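(* Let $1\le p<\infty$. A Banach space $X$ does not contain a copy of $\ell_1$ if and only if $X^*$ has the weak $p$-GP property.
   Context: $X$ contains a copy of $\ell_1$ if it has a closed subspace isomorphic to $\ell_1$. A sequence $(z_n^* )_n$ in the dual $Z^*$ of a Banach space $Z$ is weak* $p$-summable if $(z_n^*(z))_n\in\ell_p$ for every $z\in Z$. A subset $A$ of $Z$ is $p$-limited if for every weak* $p$-summable sequence $(z_n^* )_n\subset Z^*$ there is $(a_n)_n\in\ell_p$ with $|z_n^*(z)|\le a_n$ for all $z\in A$ and $n\in\mathbb{N}$. A Banach space $Z$ has the weak $p$-GP property if every $p$-limited subset of $Z$ is relatively compact. *)

theory Defs
  imports "HOL-Analysis.Analysis"
begin

definition ell :: "real \<Rightarrow> (nat \<Rightarrow> real) set" where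
  "ell p = {a. summable (\<lambda>n. \<bar>a n\<bar> powr p)}"

lemma ell_1_iff: "a \<in> ell 1 \<longleftrightarrow> summable (\<lambda>n. \<bar>a n\<bar>)"
  by (simp add: ell_def)


subsection \<open>The Banach space \<open>\<ell>\<^sub>1\<close>\<close>

typedef ell1 = "ell 1" morphisms seq Abs_ell1
  by (rule exI[of _ "\<lambda>_. 0"]) (simp add: ell_def)

setup_lifting type_definition_ell1

lemma summable_abs_seq: "summable (\<lambda>n. \<bar>seq x n\<bar>)"
  using seq[of x] by (simp add: ell_1_iff)

instantiation ell1 :: real_normed_vector
begin

lift_definition zero_ell1 :: ell1 is "\<lambda>_. 0"
  by (simp add: ell_def)

lift_definition plus_ell1 :: "ell1 \<Rightarrow> ell1 \<Rightarrow> ell1" is "\<lambda>x y n. x n + y n"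
proof -
  fix x y :: "nat \<Rightarrow> real"
  assume "x \<in> ell 1" "y \<in> ell 1"
  then have "summable (\<lambda>n. \<bar>x n\<bar> + \<bar>y n\<bar>)"
    by (simp add: ell_1_iff summable_add)
  then show "(\<lambda>n. x n + y n) \<in> ell 1"
    unfolding ell_1_iff by (rule summable_comparison_test'[where N = 0]) (simp add: abs_triangle_ineq)
qed

lift_definition uminus_ell1 :: "ell1 \<Rightarrow> ell1" is "\<lambda>x n. - x n"
  by (simp add: ell_def)

lift_definition minus_ell1 :: "ell1 \<Rightarrow> ell1 \<Rightarrow> ell1" is "\<lambda>x y n. x n - y n"
proof -
  fix x y :: "nat \<Rightarrow> real"
  assume "x \<in> ell 1" "y \<in> ell 1"
  then have "summable (\<lambda>n. \<bar>x n\<bar> + \<bar>y n\<bar>)"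
    by (simp add: ell_1_iff summable_add)
  then show "(\<lambda>n. x n - y n) \<in> ell 1"
    unfolding ell_1_iff by (rule summable_comparison_test'[where N = 0]) (simp add: abs_triangle_ineq4)
qed

lift_definition scaleR_ell1 :: "real \<Rightarrow> ell1 \<Rightarrow> ell1" is "\<lambda>c x n. c * x n"
  by (auto simp: ell_1_iff abs_mult intro: summable_mult)

definition norm_ell1 :: "ell1 \<Rightarrow> real" where
  "norm x = (\<Sum>n. \<bar>seq x n\<bar>)"

definition sgn_ell1 :: "ell1 \<Rightarrow> ell1" where
  "sgn (x::ell1) = inverse (norm x) *\<^sub>R x"

definition dist_ell1 :: "ell1 \<Rightarrow> ell1 \<Rightarrow> real" where
  "dist (x::ell1) y = norm (x - y)"

definition uniformity_ell1 :: "(ell1 \<times> ell1) filter" where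
  "(uniformity :: (ell1 \<times> ell1) filter) = (INF e\<in>{0 <..}. principal {(x, y). dist x y < e})"

definition open_ell1 :: "ell1 set \<Rightarrow> bool" where
  "open (U :: ell1 set) \<longleftrightarrow> (\<forall>x\<in>U. \<forall>\<^sub>F (x', y) in uniformity. x' = x \<longrightarrow> y \<in> U)"

instance
proof
  fix x y z :: ell1 and a b :: real
  show "x + y + z = x + (y + z)" by transfer (simp add: algebra_simps)
  show "x + y = y + x" by transfer (simp add: algebra_simps)
  show "0 + x = x" by transfer simp
  show "- x + x = 0" by transfer simp
  show "x - y = x + - y" by transfer simp
  show "a *\<^sub>R (x + y) = a *\<^sub>R x + a *\<^sub>R y" by transfer (simp add: algebra_simps)
  show "(a + b) *\<^sub>R x = a *\<^sub>R x + b *\<^sub>R x" by transfer (simp add: algebra_simps)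
  show "a *\<^sub>R b *\<^sub>R x = (a * b) *\<^sub>R x" by transfer (simp add: algebra_simps)
  show "1 *\<^sub>R x = x" by transfer simp
  show "dist x y = norm (x - y)" by (rule dist_ell1_def)
  show "sgn x = inverse (norm x) *\<^sub>R x" by (rule sgn_ell1_def)
  show "(uniformity :: (ell1 \<times> ell1) filter) = (INF e\<in>{0 <..}. principal {(x, y). dist x y < e})"
    by (rule uniformity_ell1_def)
  show "open U \<longleftrightarrow> (\<forall>x\<in>U. \<forall>\<^sub>F (x', y) in uniformity. x' = x \<longrightarrow> y \<in> U)" for U :: "ell1 set"
    by (rule open_ell1_def)
  have "norm x = 0 \<longleftrightarrow> (\<forall>n. seq x n = 0)"
    unfolding norm_ell1_def using suminf_eq_zero_iff[OF summable_abs_seq[of x]] by simp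
  also have "\<dots> \<longleftrightarrow> x = 0" by transfer auto
  finally show "norm x = 0 \<longleftrightarrow> x = 0" .
  show "norm (x + y) \<le> norm x + norm y"
    unfolding norm_ell1_def suminf_add[OF summable_abs_seq summable_abs_seq]
    by (rule suminf_le[OF _ summable_abs_seq summable_add[OF summable_abs_seq summable_abs_seq]])
      (simp add: plus_ell1.rep_eq abs_triangle_ineq)
  show "norm (a *\<^sub>R x) = \<bar>a\<bar> * norm x"
    by (simp add: norm_ell1_def scaleR_ell1.rep_eq abs_mult suminf_mult summable_abs_seq)
qed

end

instance ell1 :: banach
proof
  fix X :: "nat \<Rightarrow> ell1"
  assume X: "Cauchy X"
  have le: "(\<Sum>k<m. \<bar>seq x k\<bar>) \<le> norm x" for x m
    unfolding norm_ell1_def by (rule sum_le_suminf[OF summable_abs_seq]) auto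
  have coord: "\<bar>seq x k\<bar> \<le> norm x" for x k
    using le[of x "Suc k"] sum_abs_ge_zero[of "seq x" "{..<k}"]
    unfolding sum.lessThan_Suc by linarith
  have "Cauchy (\<lambda>n. seq (X n) k)" for k
    unfolding Cauchy_iff
  proof (intro allI impI)
    fix e :: real assume "e > 0"
    then obtain M where M: "\<And>m n. m \<ge> M \<Longrightarrow> n \<ge> M \<Longrightarrow> norm (X m - X n) < e"
      using X unfolding Cauchy_iff by blast
    have "norm (seq (X m) k - seq (X n) k) < e" if "m \<ge> M" "n \<ge> M" for m n
      using coord[of "X m - X n" k] M[OF that] by (simp add: minus_ell1.rep_eq)
    then show "\<exists>M. \<forall>m\<ge>M. \<forall>n\<ge>M. norm (seq (X m) k - seq (X n) k) < e" by blast
  qed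
  then have "\<exists>l. (\<lambda>n. seq (X n) k) \<longlonglongrightarrow> l" for k
    using Cauchy_convergent_iff convergent_def by blast
  then obtain l where l: "\<And>k. (\<lambda>n. seq (X n) k) \<longlonglongrightarrow> l k" by metis
  have tail: "\<exists>M. \<forall>n\<ge>M. \<forall>m. (\<Sum>k<m. \<bar>seq (X n) k - l k\<bar>) \<le> e" if e: "e > 0" for e :: real
  proof -
    obtain M where M: "\<And>m n. m \<ge> M \<Longrightarrow> n \<ge> M \<Longrightarrow> norm (X m - X n) < e"
      using X e unfolding Cauchy_iff by blast
    have "(\<Sum>k<m. \<bar>seq (X n) k - l k\<bar>) \<le> e" if n: "n \<ge> M" for n m
    proof (rule tendsto_upperbound)
      show "(\<lambda>j. \<Sum>k<m. \<bar>seq (X n) k - seq (X j) k\<bar>) \<longlonglongrightarrow> (\<Sum>k<m. \<bar>seq (X n) k - l k\<bar>)"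
        by (intro tendsto_intros l)
      show "\<forall>\<^sub>F j in sequentially. (\<Sum>k<m. \<bar>seq (X n) k - seq (X j) k\<bar>) \<le> e"
        using eventually_ge_at_top[of M]
      proof eventually_elim
        case (elim j)
        then show ?case
          using le[of "X n - X j" m] M[OF n elim] by (simp add: minus_ell1.rep_eq)
      qed
    qed simp
    then show ?thesis by blast
  qed
  obtain N where N: "\<And>m. (\<Sum>k<m. \<bar>seq (X N) k - l k\<bar>) \<le> 1"
    using tail[of 1] by auto
  have "summable (\<lambda>k. \<bar>seq (X N) k - l k\<bar>)"
    by (rule summableI_nonneg_bounded[OF _ N]) simp
  then have "summable (\<lambda>k. \<bar>seq (X N) k\<bar> + \<bar>seq (X N) k - l k\<bar>)"
    by (rule summable_add[OF summable_abs_seq])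
  then have "summable (\<lambda>k. \<bar>l k\<bar>)"
    by (rule summable_comparison_test'[where N = 0]) simp
  then have "l \<in> ell 1" by (simp add: ell_1_iff)
  then have L: "seq (Abs_ell1 l) = l" by (rule Abs_ell1_inverse)
  have "X \<longlonglongrightarrow> Abs_ell1 l"
  proof (rule LIMSEQ_I)
    fix r :: real assume "r > 0"
    then obtain M where M: "\<And>n m. n \<ge> M \<Longrightarrow> (\<Sum>k<m. \<bar>seq (X n) k - l k\<bar>) \<le> r / 2"
      using tail[of "r / 2"] by auto
    have "norm (X n - Abs_ell1 l) < r" if "n \<ge> M" for n
    proof -
      have "norm (X n - Abs_ell1 l) \<le> r / 2"
        unfolding norm_ell1_def
        by (rule suminf_le_const[OF summable_abs_seq]) (use M[OF that] L in \<open>simp add: minus_ell1.rep_eq\<close>)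
      then show ?thesis using \<open>r > 0\<close> by simp
    qed
    then show "\<exists>M. \<forall>n\<ge>M. norm (X n - Abs_ell1 l) < r" by blast
  qed
  then show "convergent X" by (rule convergentI)
qed


subsection \<open>Banach space properties\<close>

text \<open>All Banach spaces are real. The dual of a space of type \<open>'a\<close> is the type
  \<open>'a \<Rightarrow>\<^sub>L real\<close> with the operator norm. Properties of a space as a whole
  take the type as an argument, in the form \<open>TYPE('a)\<close>.\<close>

definition contains_copy_of_ell1 :: "'a::banach itself \<Rightarrow> bool" where
  "contains_copy_of_ell1 _ \<longleftrightarrow>
     (\<exists>(Y :: 'a set) (T :: ell1 \<Rightarrow> 'a) S.
        subspace Y \<and> closed Y \<and> linear T \<and> homeomorphism UNIV Y T S)"

definition weak_star_summable :: "real \<Rightarrow> (nat \<Rightarrow> 'z::banach \<Rightarrow>\<^sub>L real) \<Rightarrow> bool" where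
  "weak_star_summable p f \<longleftrightarrow> (\<forall>z. (\<lambda>n. blinfun_apply (f n) z) \<in> ell p)"

definition limited :: "real \<Rightarrow> 'z::banach set \<Rightarrow> bool" where
  "limited p A \<longleftrightarrow>
     (\<forall>f :: nat \<Rightarrow> 'z \<Rightarrow>\<^sub>L real. weak_star_summable p f \<longrightarrow>
        (\<exists>a\<in>ell p. \<forall>z\<in>A. \<forall>n. \<bar>blinfun_apply (f n) z\<bar> \<le> a n))"

definition weak_GP_property :: "real \<Rightarrow> 'z::banach itself \<Rightarrow> bool" where
  "weak_GP_property p _ \<longleftrightarrow> (\<forall>A :: 'z set. limited p A \<longrightarrow> compact (closure A))"

end

theory Submission
  imports Defs "HOL-Library.Function_Algebras"
begin

text \<open>
  Write \<open>X\<close> for the Banach space and \<open>B\<close> for the closed unit ball of its dual.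

  Suppose first that \<open>A\<close> is a \<open>p\<close>-limited subset of the dual which is not relatively compact; a copy
  of \<open>\<ell>\<^sub>1\<close> in \<open>X\<close> has to be produced. Applying \<open>p\<close>-limitedness to evaluations at points of \<open>X\<close>, and
  concatenating finite families, one finds that evaluation on \<open>A\<close> is a \<open>p\<close>-summing map from \<open>X\<close> to
  the bounded functions on \<open>A\<close> (\<open>limited_imp_summing\<close>). This map does not send the unit ball of \<open>X\<close> to
  a totally bounded set, so there are \<open>x\<^sub>n\<close> in the unit ball whose images are uniformly separated
  (\<open>not_relatively_compact_imp_separated\<close>). As in the Pietsch domination theorem, Hahn-Banach
  yields a finitely additive mean \<open>T\<close> on the functions on \<open>B\<close> with \<open>T (\<bar>x\<^sub>n - x\<^sub>m\<bar> powr p)\<close> bounded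
  below for \<open>n \<noteq> m\<close> (\<open>summing_imp_mean\<close>). So the \<open>x\<^sub>n\<close> form a uniformly bounded sequence of
  functions on \<open>B\<close> without convergent subsequence in \<open>L\<^sup>2(T)\<close>.

  Such a sequence contains a subsequence equivalent to the unit vectors of \<open>\<ell>\<^sub>1\<close> in the supremum
  norm. For some \<open>r\<close> and \<open>h > 0\<close>, let \<open>a\<^sub>n\<close> and \<open>b\<^sub>n\<close> be the indicator functions of \<open>x\<^sub>n < r\<close> and
  of \<open>x\<^sub>n > r + h\<close>, and let \<open>\<alpha>\<close>, \<open>\<beta>\<close> be their weak limits along a free ultrafilter. Separation
  forces \<open>\<alpha> \<beta>\<close> to be nonzero for suitable \<open>r\<close>, \<open>h\<close> (\<open>separated_imp_oscillation\<close>). If \<open>\<alpha> \<beta>\<close> has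
  positive integral over a set \<open>E\<close>, then so does \<open>\<alpha>\<^sup>2 \<beta>\<close>, whence \<open>\<alpha> \<beta>\<close> has positive integral over
  the part of \<open>E\<close> where \<open>a\<^sub>n = 1\<close> for almost all \<open>n\<close>; likewise for \<open>b\<^sub>n\<close>. Splitting repeatedly
  all the sets constructed so far produces a subsequence for which every pattern of conditions
  \<open>x\<^sub>n < r\<close>, \<open>x\<^sub>n > r + h\<close> is realised at a point of \<open>B\<close>
  (\<open>oscillation_imp_independent_subsequence\<close>), and Rosenthal's classical argument turns this
  Boolean independence into a lower \<open>\<ell>\<^sub>1\<close> estimate. The measure is used to find the independent
  subsequence directly, so the Ramsey argument in the dichotomy of Rosenthal is avoided.
  Since \<open>T\<close> is only finitely additive, \<open>\<alpha>\<close> and \<open>\<beta>\<close> need not be functions; the functionals that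
  they represent are used instead (\<open>weighted_limit\<close>).

  Conversely, let \<open>e\<^sub>m\<close> span a copy of \<open>\<ell>\<^sub>1\<close>. Hahn-Banach extends every pattern of signs
  \<open>e\<^sub>m \<mapsto> \<plusminus> 1\<close> to a functional on \<open>X\<close> with a common norm bound; averaging these functionals against
  the Rademacher functions gives \<open>a\<^sub>n\<close> in the dual with \<open>a\<^sub>n(e\<^sub>m)\<close> equal to \<open>1\<close> if \<open>n = m\<close> and to
  \<open>0\<close> otherwise, so that the \<open>a\<^sub>n\<close> are not relatively compact. They are the images of the
  Rademacher functions under a bounded operator from \<open>L\<^sup>1\<close> to the dual, and the Rademacher functions
  form a \<open>p\<close>-limited set because the inclusion of \<open>L\<^sup>\<infinity>\<close> in \<open>L\<^sup>p\<close> is \<open>p\<close>-summing; concretely, this is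
  Jensen's inequality over a dyadic tree of functionals (\<open>bounded_tree_averages_limited\<close>).
\<close>

section \<open>The Hahn-Banach theorem\<close>

definition sublinear_on :: "'v::real_vector set \<Rightarrow> ('v \<Rightarrow> real) \<Rightarrow> bool" where
  "sublinear_on E q \<longleftrightarrow> (\<forall>x\<in>E. \<forall>y\<in>E. q (x + y) \<le> q x + q y) \<and>
     (\<forall>x\<in>E. \<forall>c\<ge>0. q (c *\<^sub>R x) = c * q x)"

lemma sublinear_onI:
  assumes E: "subspace E"
    and add: "\<And>x y. x \<in> E \<Longrightarrow> y \<in> E \<Longrightarrow> q (x + y) \<le> q x + q y"
    and scale: "\<And>x c. x \<in> E \<Longrightarrow> c > 0 \<Longrightarrow> q (c *\<^sub>R x) \<le> c * q x"
    and zero: "q 0 = 0"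
  shows "sublinear_on E q"
proof -
  have "q (c *\<^sub>R x) = c * q x" if "x \<in> E" "c \<ge> 0" for x c
  proof (cases "c = 0")
    case False
    then have c: "c > 0" using that by simp
    have "q (inverse c *\<^sub>R (c *\<^sub>R x)) \<le> inverse c * q (c *\<^sub>R x)"
      using c that E by (intro scale) (auto simp: subspace_def)
    then have "c * q x \<le> q (c *\<^sub>R x)" using c by (simp add: field_simps)
    with scale[OF that(1) c] show ?thesis by simp
  qed (simp add: zero)
  then show ?thesis using add by (auto simp: sublinear_on_def)
qed

lemma sublinear_on_lower_bound:
  assumes E: "subspace E" and q: "sublinear_on E q" and x: "x \<in> E"
  shows "- q (- x) \<le> q x"
proof -
  have "q (0 *\<^sub>R x) = 0 * q x" using q x unfolding sublinear_on_def by blast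
  moreover have "q (x + - x) \<le> q x + q (- x)"
    using q x subspace_neg[OF E x] unfolding sublinear_on_def by blast
  ultimately show ?thesis by simp
qed

text \<open>A minimal sublinear functional is additive: for fixed \<open>x\<close>, the infimum of
  \<open>q (y + t *\<^sub>R x) - t * q x\<close> over \<open>t \<ge> 0\<close> is again a sublinear functional of \<open>y\<close> below \<open>q\<close>, hence
  equal to \<open>q\<close>, and \<open>t = 1\<close> gives superadditivity in the direction \<open>x\<close>.\<close>

lemma minimal_sublinear_additive:
  assumes E: "subspace E" and q: "sublinear_on E q" and x: "x \<in> E" and y: "y \<in> E"
    and minimal: "\<And>r. sublinear_on E r \<Longrightarrow> (\<And>z. z \<in> E \<Longrightarrow> r z \<le> q z) \<Longrightarrow> (\<And>z. z \<in> E \<Longrightarrow> r z = q z)"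
  shows "q (x + y) = q x + q y"
proof -
  have tx: "y + t *\<^sub>R x \<in> E" if "y \<in> E" for y t
    using E x that by (simp add: subspace_add subspace_scale)
  have qadd: "q (u + v) \<le> q u + q v" if "u \<in> E" "v \<in> E" for u v
    using q that by (simp add: sublinear_on_def)
  have qsc: "q (c *\<^sub>R u) = c * q u" if "u \<in> E" "c \<ge> 0" for u c
    using q that by (simp add: sublinear_on_def)
  define r where "r y = (INF t\<in>{0::real..}. q (y + t *\<^sub>R x) - t * q x)" for y
  have bdd: "bdd_below ((\<lambda>t. q (y + t *\<^sub>R x) - t * q x) ` {0..})" if y: "y \<in> E" for y
  proof (rule bdd_belowI2)
    fix t :: real assume t: "t \<in> {0..}"
    have "q ((y + t *\<^sub>R x) + - y) \<le> q (y + t *\<^sub>R x) + q (- y)"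
      using tx y E by (intro qadd) (auto simp: subspace_neg)
    then have "t * q x \<le> q (y + t *\<^sub>R x) + q (- y)"
      using qsc[OF x, of t] t by simp
    then show "- q (- y) \<le> q (y + t *\<^sub>R x) - t * q x" by simp
  qed
  have low: "r y \<le> q (y + t *\<^sub>R x) - t * q x" if "y \<in> E" "t \<ge> 0" for y t
    unfolding r_def using that by (intro cINF_lower bdd) auto
  have great: "b \<le> r y" if "\<And>t. t \<ge> 0 \<Longrightarrow> b \<le> q (y + t *\<^sub>R x) - t * q x" for b y
    unfolding r_def using that by (intro cINF_greatest) auto
  have "sublinear_on E r"
  proof (rule sublinear_onI[OF E])
    fix y z assume y: "y \<in> E" and z: "z \<in> E"
    have "r (y + z) - r z \<le> r y"
    proof (rule great)
      fix t :: real assume t: "t \<ge> 0"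
      have "r (y + z) - (q (y + t *\<^sub>R x) - t * q x) \<le> r z"
      proof (rule great)
        fix s :: real assume s: "s \<ge> 0"
        have "r (y + z) \<le> q ((y + z) + (t + s) *\<^sub>R x) - (t + s) * q x"
          using y z E t s by (intro low) (auto simp: subspace_add)
        also have "(y + z) + (t + s) *\<^sub>R x = (y + t *\<^sub>R x) + (z + s *\<^sub>R x)"
          by (simp add: algebra_simps)
        also have "q \<dots> \<le> q (y + t *\<^sub>R x) + q (z + s *\<^sub>R x)"
          using tx y z by (intro qadd) auto
        finally show "r (y + z) - (q (y + t *\<^sub>R x) - t * q x) \<le> q (z + s *\<^sub>R x) - s * q x"
          by (simp add: algebra_simps)
      qed
      then show "r (y + z) - r z \<le> q (y + t *\<^sub>R x) - t * q x" by simp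
    qed
    then show "r (y + z) \<le> r y + r z" by simp
  next
    fix y and c :: real assume y: "y \<in> E" and c: "c > 0"
    have "r (c *\<^sub>R y) / c \<le> r y"
    proof (rule great)
      fix t :: real assume t: "t \<ge> 0"
      have "r (c *\<^sub>R y) \<le> q (c *\<^sub>R y + (c * t) *\<^sub>R x) - (c * t) * q x"
        using y c t E by (intro low) (auto simp: subspace_scale)
      also have "c *\<^sub>R y + (c * t) *\<^sub>R x = c *\<^sub>R (y + t *\<^sub>R x)"
        by (simp add: algebra_simps)
      also have "q \<dots> = c * q (y + t *\<^sub>R x)" using tx[OF y] c by (intro qsc) auto
      finally show "r (c *\<^sub>R y) / c \<le> q (y + t *\<^sub>R x) - t * q x"
        using c by (simp add: field_simps)
    qed
    then show "r (c *\<^sub>R y) \<le> c * r y" using c by (simp add: field_simps)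
  next
    have "r 0 \<le> q (0 + 0 *\<^sub>R x) - 0 * q x" using E by (intro low) (auto simp: subspace_0)
    moreover have "q (0 *\<^sub>R x) = 0 * q x" by (rule qsc) (use x in auto)
    moreover have "0 \<le> r 0" by (rule great) (use qsc[OF x] in simp)
    ultimately show "r 0 = 0" by simp
  qed
  moreover have "r z \<le> q z" if "z \<in> E" for z
    using low[OF that, of 0] by simp
  ultimately have "q y = r y" using minimal y by metis
  then have "q y \<le> q (y + x) - q x" using low[OF y, of 1] by simp
  with qadd[OF x y] show ?thesis by (simp add: add.commute)
qed

text \<open>By Zorn's lemma there is a minimal sublinear functional below \<open>p\<close>; it is linear. The functionals
  are normalised to vanish off \<open>E\<close>, so that pointwise comparison on the whole type is
  antisymmetric. The version on a subspace is needed because the supremum of a function is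
  available only on the space of bounded functions.\<close>

theorem sublinear_dominates_linear:
  assumes E: "subspace E" and p: "sublinear_on E p"
  obtains L where "\<And>x y. x \<in> E \<Longrightarrow> y \<in> E \<Longrightarrow> L (x + y) = L x + L y"
    "\<And>c x. x \<in> E \<Longrightarrow> L (c *\<^sub>R x) = c * L x" "\<And>x. x \<in> E \<Longrightarrow> L x \<le> p x"
proof -
  define A where "A = {q. sublinear_on E q \<and> (\<forall>x\<in>E. q x \<le> p x) \<and> (\<forall>x. x \<notin> E \<longrightarrow> q x = 0)}"
  have "\<exists>m\<in>A. \<forall>a\<in>A. a \<le> m \<longrightarrow> a = m"
  proof (rule predicate_Zorn)
    show "partial_order_on A (relation_of (\<lambda>q r. r \<le> q) A)"
      by (rule partial_order_on_relation_ofI) auto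
    fix C assume C: "C \<in> Chains (relation_of (\<lambda>q r. r \<le> q) A)"
    then have CA: "C \<subseteq> A" and tot: "\<And>a b. a \<in> C \<Longrightarrow> b \<in> C \<Longrightarrow> a \<le> b \<or> b \<le> a"
      by (auto simp: Chains_def relation_of_def)
    show "\<exists>u\<in>A. \<forall>a\<in>C. u \<le> a"
    proof (cases "C = {}")
      case True
      have "sublinear_on E (\<lambda>x. if x \<in> E then p x else 0)"
        using p E by (auto simp: sublinear_on_def subspace_add subspace_scale)
      then show ?thesis
        using True by (auto simp: A_def intro!: exI[of _ "\<lambda>x. if x \<in> E then p x else 0"])
    next
      case False
      define Q where "Q x = (INF q\<in>C. q x)" for x
      have bdd: "bdd_below ((\<lambda>q. q x) ` C)" for x
      proof (cases "x \<in> E")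
        case True
        show ?thesis
        proof (rule bdd_belowI2)
          fix q assume "q \<in> C"
          then have "q \<in> A" using CA by blast
          then have "- q (- x) \<le> q x" and "q (- x) \<le> p (- x)"
            using sublinear_on_lower_bound[OF E _ True] subspace_neg[OF E True]
            by (auto simp: A_def)
          then show "- p (- x) \<le> q x" by simp
        qed
      next
        case False
        then show ?thesis using CA by (intro bdd_belowI2[where m = 0]) (auto simp: A_def)
      qed
      have low: "Q x \<le> q x" if "q \<in> C" for q x
        unfolding Q_def using that bdd by (intro cINF_lower)
      have great: "b \<le> Q x" if "\<And>q. q \<in> C \<Longrightarrow> b \<le> q x" for b x
        unfolding Q_def using that False by (intro cINF_greatest)
      have sub: "sublinear_on E q" if "q \<in> C" for q using that CA by (auto simp: A_def)
      obtain q0 where q0: "q0 \<in> C" using False by blast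
      have "sublinear_on E Q"
      proof (rule sublinear_onI[OF E])
        fix x y assume x: "x \<in> E" and y: "y \<in> E"
        have "Q (x + y) - Q y \<le> Q x"
        proof (rule great)
          fix q1 assume q1: "q1 \<in> C"
          have "Q (x + y) - q1 x \<le> Q y"
          proof (rule great)
            fix q2 assume q2: "q2 \<in> C"
            \<comment> \<open>subadditivity of the smaller of the two members of the chain suffices\<close>
            obtain q where q: "q \<in> C" "q \<le> q1" "q \<le> q2" using tot[OF q1 q2] q1 q2 by auto
            have "Q (x + y) \<le> q (x + y)" using low q by blast
            also have "\<dots> \<le> q x + q y" using sub[OF q(1)] x y by (auto simp: sublinear_on_def)
            also have "\<dots> \<le> q1 x + q2 y" using q by (intro add_mono) (auto simp: le_fun_def)
            finally show "Q (x + y) - q1 x \<le> q2 y" by simp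
          qed
          then show "Q (x + y) - Q y \<le> q1 x" by simp
        qed
        then show "Q (x + y) \<le> Q x + Q y" by simp
      next
        fix x and c :: real assume x: "x \<in> E" and c: "c > 0"
        have "Q (c *\<^sub>R x) / c \<le> Q x"
        proof (rule great)
          fix q assume q: "q \<in> C"
          have "Q (c *\<^sub>R x) \<le> c * q x"
            using low[OF q, of "c *\<^sub>R x"] sub[OF q] x c by (simp add: sublinear_on_def)
          then show "Q (c *\<^sub>R x) / c \<le> q x" using c by (simp add: field_simps)
        qed
        then show "Q (c *\<^sub>R x) \<le> c * Q x" using c by (simp add: field_simps)
      next
        have "q 0 = 0" if "q \<in> C" for q
        proof -
          have "q (0 *\<^sub>R 0) = 0 * q 0"
            using sub[OF that] subspace_0[OF E] unfolding sublinear_on_def by blast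
          then show ?thesis by simp
        qed
        then show "Q 0 = 0" using low[OF q0, of 0] q0 great[of 0 0] by force
      qed
      moreover have "Q x \<le> p x" if "x \<in> E" for x
        using low[OF q0, of x] q0 CA that by (force simp: A_def)
      moreover have "Q x = 0" if "x \<notin> E" for x
      proof -
        have "q x = 0" if "q \<in> C" for q using that \<open>x \<notin> E\<close> CA by (auto simp: A_def)
        then show ?thesis using low[OF q0, of x] q0 great[of 0 x] by force
      qed
      ultimately show ?thesis using low by (auto simp: A_def le_fun_def)
    qed
  qed
  then obtain q where q: "q \<in> A" and min: "\<And>a. a \<in> A \<Longrightarrow> a \<le> q \<Longrightarrow> a = q" by blast
  have qs: "sublinear_on E q" using q by (simp add: A_def)
  have add: "q (x + y) = q x + q y" if "x \<in> E" "y \<in> E" for x y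
  proof (rule minimal_sublinear_additive[OF E qs that])
    fix r z assume r: "sublinear_on E r" "\<And>z. z \<in> E \<Longrightarrow> r z \<le> q z" and z: "z \<in> E"
    define r' where "r' x = (if x \<in> E then r x else 0)" for x
    have "sublinear_on E r'"
      using r(1) E by (auto simp: r'_def sublinear_on_def subspace_add subspace_scale)
    moreover have "r' \<le> q" using r(2) q by (auto simp: r'_def le_fun_def A_def)
    moreover have "r' x \<le> p x" if "x \<in> E" for x
    proof -
      have "q x \<le> p x" using q that by (simp add: A_def)
      with r(2)[OF that] that show ?thesis by (simp add: r'_def)
    qed
    ultimately have "r' \<in> A" by (simp add: A_def r'_def)
    then have "r' = q" using \<open>r' \<le> q\<close> by (rule min)
    moreover have "r z = r' z" using z by (simp add: r'_def)
    ultimately show "r z = q z" by simp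
  qed
  have scale: "q (c *\<^sub>R x) = c * q x" if x: "x \<in> E" for c x
  proof (cases "c \<ge> 0")
    case True
    then show ?thesis using qs x by (simp add: sublinear_on_def)
  next
    case False
    have z: "q (0 *\<^sub>R x) = 0 * q x" using qs x unfolding sublinear_on_def by blast
    have "q (c *\<^sub>R x + (- c) *\<^sub>R x) = q (c *\<^sub>R x) + q ((- c) *\<^sub>R x)"
      using x E by (intro add) (auto simp: subspace_scale subspace_neg)
    moreover have "q ((- c) *\<^sub>R x) = (- c) * q x"
      using qs[unfolded sublinear_on_def, THEN conjunct2, rule_format, OF x, of "- c"] False by simp
    ultimately show ?thesis using z by simp
  qed
  have "q x \<le> p x" if "x \<in> E" for x using q that by (simp add: A_def)
  with add scale show thesis by (rule that)
qed

text \<open>The norm-preserving extension follows by taking for the sublinear functional the infimal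
  convolution of \<open>C * norm\<close> and \<open>g\<close>: a linear functional below it is at most \<open>g\<close> on the
  subspace \<open>Y\<close>, hence equal to \<open>g\<close> there.\<close>

theorem bounded_functional_extension:
  fixes g :: "'a::real_normed_vector \<Rightarrow> real"
  assumes Y: "subspace Y" and C: "C \<ge> 0"
    and add: "\<And>x y. x \<in> Y \<Longrightarrow> y \<in> Y \<Longrightarrow> g (x + y) = g x + g y"
    and scale: "\<And>c x. x \<in> Y \<Longrightarrow> g (c *\<^sub>R x) = c * g x"
    and bound: "\<And>x. x \<in> Y \<Longrightarrow> \<bar>g x\<bar> \<le> C * norm x"
  obtains f :: "'a \<Rightarrow>\<^sub>L real" where "\<And>x. x \<in> Y \<Longrightarrow> blinfun_apply f x = g x" "norm f \<le> C"
proof -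
  define p where "p x = (INF y\<in>Y. C * norm (x - y) + g y)" for x
  have gneg: "g (- y) = - g y" if "y \<in> Y" for y using scale[OF that, of "-1"] by simp
  have g0: "g 0 = 0" using scale[of 0 0] subspace_0[OF Y] by simp
  have lb: "- (C * norm x) \<le> C * norm (x - y) + g y" if y: "y \<in> Y" for x y
  proof -
    have "norm y \<le> norm x + norm (x - y)"
      using norm_triangle_sub[of y x] by (simp add: norm_minus_commute)
    then have "C * norm y \<le> C * norm x + C * norm (x - y)"
      using C by (metis distrib_left mult_left_mono)
    with bound[OF y] show ?thesis by linarith
  qed
  have low: "p x \<le> C * norm (x - y) + g y" if "y \<in> Y" for x y
    unfolding p_def using that lb by (intro cINF_lower bdd_belowI2) auto
  have great: "b \<le> p x" if "\<And>y. y \<in> Y \<Longrightarrow> b \<le> C * norm (x - y) + g y" for b x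
    unfolding p_def using that subspace_0[OF Y] by (intro cINF_greatest) auto
  have "sublinear_on UNIV p"
  proof (rule sublinear_onI)
    fix x z :: 'a
    have "p (x + z) - p z \<le> p x"
    proof (rule great)
      fix y assume y: "y \<in> Y"
      have "p (x + z) - (C * norm (x - y) + g y) \<le> p z"
      proof (rule great)
        fix w assume w: "w \<in> Y"
        have "p (x + z) \<le> C * norm ((x + z) - (y + w)) + g (y + w)"
          using y w Y by (intro low subspace_add)
        also have "\<dots> \<le> C * (norm (x - y) + norm (z - w)) + (g y + g w)"
          using C add[OF y w] norm_triangle_ineq[of "x - y" "z - w"]
          by (intro add_mono mult_left_mono) (auto simp: algebra_simps)
        finally show "p (x + z) - (C * norm (x - y) + g y) \<le> C * norm (z - w) + g w"
          by (simp add: algebra_simps)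
      qed
      then show "p (x + z) - p z \<le> C * norm (x - y) + g y" by simp
    qed
    then show "p (x + z) \<le> p x + p z" by simp
  next
    fix x :: 'a and c :: real assume c: "c > 0"
    have "p (c *\<^sub>R x) / c \<le> p x"
    proof (rule great)
      fix y assume y: "y \<in> Y"
      have "p (c *\<^sub>R x) \<le> C * norm (c *\<^sub>R x - c *\<^sub>R y) + g (c *\<^sub>R y)"
        using y Y by (intro low subspace_scale)
      also have "norm (c *\<^sub>R x - c *\<^sub>R y) = c * norm (x - y)"
        using c by (simp flip: scaleR_diff_right)
      finally show "p (c *\<^sub>R x) / c \<le> C * norm (x - y) + g y"
        using c scale[OF y] by (simp add: field_simps)
    qed
    then show "p (c *\<^sub>R x) \<le> c * p x" using c by (simp add: field_simps)
  next
    have "0 \<le> p 0"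
    proof (rule great)
      fix y assume "y \<in> Y"
      from bound[OF this] show "0 \<le> C * norm (0 - y) + g y" by simp
    qed
    moreover have "p 0 \<le> 0" using low[OF subspace_0[OF Y], of 0] g0 by simp
    ultimately show "p 0 = 0" by simp
  qed simp
  from sublinear_dominates_linear[OF subspace_UNIV this]
  obtain L where L: "\<And>x y. L (x + y) = L x + L y" "\<And>c x. L (c *\<^sub>R x) = c * L x" "\<And>x. L x \<le> p x"
    by (metis UNIV_I)
  have neg: "L (- x) = - L x" for x using L(2)[of "-1" x] by simp
  have "L x \<le> C * norm x" for x
    using L(3)[of x] low[OF subspace_0[OF Y], of x] g0 by simp
  from this this[of "- x" for x] have bd: "\<bar>L x\<bar> \<le> C * norm x" for x
    using neg by (simp add: abs_le_iff)
  have bl: "bounded_linear L"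
    using L bd by (intro bounded_linear_intro[where K = C]) (auto simp: mult.commute)
  have "L x \<le> g x" if "x \<in> Y" for x using L(3)[of x] low[OF that, of x] by simp
  from this this[of "- x" for x] have eq: "L x = g x" if "x \<in> Y" for x
    using that subspace_neg[OF Y that] neg gneg by (metis neg_le_iff_le order_antisym)
  show thesis
  proof (rule that[of "Blinfun L"])
    show "blinfun_apply (Blinfun L) x = g x" if "x \<in> Y" for x
      using that by (simp add: bounded_linear_Blinfun_apply[OF bl] eq)
    show "norm (Blinfun L) \<le> C"
      using C bd by (intro norm_blinfun_bound) (simp_all add: bounded_linear_Blinfun_apply[OF bl])
  qed
qed

section \<open>Finitely additive means\<close>

text \<open>Functions form a real vector space pointwise, which makes the Hahn-Banach theorem applicable to
  spaces of functions.\<close>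

instantiation "fun" :: (type, real_vector) real_vector
begin

definition scaleR_fun :: "real \<Rightarrow> ('a \<Rightarrow> 'b) \<Rightarrow> 'a \<Rightarrow> 'b" where
  "scaleR_fun c f = (\<lambda>x. c *\<^sub>R f x)"

instance
  by standard (auto simp: scaleR_fun_def fun_eq_iff scaleR_add_right scaleR_add_left)

end

definition bounded_fun :: "('k \<Rightarrow> real) \<Rightarrow> bool" where
  "bounded_fun f \<longleftrightarrow> (\<exists>M. \<forall>x. \<bar>f x\<bar> \<le> M)"

lemma bounded_funI: "(\<And>x. \<bar>f x\<bar> \<le> M) \<Longrightarrow> bounded_fun f"
  by (auto simp: bounded_fun_def)

lemma bounded_funE:
  assumes "bounded_fun f"
  obtains M where "M \<ge> 0" "\<And>x. \<bar>f x\<bar> \<le> M"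
proof -
  obtain M where M: "\<And>x. \<bar>f x\<bar> \<le> M" using assms by (auto simp: bounded_fun_def)
  have "M \<ge> 0" using M[of undefined] abs_ge_zero[of "f undefined"] by linarith
  with M that show thesis by blast
qed

lemma bounded_fun_const [simp, intro!]: "bounded_fun (\<lambda>_. c)"
  by (rule bounded_funI[of _ "\<bar>c\<bar>"]) simp

lemma bounded_fun_add [intro!]:
  assumes "bounded_fun f" "bounded_fun g" shows "bounded_fun (\<lambda>x. f x + g x)"
proof -
  obtain M N where "\<And>x. \<bar>f x\<bar> \<le> M" "\<And>x. \<bar>g x\<bar> \<le> N"
    using assms by (auto simp: bounded_fun_def)
  then have "\<bar>f x + g x\<bar> \<le> M + N" for x by (meson abs_triangle_ineq add_mono order_trans)
  then show ?thesis by (rule bounded_funI)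
qed

lemma bounded_fun_mult [intro!]:
  assumes "bounded_fun f" "bounded_fun g" shows "bounded_fun (\<lambda>x. f x * g x)"
proof -
  obtain M N where "M \<ge> 0" "\<And>x. \<bar>f x\<bar> \<le> M" "\<And>x. \<bar>g x\<bar> \<le> N"
    using bounded_funE[OF assms(1)] bounded_funE[OF assms(2)] by metis
  then have "\<bar>f x * g x\<bar> \<le> M * N" for x by (auto simp: abs_mult intro: mult_mono)
  then show ?thesis by (rule bounded_funI)
qed

lemma bounded_fun_minus [intro!]:
  assumes "bounded_fun f" shows "bounded_fun (\<lambda>x. - f x)"
  using assms by (auto simp: bounded_fun_def)

lemma bounded_fun_diff [intro!]:
  assumes "bounded_fun f" "bounded_fun g" shows "bounded_fun (\<lambda>x. f x - g x)"
  using bounded_fun_add[OF assms(1) bounded_fun_minus[OF assms(2)]] by simp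

lemma bounded_fun_power [intro!]: "bounded_fun f \<Longrightarrow> bounded_fun (\<lambda>x. f x ^ n)"
  by (induction n) auto

lemma bounded_fun_divide [intro!]: "bounded_fun f \<Longrightarrow> bounded_fun (\<lambda>x. f x / c)"
  using bounded_fun_mult[of f "\<lambda>_. inverse c"] by (simp add: field_simps)

lemma bounded_fun_sum [intro!]:
  "(\<And>i. i \<in> I \<Longrightarrow> bounded_fun (f i)) \<Longrightarrow> bounded_fun (\<lambda>x. \<Sum>i\<in>I. f i x)"
  by (induction I rule: infinite_finite_induct) auto

lemma bounded_fun_unit:
  "(\<And>x. 0 \<le> f x) \<Longrightarrow> (\<And>x. f x \<le> 1) \<Longrightarrow> bounded_fun f"
  by (rule bounded_funI[of _ 1]) auto

text \<open>A mean plays the role of integration against a finitely additive measure of mass at most one.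
  Mass below one is admitted so that a mean weighted by a function with values between \<open>0\<close> and \<open>1\<close>
  is again a mean. The laws are restricted to the bounded functions because the means arise from
  suprema and from limits, which are finite only there.\<close>

locale subprobability_mean =
  fixes T :: "('k \<Rightarrow> real) \<Rightarrow> real"
  assumes add: "bounded_fun f \<Longrightarrow> bounded_fun g \<Longrightarrow> T (\<lambda>x. f x + g x) = T f + T g"
    and scale: "bounded_fun f \<Longrightarrow> T (\<lambda>x. c * f x) = c * T f"
    and nonneg: "bounded_fun f \<Longrightarrow> (\<And>x. 0 \<le> f x) \<Longrightarrow> 0 \<le> T f"
    and one_le: "T (\<lambda>_. 1) \<le> 1"
begin

lemma minus: "bounded_fun f \<Longrightarrow> T (\<lambda>x. - f x) = - T f"
  using scale[of f "-1"] by simp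

lemma diff: "bounded_fun f \<Longrightarrow> bounded_fun g \<Longrightarrow> T (\<lambda>x. f x - g x) = T f - T g"
  using add[OF _ bounded_fun_minus, of f g] minus[of g] by simp

lemma const: "T (\<lambda>_. c) = c * T (\<lambda>_. 1)"
  using scale[of "\<lambda>_. 1" c] by simp

lemma sum: "(\<And>i. i \<in> I \<Longrightarrow> bounded_fun (f i)) \<Longrightarrow> T (\<lambda>x. \<Sum>i\<in>I. f i x) = (\<Sum>i\<in>I. T (f i))"
  by (induction I rule: infinite_finite_induct) (auto simp: const[of 0] add bounded_fun_sum)

lemma mono:
  assumes "bounded_fun f" "bounded_fun g" "\<And>x. f x \<le> g x" shows "T f \<le> T g"
proof -
  have "0 \<le> T (\<lambda>x. g x - f x)" using assms by (intro nonneg) auto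
  then show ?thesis using diff[OF assms(2,1)] by simp
qed

lemma abs_le:
  assumes M: "\<And>x. \<bar>f x\<bar> \<le> M" shows "\<bar>T f\<bar> \<le> M"
proof -
  have b: "bounded_fun f" using M by (rule bounded_funI)
  have M0: "M \<ge> 0" using M[of undefined] by linarith
  have c: "T (\<lambda>_. M) \<le> M" using const[of M] one_le mult_left_mono[OF one_le M0] by simp
  have "T f \<le> T (\<lambda>_. M)" using b M by (intro mono) (auto simp: abs_le_iff)
  moreover have "T (\<lambda>x. - f x) \<le> T (\<lambda>_. M)" using b M by (intro mono) (auto simp: abs_le_iff)
  ultimately show ?thesis using minus[OF b] c by linarith
qed

end

text \<open>A separation theorem: if no function in the convex cone \<open>G\<close> is bounded above by a negative
  constant, then some mean is nonnegative on \<open>G\<close>. The sublinear functional is the infimum of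
  \<open>sup (f + g)\<close> over \<open>g \<in> G\<close>; the condition on \<open>G\<close> keeps it from being \<open>-\<infinity>\<close>.\<close>

lemma mean_nonneg_on_cone:
  fixes G :: "('k \<Rightarrow> real) set"
  assumes bd: "\<And>g. g \<in> G \<Longrightarrow> bounded_fun g"
    and zero: "(\<lambda>_. 0) \<in> G"
    and add: "\<And>g h. g \<in> G \<Longrightarrow> h \<in> G \<Longrightarrow> (\<lambda>x. g x + h x) \<in> G"
    and scale: "\<And>g c. g \<in> G \<Longrightarrow> c > 0 \<Longrightarrow> (\<lambda>x. c * g x) \<in> G"
    and almost_nonneg: "\<And>g e. g \<in> G \<Longrightarrow> e > 0 \<Longrightarrow> \<exists>x. - e \<le> g x"
  obtains T where "subprobability_mean T" "T (\<lambda>_. 1) = 1" "\<And>g. g \<in> G \<Longrightarrow> 0 \<le> T g"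
proof -
  define E where "E = {f :: 'k \<Rightarrow> real. bounded_fun f}"
  have E: "subspace E"
    unfolding subspace_def E_def
    by (auto simp: scaleR_fun_def plus_fun_def zero_fun_def intro!: bounded_fun_add bounded_fun_mult)
  define S where "S f = {s. \<exists>g\<in>G. \<forall>x. f x + g x \<le> s}" for f
  define p where "p f = Inf (S f)" for f
  have lb: "- M \<le> s" if f: "\<And>x. \<bar>f x\<bar> \<le> M" and s: "s \<in> S f" for f M s
  proof (rule field_le_epsilon)
    fix e :: real assume "e > 0"
    obtain g where g: "g \<in> G" "\<And>x. f x + g x \<le> s" using s by (auto simp: S_def)
    obtain x where "- e \<le> g x" using almost_nonneg[OF g(1) \<open>e > 0\<close>] by blast
    with g(2)[of x] f[of x] show "- M \<le> s + e" by linarith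
  qed
  have bb: "bdd_below (S f)" if "bounded_fun f" for f
    using that lb by (meson bdd_belowI bounded_fun_def)
  have low: "p f \<le> s" if "bounded_fun f" "g \<in> G" "\<And>x. f x + g x \<le> s" for f g s
    unfolding p_def using that by (intro cInf_lower bb) (auto simp: S_def)
  have great: "b \<le> p f" if "bounded_fun f" "\<And>g s. g \<in> G \<Longrightarrow> (\<And>x. f x + g x \<le> s) \<Longrightarrow> b \<le> s" for b f
    unfolding p_def
  proof (rule cInf_greatest)
    obtain M where "\<And>x. \<bar>f x\<bar> \<le> M" using bounded_funE[OF \<open>bounded_fun f\<close>] by metis
    then have "\<forall>x. f x + 0 \<le> M" by (simp add: abs_le_iff)
    then have "M \<in> S f" using zero by (force simp: S_def)
    then show "S f \<noteq> {}" by blast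
  qed (use that in \<open>auto simp: S_def\<close>)
  have "sublinear_on E p"
  proof (rule sublinear_onI[OF E])
    fix f h assume "f \<in> E" "h \<in> E"
    then have f: "bounded_fun f" and h: "bounded_fun h" by (auto simp: E_def)
    have "p (f + h) - p h \<le> p f"
    proof (rule great[OF f])
      fix g s assume g: "g \<in> G" "\<And>x. f x + g x \<le> s"
      have "p (f + h) - s \<le> p h"
      proof (rule great[OF h])
        fix g' s' assume g': "g' \<in> G" "\<And>x. h x + g' x \<le> s'"
        have "p (f + h) \<le> s + s'"
        proof (rule low)
          show "bounded_fun (f + h)" using f h by (auto simp: plus_fun_def)
          show "(\<lambda>x. g x + g' x) \<in> G" using g g' add by blast
          show "(f + h) x + (g x + g' x) \<le> s + s'" for x
            using add_mono[OF g(2)[of x] g'(2)[of x]] by (simp add: plus_fun_def algebra_simps)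
        qed
        then show "p (f + h) - s \<le> s'" by simp
      qed
      then show "p (f + h) - p h \<le> s" by simp
    qed
    then show "p (f + h) \<le> p f + p h" by simp
  next
    fix f and c :: real assume "f \<in> E" and c: "c > 0"
    then have f: "bounded_fun f" by (simp add: E_def)
    have "p (c *\<^sub>R f) / c \<le> p f"
    proof (rule great[OF f])
      fix g s assume g: "g \<in> G" "\<And>x. f x + g x \<le> s"
      have "p (c *\<^sub>R f) \<le> c * s"
      proof (rule low)
        show "bounded_fun (c *\<^sub>R f)" using f by (auto simp: scaleR_fun_def)
        show "(\<lambda>x. c * g x) \<in> G" using g c scale by blast
        show "(c *\<^sub>R f) x + c * g x \<le> c * s" for x
          using mult_left_mono[OF g(2)[of x], of c] c by (simp add: scaleR_fun_def algebra_simps)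
      qed
      then show "p (c *\<^sub>R f) / c \<le> s" using c by (simp add: field_simps)
    qed
    then show "p (c *\<^sub>R f) \<le> c * p f" using c by (simp add: field_simps)
  next
    have "0 \<le> p (\<lambda>_. 0)"
    proof (rule great)
      fix g s assume g: "g \<in> G" "\<And>x. 0 + g x \<le> (s :: real)"
      then have "s \<in> S (\<lambda>_. 0)" by (auto simp: S_def)
      from lb[OF _ this, of 0] show "0 \<le> s" by simp
    qed simp
    moreover have "p (\<lambda>_. 0) \<le> 0" using zero by (intro low[where g = "\<lambda>_. 0"]) auto
    ultimately show "p 0 = 0" by (simp add: zero_fun_def)
  qed
  from sublinear_dominates_linear[OF E this] obtain T where
    T: "\<And>f g. f \<in> E \<Longrightarrow> g \<in> E \<Longrightarrow> T (f + g) = T f + T g"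
       "\<And>c f. f \<in> E \<Longrightarrow> T (c *\<^sub>R f) = c * T f" "\<And>f. f \<in> E \<Longrightarrow> T f \<le> p f"
    by metis
  have Tadd: "T (\<lambda>x. f x + g x) = T f + T g" if "bounded_fun f" "bounded_fun g" for f g
    using T(1)[of f g] that by (simp add: E_def plus_fun_def)
  have Tscale: "T (\<lambda>x. c * f x) = c * T f" if "bounded_fun f" for c f
    using T(2)[of f c] that by (simp add: E_def scaleR_fun_def)
  have Tle: "T f \<le> s" if "bounded_fun f" "g \<in> G" "\<And>x. f x + g x \<le> s" for f g s
    using T(3)[of f] low[OF that] that by (simp add: E_def)
  have Tle0: "T f \<le> s" if "bounded_fun f" "\<And>x. f x \<le> s" for f s
    using Tle[OF that(1) zero, of s] that(2) by simp
  have Tneg: "T (\<lambda>x. - f x) = - T f" if "bounded_fun f" for f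
    using Tscale[OF that, of "-1"] by simp
  have one: "T (\<lambda>_. 1) = 1"
    using Tle0[of "\<lambda>_. 1" 1] Tle0[of "\<lambda>_. - 1" "- 1"] Tneg[of "\<lambda>_. 1"] by simp
  have "subprobability_mean T"
  proof
    show "0 \<le> T f" if "bounded_fun f" "\<And>x. 0 \<le> f x" for f
      using Tle0[of "\<lambda>x. - f x" 0] Tneg[of f] that by auto
  qed (use Tadd Tscale one in auto)
  moreover have "0 \<le> T g" if "g \<in> G" for g
    using Tle[of "\<lambda>x. - g x" g 0] Tneg[of g] bd[OF that] that by auto
  ultimately show thesis using one that by blast
qed

section \<open>Limits along a free ultrafilter\<close>

locale free_ultrafilter =
  fixes U :: "nat filter"
  assumes proper: "U \<noteq> bot" and free: "U \<le> sequentially"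
    and ultra: "eventually P U \<or> eventually (\<lambda>n. \<not> P n) U"

text \<open>In the order of filters, an ultrafilter is a minimal proper filter.\<close>

lemma free_ultrafilter_exists: "\<exists>U. free_ultrafilter U"
proof -
  define A where "A = {F :: nat filter. F \<noteq> bot \<and> F \<le> sequentially}"
  have "\<exists>m\<in>A. \<forall>a\<in>A. a \<le> m \<longrightarrow> a = m"
  proof (rule predicate_Zorn)
    show "partial_order_on A (relation_of (\<lambda>q r. r \<le> q) A)"
      by (rule partial_order_on_relation_ofI) auto
    fix C assume C: "C \<in> Chains (relation_of (\<lambda>q r. r \<le> q) A)"
    then have CA: "C \<subseteq> A" and tot: "\<And>a b. a \<in> C \<Longrightarrow> b \<in> C \<Longrightarrow> a \<le> b \<or> b \<le> a"
      by (auto simp: Chains_def relation_of_def)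
    show "\<exists>u\<in>A. \<forall>a\<in>C. u \<le> a"
    proof (cases "C = {}")
      case True
      then show ?thesis by (intro bexI[of _ sequentially]) (auto simp: A_def)
    next
      case False
      have "eventually P (Inf C) \<longleftrightarrow> (\<exists>b\<in>C. eventually P b)" for P
      proof (rule eventually_Inf_base[OF False])
        fix F G assume "F \<in> C" "G \<in> C"
        with tot[OF this] show "\<exists>x\<in>C. x \<le> inf F G" by (auto simp: inf_absorb1 inf_absorb2)
      qed
      from this[of "\<lambda>_. False"] have "Inf C \<noteq> bot"
        using CA by (auto simp: A_def trivial_limit_def)
      moreover have "Inf C \<le> sequentially"
        using False CA by (metis (no_types, lifting) A_def Inf_lower2 ex_in_conv mem_Collect_eq subsetD)
      ultimately have "Inf C \<in> A" by (simp add: A_def)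
      then show ?thesis by (meson Inf_lower)
    qed
  qed
  then obtain F where F: "F \<in> A" and min: "\<And>G. G \<in> A \<Longrightarrow> G \<le> F \<Longrightarrow> G = F" by blast
  have "eventually P F \<or> eventually (\<lambda>n. \<not> P n) F" for P
  proof (rule disjCI)
    assume "\<not> eventually (\<lambda>n. \<not> P n) F"
    then have "inf F (principal {n. P n}) \<noteq> bot"
      by (simp add: trivial_limit_def eventually_inf_principal)
    then have "inf F (principal {n. P n}) = F"
      using F by (intro min) (simp_all add: A_def le_infI1)
    then have "F \<le> principal {n. P n}" by (rule subst) (rule inf_le2)
    then show "eventually P F" by (simp add: le_principal)
  qed
  then have "free_ultrafilter F" using F by (simp add: A_def free_ultrafilter_def)
  then show ?thesis by blast
qed

context free_ultrafilter
begin

lemma tendsto_Lim_bounded: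
  fixes u :: "nat \<Rightarrow> real"
  assumes M: "\<And>n. \<bar>u n\<bar> \<le> M"
  shows "(u \<longlongrightarrow> Lim U u) U"
proof -
  have "filtermap u U \<noteq> bot" using proper by (simp add: filtermap_bot_iff)
  moreover have "eventually (\<lambda>y. y \<in> {-M..M}) (filtermap u U)"
  proof -
    have "u n \<in> {-M..M}" for n using M[of n] by (simp add: abs_le_iff minus_le_iff)
    then show ?thesis by (simp add: eventually_filtermap)
  qed
  ultimately have "\<exists>l\<in>{-M..M}. inf (nhds l) (filtermap u U) \<noteq> bot"
    by (rule compact_filter[THEN iffD1, rule_format, OF compact_Icc])
  then obtain l where l: "inf (nhds l) (filtermap u U) \<noteq> bot" by blast
  have "(u \<longlongrightarrow> l) U"
  proof (rule topological_tendstoI)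
    fix S :: "real set" assume S: "open S" "l \<in> S"
    show "eventually (\<lambda>n. u n \<in> S) U"
    proof (rule ccontr)
      assume "\<not> eventually (\<lambda>n. u n \<in> S) U"
      then have "eventually (\<lambda>n. u n \<notin> S) U" using ultra[of "\<lambda>n. u n \<in> S"] by simp
      then have "eventually (\<lambda>y. y \<notin> S) (filtermap u U)" by (simp add: eventually_filtermap)
      moreover have "eventually (\<lambda>y. y \<in> S) (nhds l)" using S by (rule eventually_nhds_in_open)
      ultimately have "eventually (\<lambda>_. False) (inf (nhds l) (filtermap u U))"
        unfolding eventually_inf by (intro exI[of _ "\<lambda>y. y \<in> S"] exI[of _ "\<lambda>y. y \<notin> S"]) simp
      with l show False by (simp add: trivial_limit_def)
    qed
  qed
  moreover from this have "Lim U u = l" by (rule tendsto_Lim[OF proper])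
  ultimately show ?thesis by simp
qed

lemma Lim_eqI: "(u \<longlongrightarrow> l) U \<Longrightarrow> Lim U u = (l :: real)"
  by (rule tendsto_Lim[OF proper])

lemma Lim_close:
  fixes u v :: "nat \<Rightarrow> real"
  assumes "\<And>n. \<bar>u n\<bar> \<le> M" "\<And>n. \<bar>v n\<bar> \<le> N" "\<And>n. \<bar>u n - v n\<bar> \<le> d"
  shows "\<bar>Lim U u - Lim U v\<bar> \<le> d"
proof (rule tendsto_upperbound)
  show "((\<lambda>n. \<bar>u n - v n\<bar>) \<longlongrightarrow> \<bar>Lim U u - Lim U v\<bar>) U"
    by (intro tendsto_rabs tendsto_diff tendsto_Lim_bounded[OF assms(1)] tendsto_Lim_bounded[OF assms(2)])
qed (use assms(3) proper in auto)

end

section \<open>Weak limits of sequences of weights\<close>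

text \<open>If \<open>v\<^sub>j\<close> converges weakly to \<open>v\<close> along \<open>U\<close>, then \<open>weighted_limit U T v\<close> is integration against
  \<open>v\<close> with respect to \<open>T\<close>. The limit functional exists even though, \<open>T\<close> being only finitely
  additive, no function \<open>v\<close> need represent it.\<close>

definition weighted_limit ::
  "nat filter \<Rightarrow> (('k \<Rightarrow> real) \<Rightarrow> real) \<Rightarrow> (nat \<Rightarrow> 'k \<Rightarrow> real) \<Rightarrow> ('k \<Rightarrow> real) \<Rightarrow> real" where
  "weighted_limit U T v w = Lim U (\<lambda>j. T (\<lambda>x. w x * v j x))"

locale mean_along_ultrafilter = free_ultrafilter U + subprobability_mean T
  for U and T :: "('k \<Rightarrow> real) \<Rightarrow> real"
begin

lemma weighted_limit_tendsto:
  assumes v: "\<And>j x. 0 \<le> v j x" "\<And>j x. v j x \<le> 1" and w: "bounded_fun w"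
  shows "((\<lambda>j. T (\<lambda>x. w x * v j x)) \<longlongrightarrow> weighted_limit U T v w) U"
proof -
  obtain M where M: "M \<ge> 0" "\<And>x. \<bar>w x\<bar> \<le> M" using bounded_funE[OF w] by blast
  have "\<bar>T (\<lambda>x. w x * v j x)\<bar> \<le> M" for j
  proof (rule abs_le)
    show "\<bar>w x * v j x\<bar> \<le> M" for x
      using mult_mono[OF M(2)[of x] v(2)[of j x]] v(1)[of j x] M(1) by (simp add: abs_mult)
  qed
  then show ?thesis unfolding weighted_limit_def by (rule tendsto_Lim_bounded)
qed

lemma weighted_limit_le:
  assumes v: "\<And>j x. 0 \<le> v j x" "\<And>j x. v j x \<le> 1" and w: "bounded_fun w"
    and h: "bounded_fun h" "\<And>j x. w x * v j x \<le> h x"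
  shows "weighted_limit U T v w \<le> T h"
proof (rule tendsto_upperbound[OF weighted_limit_tendsto[OF v w]])
  have "bounded_fun (v j)" for j using v by (rule bounded_fun_unit)
  then show "\<forall>\<^sub>F j in U. T (\<lambda>x. w x * v j x) \<le> T h"
    using w h by (intro always_eventually allI mono) auto
qed (use proper in auto)

lemma weighted_limit_mean:
  assumes v: "\<And>j x. 0 \<le> v j x" "\<And>j x. v j x \<le> 1"
  shows "mean_along_ultrafilter U (weighted_limit U T v)"
proof (intro mean_along_ultrafilter.intro free_ultrafilter_axioms subprobability_mean.intro)
  note lim = weighted_limit_tendsto[OF v]
  have vb: "bounded_fun (v j)" for j using v by (rule bounded_fun_unit)
  show "weighted_limit U T v (\<lambda>x. f x + g x) = weighted_limit U T v f + weighted_limit U T v g"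
    if f: "bounded_fun f" "bounded_fun g" for f g
  proof -
    have "((\<lambda>j. T (\<lambda>x. f x * v j x) + T (\<lambda>x. g x * v j x)) \<longlongrightarrow>
        weighted_limit U T v f + weighted_limit U T v g) U"
      using f by (intro tendsto_intros lim)
    moreover have "T (\<lambda>x. f x * v j x) + T (\<lambda>x. g x * v j x) = T (\<lambda>x. (f x + g x) * v j x)" for j
      using f vb by (subst add[symmetric]) (auto simp: algebra_simps)
    ultimately show ?thesis unfolding weighted_limit_def[of _ _ _ "\<lambda>x. f x + g x"]
      by (intro Lim_eqI) simp
  qed
  show "weighted_limit U T v (\<lambda>x. c * f x) = c * weighted_limit U T v f"
    if f: "bounded_fun f" for f c
  proof -
    have "((\<lambda>j. c * T (\<lambda>x. f x * v j x)) \<longlongrightarrow> c * weighted_limit U T v f) U"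
      using f by (intro tendsto_intros lim)
    moreover have "c * T (\<lambda>x. f x * v j x) = T (\<lambda>x. (c * f x) * v j x)" for j
      using f vb by (subst scale[symmetric]) (auto simp: mult.assoc)
    ultimately show ?thesis unfolding weighted_limit_def[of _ _ _ "\<lambda>x. c * f x"]
      by (intro Lim_eqI) simp
  qed
  show "0 \<le> weighted_limit U T v f" if f: "bounded_fun f" "\<And>x. 0 \<le> f x" for f
  proof (rule tendsto_lowerbound[OF lim[OF f(1)]])
    show "\<forall>\<^sub>F j in U. 0 \<le> T (\<lambda>x. f x * v j x)"
      using f v vb by (intro always_eventually allI nonneg) auto
  qed (use proper in auto)
  have "weighted_limit U T v (\<lambda>_. 1) \<le> T (\<lambda>_. 1)"
    using v by (intro weighted_limit_le) auto
  then show "weighted_limit U T v (\<lambda>_. 1) \<le> 1" using one_le by simp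
qed

text \<open>A quantitative substitute for the Riesz representation theorem: a weak limit of functions is
  represented up to \<open>d\<close> by an actual function \<open>z\<close>. It is found by almost minimising
  \<open>T (z\<^sup>2) / 2 - weighted_limit U T v z\<close>; the exact minimiser would be the weak limit. Clipping
  to \<open>[0, 1]\<close> does not increase this expression, because the \<open>v\<^sub>j\<close> take values in \<open>[0, 1]\<close>, so \<open>z\<close>
  may be chosen with values there.\<close>

lemma approximate_density:
  assumes v: "\<And>j x. 0 \<le> v j x" "\<And>j x. v j x \<le> 1" and d: "d > 0"
  obtains z where "\<And>x. 0 \<le> z x" "\<And>x. z x \<le> 1"
    "\<And>g. (\<And>x. \<bar>g x\<bar> \<le> 1) \<Longrightarrow> \<bar>weighted_limit U T v g - T (\<lambda>x. g x * z x)\<bar> \<le> d"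
proof -
  define S where "S = weighted_limit U T v"
  interpret S: mean_along_ultrafilter U S unfolding S_def using v by (rule weighted_limit_mean)
  define F where "F z = T (\<lambda>x. z x ^ 2) / 2 - S z" for z
  define Z where "Z = {z :: 'k \<Rightarrow> real. \<forall>x. 0 \<le> z x \<and> z x \<le> 1}"
  have Zb: "bounded_fun z" if "z \<in> Z" for z using that by (auto simp: Z_def intro: bounded_fun_unit)
  have "- 1 \<le> F z" if "z \<in> Z" for z
  proof -
    have "0 \<le> T (\<lambda>x. z x ^ 2)" using Zb[OF that] by (intro nonneg) auto
    moreover have "\<bar>S z\<bar> \<le> 1" using that by (intro S.abs_le) (auto simp: Z_def)
    ultimately show ?thesis by (auto simp: F_def)
  qed
  then have bb: "bdd_below (F ` Z)" by (intro bdd_belowI2)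
  define m where "m = Inf (F ` Z)"
  have "(\<lambda>_. 0) \<in> Z" by (simp add: Z_def)
  then have "Inf (F ` Z) < m + d\<^sup>2 / 2 \<and> F ` Z \<noteq> {}" using d by (auto simp: m_def)
  then obtain z where z: "z \<in> Z" "F z < m + d\<^sup>2 / 2"
    using cInf_lessD[of "F ` Z" "m + d\<^sup>2 / 2"] by blast
  have min: "m \<le> F y" if y: "bounded_fun y" for y
  proof -
    define c where "c x = min 1 (max 0 (y x))" for x
    have c: "c \<in> Z" by (auto simp: c_def Z_def)
    have cb: "bounded_fun c" using Zb[OF c] .
    have pt: "(y x - c x) * v j x \<le> (y x ^ 2 - c x ^ 2) / 2" for j x
    proof -
      have "0 \<le> (y x - c x) * (y x + c x - 2 * v j x)"
      proof (cases "y x < 0")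
        case True
        then show ?thesis using v(1)[of j x] by (simp add: c_def mult_nonpos_nonpos)
      next
        case False
        then show ?thesis using v(2)[of j x] by (simp add: c_def min_def)
      qed
      then show ?thesis by (simp add: power2_eq_square algebra_simps)
    qed
    have "S (\<lambda>x. y x - c x) \<le> T (\<lambda>x. (y x ^ 2 - c x ^ 2) / 2)"
      unfolding S_def using v y cb pt
      by (intro weighted_limit_le bounded_fun_divide bounded_fun_diff bounded_fun_power)
    also have "\<dots> = T (\<lambda>x. (1/2) * (y x ^ 2 - c x ^ 2))" by simp
    also have "\<dots> = (1/2) * (T (\<lambda>x. y x ^ 2) - T (\<lambda>x. c x ^ 2))"
      using y cb by (subst scale, auto simp: diff bounded_fun_power)
    finally have "F c \<le> F y" using S.diff[OF y cb] by (simp add: F_def field_simps)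
    moreover have "m \<le> F c" unfolding m_def using c bb by (intro cINF_lower)
    ultimately show ?thesis by simp
  qed
  have zb: "bounded_fun z" using Zb[OF z(1)] .
  \<comment> \<open>First variation at the almost minimiser; used for both signs of t.\<close>
  have key: "- d\<^sup>2 \<le> t * (T (\<lambda>x. g x * z x) - S g)"
    if g: "\<And>x. \<bar>g x\<bar> \<le> 1" and t: "t\<^sup>2 = d\<^sup>2" for g t
  proof -
    have gb: "bounded_fun g" using g by (rule bounded_funI)
    have "T (\<lambda>x. g x ^ 2) \<le> 1"
      using abs_le[of "\<lambda>x. g x ^ 2" 1] g by (simp add: abs_square_le_1)
    then have g2: "t\<^sup>2 * T (\<lambda>x. g x ^ 2) \<le> d\<^sup>2" unfolding t by (simp add: mult_left_le)
    have "(\<lambda>x. (z x + t * g x) ^ 2) = (\<lambda>x. (z x ^ 2 + (2 * t) * (g x * z x)) + t\<^sup>2 * g x ^ 2)"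
      by (simp add: power2_eq_square algebra_simps)
    then have "T (\<lambda>x. (z x + t * g x) ^ 2)
        = (T (\<lambda>x. z x ^ 2) + (2 * t) * T (\<lambda>x. g x * z x)) + t\<^sup>2 * T (\<lambda>x. g x ^ 2)"
      using zb gb by (simp add: add scale bounded_fun_add bounded_fun_mult bounded_fun_power
          del: mult.assoc)
    moreover have "S (\<lambda>x. z x + t * g x) = S z + t * S g"
      using zb gb by (simp add: S.add S.scale bounded_fun_mult)
    moreover have "m \<le> F (\<lambda>x. z x + t * g x)"
      using zb gb by (intro min) auto
    ultimately have "m \<le> F z + t * T (\<lambda>x. g x * z x) - t * S g + d\<^sup>2 / 2"
      using g2 by (simp add: F_def field_simps)
    with z(2) show ?thesis by (simp add: algebra_simps)
  qed
  have "\<bar>S g - T (\<lambda>x. g x * z x)\<bar> \<le> d" if g: "\<And>x. \<bar>g x\<bar> \<le> 1" for g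
  proof -
    let ?D = "T (\<lambda>x. g x * z x) - S g"
    have "- d\<^sup>2 \<le> d * ?D" "- d\<^sup>2 \<le> (- d) * ?D" by (rule key[OF g], simp)+
    then have "d * (- d) \<le> d * ?D" "d * ?D \<le> d * d" by (simp_all add: power2_eq_square)
    then have "- d \<le> ?D" "?D \<le> d" using d by (simp_all only: mult_le_cancel_left_pos)
    then show ?thesis by linarith
  qed
  then show thesis using that[of z] z(1) by (auto simp: Z_def S_def)
qed

text \<open>Both iterated limits integrate against the product of the two weak limits, so they agree: each is
  within \<open>2 d\<close> of \<open>T (w * za * zb)\<close> for approximate densities \<open>za\<close> and \<open>zb\<close>.\<close>

lemma weighted_limit_commute:
  assumes a: "\<And>j x. 0 \<le> a j x" "\<And>j x. a j x \<le> 1"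
    and b: "\<And>j x. 0 \<le> b j x" "\<And>j x. b j x \<le> (1::real)"
    and w: "\<And>x. \<bar>w x\<bar> \<le> 1"
  shows "weighted_limit U (weighted_limit U T b) a w = weighted_limit U (weighted_limit U T a) b w"
proof -
  have main: "\<bar>weighted_limit U (weighted_limit U T b) a w - T (\<lambda>x. w x * za x * zb x)\<bar> \<le> 2 * d"
    if a: "\<And>j x. 0 \<le> a j x" "\<And>j x. a j x \<le> 1" and b: "\<And>j x. 0 \<le> b j x" "\<And>j x. b j x \<le> (1::real)"
      and za: "\<And>g. (\<And>x. \<bar>g x\<bar> \<le> 1) \<Longrightarrow> \<bar>weighted_limit U T a g - T (\<lambda>x. g x * za x)\<bar> \<le> d"
      and zb: "\<And>g. (\<And>x. \<bar>g x\<bar> \<le> 1) \<Longrightarrow> \<bar>weighted_limit U T b g - T (\<lambda>x. g x * zb x)\<bar> \<le> d"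
        "\<And>x. 0 \<le> zb x" "\<And>x. zb x \<le> 1"
    for a b za zb d
  proof -
    interpret B: mean_along_ultrafilter U "weighted_limit U T b"
      using b by (rule weighted_limit_mean)
    have wa: "\<bar>w x * a j x\<bar> \<le> 1" for j x
      using mult_mono[OF w[of x] a(2)[of j x]] a(1)[of j x] by (simp add: abs_mult)
    have wz: "\<bar>w x * zb x\<bar> \<le> 1" for x
      using mult_mono[OF w[of x] zb(3)[of x]] zb(2)[of x] by (simp add: abs_mult)
    have wza: "\<bar>w x * zb x * a j x\<bar> \<le> 1" for j x
      using mult_mono[OF wz[of x] a(2)[of j x]] a(1)[of j x] by (simp add: abs_mult)
    have "\<bar>Lim U (\<lambda>j. weighted_limit U T b (\<lambda>x. w x * a j x)) - Lim U (\<lambda>j. T (\<lambda>x. w x * zb x * a j x))\<bar> \<le> d"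
    proof (rule Lim_close)
      show "\<bar>weighted_limit U T b (\<lambda>x. w x * a j x)\<bar> \<le> 1" for j using wa by (rule B.abs_le)
      show "\<bar>T (\<lambda>x. w x * zb x * a j x)\<bar> \<le> 1" for j using wza by (rule abs_le)
      show "\<bar>weighted_limit U T b (\<lambda>x. w x * a j x) - T (\<lambda>x. w x * zb x * a j x)\<bar> \<le> d" for j
        using zb(1)[of "\<lambda>x. w x * a j x"] wa by (simp add: ac_simps)
    qed
    moreover have "\<bar>weighted_limit U T a (\<lambda>x. w x * zb x) - T (\<lambda>x. w x * za x * zb x)\<bar> \<le> d"
      using za[of "\<lambda>x. w x * zb x"] wz by (simp add: ac_simps)
    ultimately show ?thesis unfolding weighted_limit_def[of U T a]
      weighted_limit_def[of U "weighted_limit U T b"] by linarith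
  qed
  have "\<bar>weighted_limit U (weighted_limit U T b) a w - weighted_limit U (weighted_limit U T a) b w\<bar> \<le> e"
    if e: "e > 0" for e
  proof -
    obtain za where za: "\<And>x. 0 \<le> za x" "\<And>x. za x \<le> 1"
      "\<And>g. (\<And>x. \<bar>g x\<bar> \<le> 1) \<Longrightarrow> \<bar>weighted_limit U T a g - T (\<lambda>x. g x * za x)\<bar> \<le> e / 4"
      using approximate_density[where v = a and d = "e / 4", OF a] e by auto
    obtain zb where zb: "\<And>x. 0 \<le> zb x" "\<And>x. zb x \<le> 1"
      "\<And>g. (\<And>x. \<bar>g x\<bar> \<le> 1) \<Longrightarrow> \<bar>weighted_limit U T b g - T (\<lambda>x. g x * zb x)\<bar> \<le> e / 4"
      using approximate_density[where v = b and d = "e / 4", OF b] e by auto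
    have "\<bar>weighted_limit U (weighted_limit U T b) a w - T (\<lambda>x. w x * za x * zb x)\<bar> \<le> 2 * (e / 4)"
      by (rule main[OF a b za(3) zb(3,1,2)])
    moreover have "\<bar>weighted_limit U (weighted_limit U T a) b w - T (\<lambda>x. w x * zb x * za x)\<bar> \<le> 2 * (e / 4)"
      by (rule main[OF b a zb(3) za(3,1,2)])
    moreover have "(\<lambda>x. w x * zb x * za x) = (\<lambda>x. w x * za x * zb x)" by (simp add: ac_simps)
    ultimately show ?thesis by (simp only:)
  qed
  then have "\<bar>weighted_limit U (weighted_limit U T b) a w - weighted_limit U (weighted_limit U T a) b w\<bar> \<le> 0"
    by (rule field_le_epsilon) simp
  then show ?thesis by simp
qed

text \<open>If \<open>\<alpha>\<close> denotes the weak limit of the \<open>a\<^sub>n\<close>, then \<open>weighted_limit U T a (w * a\<^sub>n)\<close> tends to the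
  integral of \<open>w \<alpha>\<^sup>2\<close>, which by Cauchy-Schwarz is at least the square of the integral \<open>t\<close> of \<open>w \<alpha>\<close>.
  The approximate density \<open>z\<close> stands in for \<open>\<alpha>\<close>, and the error \<open>d = t\<^sup>2 / 16\<close> is small enough to
  leave a positive limit.\<close>

lemma weighted_limit_recurrent:
  assumes a: "\<And>j x. 0 \<le> a j x" "\<And>j x. a j x \<le> 1"
    and w: "\<And>x. 0 \<le> w x" "\<And>x. w x \<le> 1"
    and pos: "0 < weighted_limit U T a w"
  shows "\<forall>\<^sub>F n in U. 0 < weighted_limit U T a (\<lambda>x. w x * a n x)"
proof -
  interpret S: mean_along_ultrafilter U "weighted_limit U T a"
    using a by (rule weighted_limit_mean)
  define t where "t = weighted_limit U T a w"
  have t: "0 < t" "t \<le> 1" using pos S.abs_le[of w 1] w by (auto simp: t_def)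
  define d where "d = t\<^sup>2 / 16"
  have d: "0 < d" using t by (simp add: d_def)
  have "t\<^sup>2 \<le> t" using t by (simp add: power2_eq_square mult_left_le)
  then have dt: "d \<le> t / 2" using t unfolding d_def by linarith
  obtain z where z: "\<And>x. 0 \<le> z x" "\<And>x. z x \<le> 1"
    "\<And>g. (\<And>x. \<bar>g x\<bar> \<le> 1) \<Longrightarrow> \<bar>weighted_limit U T a g - T (\<lambda>x. g x * z x)\<bar> \<le> d"
    using approximate_density[where v = a, OF a d] by auto
  have wb: "bounded_fun w" and zb: "bounded_fun z" using w z by (auto intro: bounded_fun_unit)
  have wz: "0 \<le> w x * z x" "w x * z x \<le> 1" for x
    using w z by (auto intro: mult_le_one)
  have wa: "\<bar>w x * a n x\<bar> \<le> 1" for n x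
    using w a by (auto simp: abs_mult intro: mult_le_one)
  define s where "s = T (\<lambda>x. w x * z x)"
  have "\<bar>t - s\<bar> \<le> d" unfolding t_def s_def using w by (intro z(3)) auto
  then have s: "t / 2 \<le> s" using dt by linarith
  \<comment> \<open>Cauchy-Schwarz for the weight w, in the form that the variance of z is nonnegative\<close>
  have "0 \<le> T (\<lambda>x. w x * (z x - s)\<^sup>2)" using w wb zb by (intro nonneg) auto
  also have "(\<lambda>x. w x * (z x - s)\<^sup>2) = (\<lambda>x. (w x * z x * z x - 2 * s * (w x * z x)) + s\<^sup>2 * w x)"
    by (simp add: power2_eq_square algebra_simps)
  also have "T \<dots> = (T (\<lambda>x. w x * z x * z x) - 2 * s * s) + s\<^sup>2 * T w"
    using wb zb by (simp add: add diff scale bounded_fun_add bounded_fun_mult bounded_fun_diff s_def)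
  also have "s\<^sup>2 * T w \<le> s\<^sup>2 * 1"
    using abs_le[of w 1] w by (intro mult_left_mono) auto
  finally have "s\<^sup>2 \<le> T (\<lambda>x. w x * z x * z x)" by (simp add: power2_eq_square)
  moreover have "(t / 2)\<^sup>2 \<le> s\<^sup>2" using s t by (intro power_mono) auto
  ultimately have "4 * d \<le> T (\<lambda>x. w x * z x * z x)" by (simp add: d_def power_divide)
  moreover have "\<bar>weighted_limit U T a (\<lambda>x. w x * z x) - T (\<lambda>x. w x * z x * z x)\<bar> \<le> d"
    using wz by (intro z(3)) auto
  ultimately have "3 * d \<le> weighted_limit U T a (\<lambda>x. w x * z x)" by linarith
  then have "2 * d < weighted_limit U T a (\<lambda>x. w x * z x)" using d by linarith
  then have "\<forall>\<^sub>F n in U. 2 * d < T (\<lambda>x. w x * z x * a n x)"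
    by (rule order_tendstoD(1)[OF weighted_limit_tendsto[where v = a, OF a bounded_fun_mult[OF wb zb]]])
  then show ?thesis
  proof eventually_elim
    case (elim n)
    have "\<bar>weighted_limit U T a (\<lambda>x. w x * a n x) - T (\<lambda>x. w x * a n x * z x)\<bar> \<le> d"
      using wa by (rule z(3))
    moreover have "(\<lambda>x. w x * a n x * z x) = (\<lambda>x. w x * z x * a n x)" by (simp add: ac_simps)
    ultimately show ?case using elim d by simp
  qed
qed

end

section \<open>Independent subsequences of separated sequences\<close>

text \<open>Two numbers in \<open>[-1, 1]\<close> more than \<open>2 h\<close> apart have an interval \<open>[k h, k h + h]\<close> strictly between
  them, and there are only finitely many such intervals to choose from.\<close>

lemma square_diff_le_grid_crossings:
  fixes s t h :: real
  assumes h: "h > 0" and s: "\<bar>s\<bar> \<le> 1" and t: "\<bar>t\<bar> \<le> 1"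
  shows "(s - t)\<^sup>2 \<le> 4 * h\<^sup>2 + 4 * (\<Sum>k\<in>{- \<lceil>1 / h\<rceil>..\<lceil>1 / h\<rceil> + 1}.
    of_bool (s < k * h) * of_bool (k * h + h < t) + of_bool (t < k * h) * of_bool (k * h + h < s))"
proof -
  define I where "I = {- \<lceil>1 / h\<rceil>..\<lceil>1 / h\<rceil> + 1}"
  define crossings where
    "crossings s t = (\<Sum>k\<in>I. of_bool (s < k * h) * of_bool (k * h + h < t) :: real)" for s t
  have nonneg: "0 \<le> crossings s t" for s t
    unfolding crossings_def by (intro sum_nonneg) auto
  have main: "(s - t)\<^sup>2 \<le> 4 * h\<^sup>2 + 4 * crossings s t"
    if s: "\<bar>s\<bar> \<le> 1" and t: "\<bar>t\<bar> \<le> 1" and le: "s \<le> t" for s t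
  proof (cases "t - s \<le> 2 * h")
    case True
    then have "(t - s)\<^sup>2 \<le> (2 * h)\<^sup>2" using le by (intro power_mono) auto
    then show ?thesis
      using nonneg[of s t] unfolding power2_commute[of s t] by (simp add: power_mult_distrib)
  next
    case False
    define k where "k = \<lfloor>s / h\<rfloor> + 1"
    have k1: "s < k * h" and k2: "k * h \<le> s + h"
    proof -
      have "s / h < k" "k \<le> s / h + 1" unfolding k_def by linarith+
      then show "s < k * h" "k * h \<le> s + h" using h by (simp_all add: field_simps)
    qed
    have "- (1 / h) \<le> s / h" "s / h \<le> 1 / h"
      using s h by (simp_all add: abs_le_iff divide_simps)
    then have "k \<in> I" unfolding I_def k_def atLeastAtMost_iff by linarith
    then have "of_bool (s < k * h) * of_bool (k * h + h < t)
        \<le> crossings s t"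
      unfolding crossings_def by (intro member_le_sum) (auto simp: I_def)
    moreover have "k * h + h < t" using k2 False by linarith
    ultimately have "1 \<le> crossings s t"
      using k1 by simp
    moreover have "(t - s)\<^sup>2 \<le> 4" using power_mono[of "t - s" 2 2] s t le by simp
    moreover have "(s - t)\<^sup>2 = (t - s)\<^sup>2" by (rule power2_commute)
    moreover have "0 \<le> h\<^sup>2" by simp
    ultimately show ?thesis by linarith
  qed
  have "(s - t)\<^sup>2 \<le> 4 * h\<^sup>2 + 4 * (crossings s t + crossings t s)"
  proof (cases "s \<le> t")
    case True
    then show ?thesis using main[OF s t True] nonneg[of t s] by (simp only: distrib_left)
  next
    case False
    then have "t \<le> s" by simp
    moreover have "(s - t)\<^sup>2 = (t - s)\<^sup>2" by (rule power2_commute)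
    ultimately show ?thesis
      using main[OF t s \<open>t \<le> s\<close>] nonneg[of s t] by (simp only: distrib_left)
  qed
  then show ?thesis by (simp add: crossings_def I_def sum.distrib)
qed

context mean_along_ultrafilter
begin

text \<open>If for every grid point \<open>r\<close> the weak limits of the indicators of \<open>f\<^sub>n < r\<close> and of \<open>f\<^sub>n > r + h\<close> had
  product zero, then for suitable \<open>i < j\<close> the functions \<open>f\<^sub>i\<close> and \<open>f\<^sub>j\<close> would lie on different
  sides of a grid interval only with small measure, and their distance in \<open>L\<^sup>2\<close> would be too small.
  Both orders of crossing are controlled at once because the iterated limits commute.\<close>

lemma separated_imp_oscillation:
  fixes f :: "nat \<Rightarrow> 'k \<Rightarrow> real"
  assumes f: "\<And>n x. \<bar>f n x\<bar> \<le> 1" and c: "c > 0"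
    and sep: "\<And>n m. n \<noteq> m \<Longrightarrow> c \<le> T (\<lambda>x. (f n x - f m x)\<^sup>2)"
  obtains r h where "h > 0"
    "0 < weighted_limit U (weighted_limit U T (\<lambda>n x. of_bool (r + h < f n x)))
           (\<lambda>n x. of_bool (f n x < r)) (\<lambda>_. 1)"
proof (rule ccontr)
  assume no: "\<not> thesis"
  define h where "h = sqrt (c / 8)"
  have h: "h > 0" "4 * h\<^sup>2 = c / 2" using c by (simp_all add: h_def)
  define I where "I = {- \<lceil>1 / h\<rceil>..\<lceil>1 / h\<rceil> + 1}"
  have "0 < 1 / h" using h by simp
  then have "0 \<in> I" unfolding I_def atLeastAtMost_iff by linarith
  moreover have fin: "finite I" by (simp add: I_def)
  ultimately have card: "card I > 0" "finite I" by (auto simp: card_gt_0_iff)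
  define a where "a = (\<lambda>(k::int) n x. of_bool (f n x < of_int k * h) :: real)"
  define b where "b = (\<lambda>(k::int) n x. of_bool (of_int k * h + h < f n x) :: real)"
  have a: "0 \<le> a k n x" "a k n x \<le> 1" and b: "0 \<le> b k n x" "b k n x \<le> 1" for k n x
    by (auto simp: a_def b_def)
  have Lab: "weighted_limit U (weighted_limit U T (b k)) (a k) (\<lambda>_. 1) \<le> 0" for k
  proof (rule ccontr)
    assume "\<not> ?thesis"
    then show False using no that[of h "k * h"] h by (simp add: a_def b_def not_le)
  qed
  have Lba: "weighted_limit U (weighted_limit U T (a k)) (b k) (\<lambda>_. 1) \<le> 0" for k
    using weighted_limit_commute[where a = "a k" and b = "b k" and w = "\<lambda>_. 1", OF a b] Lab[of k]
    by simp
  define e where "e = c / (32 * card I)"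
  have e: "e > 0" using c card by (simp add: e_def)
  have evA: "\<forall>\<^sub>F i in U. \<forall>k\<in>I. weighted_limit U T (b k) (a k i) < e"
  proof (intro eventually_ball_finite ballI card)
    fix k
    interpret B: mean_along_ultrafilter U "weighted_limit U T (b k)"
      using b by (rule weighted_limit_mean)
    show "\<forall>\<^sub>F i in U. weighted_limit U T (b k) (a k i) < e"
      using order_tendstoD(2)[OF B.weighted_limit_tendsto[of "a k" "\<lambda>_. 1"], of e] a Lab[of k] e
      by auto
  qed
  have evB: "\<forall>\<^sub>F i in U. \<forall>k\<in>I. weighted_limit U T (a k) (b k i) < e"
  proof (intro eventually_ball_finite ballI card)
    fix k
    interpret A: mean_along_ultrafilter U "weighted_limit U T (a k)"
      using a by (rule weighted_limit_mean)
    show "\<forall>\<^sub>F i in U. weighted_limit U T (a k) (b k i) < e"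
      using order_tendstoD(2)[OF A.weighted_limit_tendsto[of "b k" "\<lambda>_. 1"], of e] b Lba[of k] e
      by auto
  qed
  obtain i where i: "\<And>k. k \<in> I \<Longrightarrow> weighted_limit U T (b k) (a k i) < e"
      "\<And>k. k \<in> I \<Longrightarrow> weighted_limit U T (a k) (b k i) < e"
    using eventually_happens'[OF proper eventually_conj[OF evA evB]] by blast
  have ab: "bounded_fun (a k n)" "bounded_fun (b k n)" for k n
    using a b by (auto intro: bounded_fun_unit)
  have "\<forall>\<^sub>F j in U. \<forall>k\<in>I. T (\<lambda>x. a k i x * b k j x) < e"
  proof (intro eventually_ball_finite ballI card)
    fix k assume "k \<in> I"
    then show "\<forall>\<^sub>F j in U. T (\<lambda>x. a k i x * b k j x) < e"
      by (intro order_tendstoD(2)[OF weighted_limit_tendsto[where v = "b k", OF b ab(1)]] i)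
  qed
  moreover have "\<forall>\<^sub>F j in U. \<forall>k\<in>I. T (\<lambda>x. b k i x * a k j x) < e"
  proof (intro eventually_ball_finite ballI card)
    fix k assume "k \<in> I"
    then show "\<forall>\<^sub>F j in U. T (\<lambda>x. b k i x * a k j x) < e"
      by (intro order_tendstoD(2)[OF weighted_limit_tendsto[where v = "a k", OF a ab(2)]] i)
  qed
  moreover have "\<forall>\<^sub>F j in U. i < j"
    using free eventually_gt_at_top[of i] by (rule filter_leD)
  ultimately have "\<forall>\<^sub>F j in U. (\<forall>k\<in>I. T (\<lambda>x. a k i x * b k j x) < e) \<and>
      (\<forall>k\<in>I. T (\<lambda>x. b k i x * a k j x) < e) \<and> i < j"
    by (intro eventually_conj)
  then obtain j where j: "\<And>k. k \<in> I \<Longrightarrow> T (\<lambda>x. a k i x * b k j x) < e"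
      "\<And>k. k \<in> I \<Longrightarrow> T (\<lambda>x. b k i x * a k j x) < e" "i < j"
    using eventually_happens'[OF proper] by blast
  have fb: "bounded_fun (f n)" for n using f by (rule bounded_funI)
  have "c \<le> T (\<lambda>x. (f i x - f j x)\<^sup>2)" using j(3) by (intro sep) simp
  also have "\<dots> \<le> T (\<lambda>x. 4 * h\<^sup>2 + 4 * (\<Sum>k\<in>I. a k i x * b k j x + b k i x * a k j x))"
  proof (rule mono)
    show "bounded_fun (\<lambda>x. 4 * h\<^sup>2 + 4 * (\<Sum>k\<in>I. a k i x * b k j x + b k i x * a k j x))"
      using ab by (intro bounded_fun_add bounded_fun_mult bounded_fun_sum bounded_fun_const)
    show "(f i x - f j x)\<^sup>2 \<le> 4 * h\<^sup>2 + 4 * (\<Sum>k\<in>I. a k i x * b k j x + b k i x * a k j x)" for x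
      using square_diff_le_grid_crossings[OF h(1) f[of i x] f[of j x]]
      by (simp add: a_def b_def I_def mult.commute)
  qed (use fb in auto)
  also have "\<dots> = 4 * h\<^sup>2 * T (\<lambda>_. 1) + 4 * (\<Sum>k\<in>I. T (\<lambda>x. a k i x * b k j x) + T (\<lambda>x. b k i x * a k j x))"
    using ab by (simp add: add scale sum bounded_fun_add bounded_fun_mult bounded_fun_sum const[of "4 * h\<^sup>2"])
  also have "\<dots> \<le> 4 * h\<^sup>2 * 1 + 4 * (\<Sum>k\<in>I. 2 * e)"
  proof (intro add_mono mult_left_mono sum_mono one_le)
    show "T (\<lambda>x. a k i x * b k j x) + T (\<lambda>x. b k i x * a k j x) \<le> 2 * e" if "k \<in> I" for k
      using j(1,2)[OF that] by linarith
  qed auto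
  also have "\<dots> = c / 2 + c / 4" using h(2) card by (auto simp: e_def)
  finally show False using c by simp
qed

text \<open>The functional \<open>L\<close> is integration against the product of the weak limits of the \<open>a\<^sub>n\<close> and the
  \<open>b\<^sub>n\<close>. Positivity of \<open>L w\<close> is inherited by \<open>L (w * a\<^sub>n)\<close> and by \<open>L (w * b\<^sub>n)\<close> for almost all \<open>n\<close>,
  so a single \<open>n\<close> splits any finite family of weights. Iterating, one keeps \<open>L\<close> positive, hence the
  weight nonzero somewhere, on all \<open>2\<^sup>k\<close> products of length \<open>k\<close>.\<close>

lemma oscillation_imp_independent_subsequence:
  assumes a: "\<And>j x. 0 \<le> a j x" "\<And>j x. a j x \<le> 1"
    and b: "\<And>j x. 0 \<le> b j x" "\<And>j x. b j x \<le> (1::real)"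
    and pos: "0 < weighted_limit U (weighted_limit U T b) a (\<lambda>_. 1)"
  shows "\<exists>\<sigma> :: nat \<Rightarrow> nat. strict_mono \<sigma> \<and>
    (\<forall>k \<epsilon>. \<exists>x. \<forall>i<k. 0 < (if \<epsilon> i then b (\<sigma> i) x else a (\<sigma> i) x))"
proof -
  define L where "L = weighted_limit U (weighted_limit U T b) a"
  interpret A: mean_along_ultrafilter U "weighted_limit U T a" using a by (rule weighted_limit_mean)
  interpret B: mean_along_ultrafilter U "weighted_limit U T b" using b by (rule weighted_limit_mean)
  interpret L: mean_along_ultrafilter U L unfolding L_def using a by (rule B.weighted_limit_mean)
  define unit where "unit w \<longleftrightarrow> (\<forall>x. 0 \<le> w x \<and> w x \<le> (1::real))" for w :: "'k \<Rightarrow> real"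
  have unit_mult: "unit (\<lambda>x. w x * a n x)" "unit (\<lambda>x. w x * b n x)" if "unit w" for w n
    using that a b by (auto simp: unit_def intro: mult_le_one)
  have L': "L w = weighted_limit U (weighted_limit U T a) b w" if "unit w" for w
    unfolding L_def using that a b by (intro weighted_limit_commute) (auto simp: unit_def)
  have recA: "\<forall>\<^sub>F n in U. 0 < L (\<lambda>x. w x * a n x)" if "unit w" "0 < L w" for w
    using that a unfolding L_def by (intro B.weighted_limit_recurrent) (auto simp: unit_def)
  have recB: "\<forall>\<^sub>F n in U. 0 < L (\<lambda>x. w x * b n x)" if w: "unit w" "0 < L w" for w
  proof -
    have "\<forall>\<^sub>F n in U. 0 < weighted_limit U (weighted_limit U T a) b (\<lambda>x. w x * b n x)"
      using w b L' by (intro A.weighted_limit_recurrent) (auto simp: unit_def)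
    then show ?thesis using L'[OF unit_mult(2)[OF w(1)]] by simp
  qed
  define good where "good W \<longleftrightarrow> finite W \<and> (\<forall>w\<in>W. unit w \<and> 0 < L w)" for W
  define children where "children n W = (\<lambda>w x. w x * a n x) ` W \<union> (\<lambda>w x. w x * b n x) ` W" for n W
  have "\<exists>s. \<forall>n. good (snd (s n)) \<and> (fst (s n) < fst (s (Suc n)) \<and>
      snd (s (Suc n)) = children (fst (s (Suc n))) (snd (s n))) \<and> (n = 0 \<longrightarrow> snd (s n) = {\<lambda>_. 1})"
  proof -
    have "\<exists>s :: nat \<Rightarrow> nat \<times> ('k \<Rightarrow> real) set. \<forall>n. (good (snd (s n)) \<and> (n = 0 \<longrightarrow> snd (s n) = {\<lambda>_. 1})) \<and>
      (fst (s n) < fst (s (Suc n)) \<and> snd (s (Suc n)) = children (fst (s (Suc n))) (snd (s n)))"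
    proof (rule dependent_nat_choice)
      show "\<exists>s :: nat \<times> ('k \<Rightarrow> real) set. good (snd s) \<and> (0 = (0::nat) \<longrightarrow> snd s = {\<lambda>_. 1})"
      proof
        show "good (snd (0::nat, {\<lambda>_. 1})) \<and> (0 = (0::nat) \<longrightarrow> snd (0::nat, {\<lambda>_. 1}) = {\<lambda>_. 1})"
          using pos by (simp add: good_def unit_def L_def)
      qed
    next
      fix s :: "nat \<times> ('k \<Rightarrow> real) set" and n :: nat
      assume "good (snd s) \<and> (n = 0 \<longrightarrow> snd s = {\<lambda>_. 1})"
      then have W: "finite (snd s)" "\<And>w. w \<in> snd s \<Longrightarrow> unit w \<and> 0 < L w"
        by (auto simp: good_def)
      have "\<forall>\<^sub>F n in U. \<forall>w\<in>snd s. 0 < L (\<lambda>x. w x * a n x)"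
        using W recA by (intro eventually_ball_finite) auto
      moreover have "\<forall>\<^sub>F n in U. \<forall>w\<in>snd s. 0 < L (\<lambda>x. w x * b n x)"
        using W recB by (intro eventually_ball_finite) auto
      moreover have "\<forall>\<^sub>F n in U. fst s < n"
        using free eventually_gt_at_top[of "fst s"] by (rule filter_leD)
      ultimately have "\<forall>\<^sub>F n in U. (\<forall>w\<in>snd s. 0 < L (\<lambda>x. w x * a n x)) \<and>
          (\<forall>w\<in>snd s. 0 < L (\<lambda>x. w x * b n x)) \<and> fst s < n"
        by (intro eventually_conj)
      then obtain m where m: "\<And>w. w \<in> snd s \<Longrightarrow> 0 < L (\<lambda>x. w x * a m x)"
          "\<And>w. w \<in> snd s \<Longrightarrow> 0 < L (\<lambda>x. w x * b m x)" "fst s < m"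
        using eventually_happens'[OF proper] by blast
      have "good (children m (snd s))"
        using W m unit_mult by (auto simp: good_def children_def)
      then show "\<exists>s'. (good (snd s') \<and> (Suc n = 0 \<longrightarrow> snd s' = {\<lambda>_. 1})) \<and>
          fst s < fst s' \<and> snd s' = children (fst s') (snd s)"
        using m(3) by (intro exI[of _ "(m, children m (snd s))"]) auto
    qed
    then show ?thesis by blast
  qed
  then obtain s where s: "\<And>n. good (snd (s n))" "\<And>n. fst (s n) < fst (s (Suc n))"
      "\<And>n. snd (s (Suc n)) = children (fst (s (Suc n))) (snd (s n))" "snd (s 0) = {\<lambda>_. 1}"
    by blast
  define \<sigma> where "\<sigma> i = fst (s (Suc i))" for i
  define \<pi> where "\<pi> \<epsilon> k x = (\<Prod>i<k. if \<epsilon> i then b (\<sigma> i) x else a (\<sigma> i) x)"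
    for \<epsilon> :: "nat \<Rightarrow> bool" and k x
  have mem: "\<pi> \<epsilon> k \<in> snd (s k)" for \<epsilon> k
  proof (induction k)
    case 0
    then show ?case by (simp add: \<pi>_def s(4))
  next
    case (Suc k)
    have "\<pi> \<epsilon> (Suc k) = (\<lambda>x. \<pi> \<epsilon> k x * (if \<epsilon> k then b (\<sigma> k) x else a (\<sigma> k) x))"
      by (simp add: \<pi>_def fun_eq_iff)
    then show ?case using Suc by (cases "\<epsilon> k") (auto simp: s(3) children_def \<sigma>_def)
  qed
  show ?thesis
  proof (intro exI[of _ \<sigma>] conjI allI)
    show "strict_mono \<sigma>" using s(2) by (simp add: strict_mono_Suc_iff \<sigma>_def)
    fix k \<epsilon>
    have "0 < L (\<pi> \<epsilon> k)" using mem s(1) by (auto simp: good_def)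
    then have "\<pi> \<epsilon> k \<noteq> (\<lambda>_. 0)" using L.const[of 0] by force
    then obtain x where x: "\<pi> \<epsilon> k x \<noteq> 0" by auto
    have "0 < (if \<epsilon> i then b (\<sigma> i) x else a (\<sigma> i) x)" if "i < k" for i
    proof -
      have "(if \<epsilon> i then b (\<sigma> i) x else a (\<sigma> i) x) \<noteq> 0"
        using x that by (auto simp: \<pi>_def)
      moreover have "0 \<le> (if \<epsilon> i then b (\<sigma> i) x else a (\<sigma> i) x)" using a b by simp
      ultimately show ?thesis by linarith
    qed
    then show "\<exists>x. \<forall>i<k. 0 < (if \<epsilon> i then b (\<sigma> i) x else a (\<sigma> i) x)" by blast
  qed
qed

end

theorem independent_subsequence:
  fixes f :: "nat \<Rightarrow> 'k \<Rightarrow> real"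
  assumes T: "subprobability_mean T" and f: "\<And>n x. \<bar>f n x\<bar> \<le> 1" and c: "c > 0"
    and sep: "\<And>n m. n \<noteq> m \<Longrightarrow> c \<le> T (\<lambda>x. (f n x - f m x)\<^sup>2)"
  obtains \<sigma> :: "nat \<Rightarrow> nat" and r h where "strict_mono \<sigma>" "h > 0"
    "\<And>k \<epsilon>. \<exists>x. \<forall>i<k. if \<epsilon> i then r + h < f (\<sigma> i) x else f (\<sigma> i) x < r"
proof -
  obtain U where "free_ultrafilter U" using free_ultrafilter_exists by blast
  then interpret mean_along_ultrafilter U T using T by (rule mean_along_ultrafilter.intro)
  obtain r h where rh: "h > 0" "0 < weighted_limit U
      (weighted_limit U T (\<lambda>n x. of_bool (r + h < f n x))) (\<lambda>n x. of_bool (f n x < r)) (\<lambda>_. 1)"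
    by (rule separated_imp_oscillation[OF f c sep])
  define a b where "a = (\<lambda>n x. of_bool (f n x < r) :: real)"
    and "b = (\<lambda>n x. of_bool (r + h < f n x) :: real)"
  have a: "0 \<le> a n x" "a n x \<le> 1" and b: "0 \<le> b n x" "b n x \<le> 1" for n x
    by (simp_all add: a_def b_def)
  have "0 < weighted_limit U (weighted_limit U T b) a (\<lambda>_. 1)"
    using rh(2) by (simp only: a_def b_def)
  then obtain \<sigma> :: "nat \<Rightarrow> nat" where \<sigma>: "strict_mono \<sigma>"
      "\<And>k \<epsilon>. \<exists>x. \<forall>i<k. 0 < (if \<epsilon> i then b (\<sigma> i) x else a (\<sigma> i) x)"
    using oscillation_imp_independent_subsequence[where a = a and b = b, OF a b] by blast
  have "\<exists>x. \<forall>i<k. if \<epsilon> i then r + h < f (\<sigma> i) x else f (\<sigma> i) x < r" for k \<epsilon>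
  proof -
    obtain x where x: "\<And>i. i < k \<Longrightarrow> 0 < (if \<epsilon> i then b (\<sigma> i) x else a (\<sigma> i) x)"
      using \<sigma>(2)[of k \<epsilon>] by blast
    have "if \<epsilon> i then r + h < f (\<sigma> i) x else f (\<sigma> i) x < r" if "i < k" for i
      using x[OF that] by (simp add: a_def b_def split: if_splits)
    then show ?thesis by blast
  qed
  with \<sigma>(1) rh(1) show thesis by (rule that)
qed

section \<open>Limited sets and summing families\<close>

lemma summing_norm_bound:
  fixes y :: "'i \<Rightarrow> 'a::real_normed_vector"
  assumes "p > 0"
    and le: "\<And>\<phi> :: 'a \<Rightarrow>\<^sub>L real. norm \<phi> \<le> 1 \<Longrightarrow> (\<Sum>i\<in>I. \<bar>blinfun_apply \<phi> (y i)\<bar> powr p) \<le> 1"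
  shows "(\<Sum>i\<in>I. \<bar>blinfun_apply \<phi> (y i)\<bar> powr p) \<le> (1 + norm \<phi>) powr p"
proof -
  define s where "s = 1 + norm \<phi>"
  have s: "s > 0" "norm \<phi> \<le> s" by (auto simp: s_def add_pos_nonneg)
  have "norm (inverse s *\<^sub>R \<phi>) \<le> 1" using s by (simp add: field_simps)
  from le[OF this] have "(\<Sum>i\<in>I. \<bar>inverse s * blinfun_apply \<phi> (y i)\<bar> powr p) \<le> 1"
    by (simp add: blinfun.scaleR_left)
  also have "(\<Sum>i\<in>I. \<bar>inverse s * blinfun_apply \<phi> (y i)\<bar> powr p) = (\<Sum>i\<in>I. \<bar>blinfun_apply \<phi> (y i)\<bar> powr p) / s powr p"
    using s by (simp add: abs_mult powr_mult powr_divide divide_inverse sum_distrib_left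
        powr_minus inverse_powr mult.commute)
  finally show ?thesis using s unfolding s_def by (simp add: divide_le_eq)
qed

text \<open>The weak \<open>p\<close>-norm of the family is at most one.\<close>

definition weakly_unit_summable :: "real \<Rightarrow> 'i set \<Rightarrow> ('i \<Rightarrow> 'a::real_normed_vector) \<Rightarrow> bool" where
  "weakly_unit_summable p I y \<longleftrightarrow>
     (\<forall>\<phi> :: 'a \<Rightarrow>\<^sub>L real. norm \<phi> \<le> 1 \<longrightarrow> (\<Sum>i\<in>I. \<bar>blinfun_apply \<phi> (y i)\<bar> powr p) \<le> 1)"

text \<open>The map sending \<open>x\<close> to the function \<open>\<phi> \<mapsto> \<phi> x\<close> on \<open>A\<close> is \<open>p\<close>-summing with constant \<open>C\<close> (to the
  power \<open>p\<close>). The functionals \<open>a\<^sub>k\<close> pick arbitrary coordinates, which replaces the supremum norm on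
  the functions on \<open>A\<close>.\<close>

definition summing_with :: "real \<Rightarrow> real \<Rightarrow> ('a::real_normed_vector \<Rightarrow>\<^sub>L real) set \<Rightarrow> bool" where
  "summing_with p C A \<longleftrightarrow>
     (\<forall>(K :: nat) y a. weakly_unit_summable p {..<K} y \<longrightarrow> (\<forall>k<K. a k \<in> A) \<longrightarrow>
        (\<Sum>k<K. \<bar>blinfun_apply (a k) (y k)\<bar> powr p) \<le> C)"

lemma summing_withD:
  assumes A: "summing_with p C A" and I: "finite I" and y: "weakly_unit_summable p I y"
    and a: "\<And>i. i \<in> I \<Longrightarrow> a i \<in> A"
  shows "(\<Sum>i\<in>I. \<bar>blinfun_apply (a i) (y i)\<bar> powr p) \<le> C"
proof -
  obtain e where e: "bij_betw e {..<card I} I"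
    using ex_bij_betw_nat_finite[OF I] by (auto simp: atLeast0LessThan)
  have reindex: "(\<Sum>i\<in>I. F i) = (\<Sum>k<card I. F (e k))" for F :: "'b \<Rightarrow> real"
    using sum.reindex_bij_betw[OF e, of F] by simp
  have "weakly_unit_summable p {..<card I} (y \<circ> e)"
    using y by (simp add: weakly_unit_summable_def reindex)
  moreover have "\<forall>k<card I. (a \<circ> e) k \<in> A"
    using a e by (auto simp: bij_betw_def)
  ultimately have "(\<Sum>k<card I. \<bar>blinfun_apply ((a \<circ> e) k) ((y \<circ> e) k)\<bar> powr p) \<le> C"
    using A unfolding summing_with_def by blast
  then show ?thesis by (simp add: reindex)
qed

text \<open>If no constant works, there are finite families of weak \<open>p\<close>-norm at most one whose strong
  \<open>p\<close>-sums exceed \<open>4\<^sup>m\<close>. Scaled by \<open>2 powr (- m / p)\<close> and concatenated, they form a weakly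
  \<open>p\<close>-summable sequence in the space, that is, a weak* \<open>p\<close>-summable sequence of functionals on the
  dual. A dominating sequence in \<open>\<ell>\<^sub>p\<close> would have blocks of size more than \<open>2\<^sup>m\<close>.\<close>

lemma limited_imp_summing:
  fixes A :: "('a::banach \<Rightarrow>\<^sub>L real) set"
  assumes p: "1 \<le> p" and A: "limited p A"
  shows "\<exists>C>0. summing_with p C A"
proof -
  have "\<exists>C>0. \<forall>(K :: nat) y a. weakly_unit_summable p {..<K} y \<longrightarrow> (\<forall>k<K. a k \<in> A) \<longrightarrow>
      (\<Sum>k<K. \<bar>blinfun_apply (a k) (y k)\<bar> powr p) \<le> C"
  proof (rule ccontr)
    assume no_bound: "\<not> ?thesis"
    define bad where "bad C K y a \<longleftrightarrow> weakly_unit_summable p {..<K} y \<and> (\<forall>k<K. a k \<in> A) \<and>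
        C < (\<Sum>k<K. \<bar>blinfun_apply (a k) (y k)\<bar> powr p)"
      for C and K :: nat and y :: "nat \<Rightarrow> 'a" and a
    from no_bound have no: "\<exists>K y a. bad C K y a" if "C > 0" for C
      using that unfolding bad_def by (meson not_le)
    then have "\<forall>m :: nat. \<exists>K y a. bad (4 ^ m) K y a" by simp
    then obtain K y a where bad: "\<And>m :: nat. bad (4 ^ m) (K m) (y m) (a m)" by metis
    have uf: "weakly_unit_summable p {..<K m} (y m)" and a: "k < K m \<Longrightarrow> a m k \<in> A"
      and big: "4 ^ m < (\<Sum>k<K m. \<bar>blinfun_apply (a m k) (y m k)\<bar> powr p)" for m k
      using bad[of m] by (auto simp: bad_def)
    define z where "z m k = (if k < K m then (2 powr (- (real m / p))) *\<^sub>R y m k else 0)" for m k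
    define x where "x n = case_prod z (prod_decode n)" for n
    have xz: "x (prod_encode (m, k)) = z m k" for m k by (simp add: x_def)
    have zp: "\<bar>blinfun_apply \<phi> (z m k)\<bar> powr p = (1/2) ^ m * \<bar>blinfun_apply \<phi> (y m k)\<bar> powr p"
      if "k < K m" for \<phi> m k
    proof -
      have "\<bar>blinfun_apply \<phi> (z m k)\<bar> powr p = (2 powr (- (real m / p)) * \<bar>blinfun_apply \<phi> (y m k)\<bar>) powr p"
        using that by (simp add: z_def blinfun.scaleR_right abs_mult)
      also have "\<dots> = 2 powr (- real m) * \<bar>blinfun_apply \<phi> (y m k)\<bar> powr p"
        using p by (simp add: powr_mult powr_powr)
      also have "2 powr (- real m) = (1/2) ^ m"
        by (simp add: powr_minus powr_realpow power_one_over inverse_eq_divide)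
      finally show ?thesis .
    qed
    have block: "(\<Sum>k<K m. \<bar>blinfun_apply \<phi> (z m k)\<bar> powr p) \<le> (1/2) ^ m * (1 + norm \<phi>) powr p" for \<phi> m
    proof -
      have "(\<Sum>k<K m. \<bar>blinfun_apply \<phi> (y m k)\<bar> powr p) \<le> (1 + norm \<phi>) powr p"
        using p uf[of m] by (intro summing_norm_bound) (auto simp: weakly_unit_summable_def)
      then show ?thesis by (simp add: zp flip: sum_distrib_left)
    qed
    \<comment> \<open>The concatenated sequence is weakly p-summable because the m-th block weighs 2^-m.\<close>
    have "summable (\<lambda>n. \<bar>blinfun_apply \<phi> (x n)\<bar> powr p)" for \<phi>
    proof (rule summableI_nonneg_bounded)
      fix N
      define g where "g = (\<lambda>(m, k). \<bar>blinfun_apply \<phi> (z m k)\<bar> powr p)"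
      have g: "0 \<le> g i" for i by (auto simp: g_def split: prod.splits)
      have "(\<Sum>n<N. \<bar>blinfun_apply \<phi> (x n)\<bar> powr p) = (\<Sum>n<N. g (prod_decode n))"
        by (intro sum.cong) (auto simp: g_def x_def split: prod.splits)
      also have "\<dots> = (\<Sum>i\<in>prod_decode ` {..<N}. g i)"
        by (subst sum.reindex) (auto simp: inj_prod_decode)
      also have "\<dots> \<le> (\<Sum>i\<in>{..<N} \<times> {..<N}. g i)"
      proof (rule sum_mono2)
        show "prod_decode ` {..<N} \<subseteq> {..<N} \<times> {..<N}"
        proof
          fix i assume "i \<in> prod_decode ` {..<N}"
          then obtain n where n: "n < N" "i = prod_decode n" by auto
          obtain m k where mk: "i = (m, k)" by (cases i)
          then have "prod_encode (m, k) = n" using n by (metis prod_decode_inverse)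
          then show "i \<in> {..<N} \<times> {..<N}"
            using n(1) le_prod_encode_1[of m k] le_prod_encode_2[of k m] unfolding mk by simp
        qed
      qed (use g in auto)
      also have "\<dots> = (\<Sum>m<N. \<Sum>k<N. \<bar>blinfun_apply \<phi> (z m k)\<bar> powr p)"
        by (simp add: g_def sum.cartesian_product)
      also have "\<dots> \<le> (\<Sum>m<N. (1/2) ^ m * (1 + norm \<phi>) powr p)"
      proof (rule sum_mono)
        fix m
        have "(\<Sum>k<N. \<bar>blinfun_apply \<phi> (z m k)\<bar> powr p)
            = (\<Sum>k\<in>{..<N} \<inter> {..<K m}. \<bar>blinfun_apply \<phi> (z m k)\<bar> powr p)"
          by (rule sum.mono_neutral_right) (auto simp: z_def)
        also have "\<dots> \<le> (\<Sum>k<K m. \<bar>blinfun_apply \<phi> (z m k)\<bar> powr p)"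
          by (rule sum_mono2) auto
        also note block
        finally show "(\<Sum>k<N. \<bar>blinfun_apply \<phi> (z m k)\<bar> powr p) \<le> (1/2) ^ m * (1 + norm \<phi>) powr p" .
      qed
      also have "\<dots> = (\<Sum>m<N. (1/2) ^ m) * (1 + norm \<phi>) powr p"
        by (simp add: sum_distrib_right)
      also have "(\<Sum>m<N. (1/2) ^ m) \<le> (2 :: real)"
        using sum_le_suminf[OF summable_geometric[of "1/2 :: real"], of "{..<N}"]
          suminf_geometric[of "1/2 :: real"] by simp
      finally show "(\<Sum>n<N. \<bar>blinfun_apply \<phi> (x n)\<bar> powr p) \<le> 2 * (1 + norm \<phi>) powr p"
        by (simp add: mult_right_mono)
    qed simp
    then have "weak_star_summable p (\<lambda>n. Blinfun (\<lambda>\<phi>. blinfun_apply \<phi> (x n)))"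
      by (simp add: weak_star_summable_def ell_def bounded_linear_Blinfun_apply blinfun.bounded_linear_left)
    then obtain b where b: "b \<in> ell p" "\<And>\<phi> n. \<phi> \<in> A \<Longrightarrow> \<bar>blinfun_apply \<phi> (x n)\<bar> \<le> b n"
      using A unfolding limited_def
      by (auto simp: bounded_linear_Blinfun_apply blinfun.bounded_linear_left dest!: spec)
    have bs: "summable (\<lambda>n. \<bar>b n\<bar> powr p)" using b(1) by (simp add: ell_def)
    have "2 ^ m < (\<Sum>n. \<bar>b n\<bar> powr p)" for m
    proof -
      have "(2 :: real) ^ m = (1/2) ^ m * 4 ^ m"
        by (simp flip: power_mult_distrib)
      also have "\<dots> < (1/2) ^ m * (\<Sum>k<K m. \<bar>blinfun_apply (a m k) (y m k)\<bar> powr p)"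
        using big[of m] by simp
      also have "\<dots> = (\<Sum>k<K m. \<bar>blinfun_apply (a m k) (z m k)\<bar> powr p)"
        by (simp add: zp sum_distrib_left)
      also have "\<dots> \<le> (\<Sum>k<K m. \<bar>b (prod_encode (m, k))\<bar> powr p)"
      proof (rule sum_mono)
        fix k assume "k \<in> {..<K m}"
        then have "\<bar>blinfun_apply (a m k) (z m k)\<bar> \<le> b (prod_encode (m, k))"
          using b(2)[OF a, of k m "prod_encode (m, k)"] by (simp add: xz)
        then show "\<bar>blinfun_apply (a m k) (z m k)\<bar> powr p \<le> \<bar>b (prod_encode (m, k))\<bar> powr p"
          using p by (intro powr_mono2) auto
      qed
      also have "\<dots> = (\<Sum>n\<in>(\<lambda>k. prod_encode (m, k)) ` {..<K m}. \<bar>b n\<bar> powr p)"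
        by (subst sum.reindex) (auto simp: inj_on_def)
      also have "\<dots> \<le> (\<Sum>n. \<bar>b n\<bar> powr p)"
        using bs by (intro sum_le_suminf) auto
      finally show ?thesis .
    qed
    then show False using real_arch_pow[of 2 "\<Sum>n. \<bar>b n\<bar> powr p"] by (meson less_asym one_less_numeral_iff semiring_norm(76))
  qed
  then show ?thesis unfolding summing_with_def .
qed

text \<open>If the unit ball were, for every \<open>\<epsilon>\<close>, covered up to \<open>\<epsilon>\<close> uniformly on \<open>A\<close> by a finite set \<open>F\<close>, then
  the elements of \<open>A\<close> would be determined up to a multiple of \<open>\<epsilon>\<close> by their values on \<open>F\<close>, and \<open>A\<close>
  would be totally bounded. (This is the compactness of an operator and of its adjoint.)\<close>

lemma not_relatively_compact_imp_separated:
  fixes A :: "('a::real_normed_vector \<Rightarrow>\<^sub>L real) set"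
  assumes R: "\<And>\<phi>. \<phi> \<in> A \<Longrightarrow> norm \<phi> \<le> R" and A: "\<not> compact (closure A)"
  obtains \<epsilon> :: real and x :: "nat \<Rightarrow> 'a" where "\<epsilon> > 0" "\<And>n. norm (x n) \<le> 1"
    "\<And>n m. n \<noteq> m \<Longrightarrow> \<exists>\<phi>\<in>A. \<epsilon> \<le> \<bar>blinfun_apply \<phi> (x n - x m)\<bar>"
proof -
  have "\<exists>\<epsilon>>0. \<forall>F. finite F \<longrightarrow> F \<subseteq> cball (0::'a) 1 \<longrightarrow>
      (\<exists>x. norm x \<le> 1 \<and> (\<forall>y\<in>F. \<exists>\<phi>\<in>A. \<epsilon> \<le> \<bar>blinfun_apply \<phi> (x - y)\<bar>))"
  proof (rule ccontr)
    assume "\<not> ?thesis"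
    then have net: "\<exists>F. finite F \<and> F \<subseteq> cball (0::'a) 1 \<and>
        (\<forall>x. norm x \<le> 1 \<longrightarrow> (\<exists>y\<in>F. \<forall>\<phi>\<in>A. \<bar>blinfun_apply \<phi> (x - y)\<bar> < \<epsilon>))" if "\<epsilon> > 0" for \<epsilon>
      using that by (meson not_le)
    have "\<exists>k. finite k \<and> closure A \<subseteq> (\<Union>\<psi>\<in>k. ball \<psi> e)" if e: "e > 0" for e
    proof -
      define \<epsilon> where "\<epsilon> = e / 8"
      have \<epsilon>: "\<epsilon> > 0" using e by (simp add: \<epsilon>_def)
      obtain F where F: "finite F" "F \<subseteq> cball (0::'a) 1"
          "\<And>x. norm x \<le> 1 \<Longrightarrow> \<exists>y\<in>F. \<forall>\<phi>\<in>A. \<bar>blinfun_apply \<phi> (x - y)\<bar> < \<epsilon>"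
        using net[OF \<epsilon>] by blast
      \<comment> \<open>Pigeonhole: round the values on the net F to multiples of epsilon.\<close>
      define \<kappa> where "\<kappa> \<phi> = (\<lambda>y\<in>F. \<lfloor>blinfun_apply \<phi> y / \<epsilon>\<rfloor>)" for \<phi> :: "'a \<Rightarrow>\<^sub>L real"
      have "\<kappa> \<phi> \<in> F \<rightarrow>\<^sub>E {- \<lceil>R / \<epsilon>\<rceil>..\<lceil>R / \<epsilon>\<rceil>}" if \<phi>: "\<phi> \<in> A" for \<phi>
      proof -
        have "\<bar>blinfun_apply \<phi> y\<bar> \<le> R" if "y \<in> F" for y
        proof -
          have "\<bar>blinfun_apply \<phi> y\<bar> \<le> norm \<phi> * norm y" using norm_blinfun[of \<phi> y] by simp
          also have "\<dots> \<le> R * 1" using R[OF \<phi>] F(2) that order_trans[OF norm_ge_zero R[OF \<phi>]]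
            by (intro mult_mono) auto
          finally show ?thesis by simp
        qed
        then have bd: "- (R / \<epsilon>) \<le> blinfun_apply \<phi> y / \<epsilon>" "blinfun_apply \<phi> y / \<epsilon> \<le> R / \<epsilon>"
          if "y \<in> F" for y
          using \<epsilon> that by (auto simp: abs_le_iff divide_simps minus_le_iff)
        have "- \<lceil>R / \<epsilon>\<rceil> \<le> \<lfloor>blinfun_apply \<phi> y / \<epsilon>\<rfloor>" "\<lfloor>blinfun_apply \<phi> y / \<epsilon>\<rfloor> \<le> \<lceil>R / \<epsilon>\<rceil>"
          if "y \<in> F" for y
          using bd[OF that] by linarith+
        then show ?thesis by (auto simp: \<kappa>_def)
      qed
      then have "\<kappa> ` A \<subseteq> F \<rightarrow>\<^sub>E {- \<lceil>R / \<epsilon>\<rceil>..\<lceil>R / \<epsilon>\<rceil>}" by blast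
      then have fin: "finite (\<kappa> ` A)"
        using F(1) by (rule finite_subset[OF _ finite_PiE]) auto
      define k where "k = inv_into A \<kappa> ` \<kappa> ` A"
      have "closure A \<subseteq> (\<Union>\<psi>\<in>k. ball \<psi> e)"
      proof
        fix \<zeta> assume "\<zeta> \<in> closure A"
        then obtain \<phi> where \<phi>: "\<phi> \<in> A" "dist \<phi> \<zeta> < \<epsilon>"
          using \<epsilon> closure_approachable by blast
        define \<psi> where "\<psi> = inv_into A \<kappa> (\<kappa> \<phi>)"
        have \<psi>: "\<psi> \<in> k" "\<psi> \<in> A" "\<kappa> \<psi> = \<kappa> \<phi>"
          using \<phi>(1) by (auto simp: k_def \<psi>_def inv_into_into f_inv_into_f)
        have near: "\<bar>blinfun_apply \<psi> y - blinfun_apply \<phi> y\<bar> \<le> \<epsilon>" if "y \<in> F" for y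
        proof -
          have "\<lfloor>blinfun_apply \<psi> y / \<epsilon>\<rfloor> = \<lfloor>blinfun_apply \<phi> y / \<epsilon>\<rfloor>"
            using fun_cong[OF \<psi>(3), of y] that by (simp add: \<kappa>_def)
          then have "\<bar>blinfun_apply \<psi> y / \<epsilon> - blinfun_apply \<phi> y / \<epsilon>\<bar> \<le> 1" by linarith
          then show ?thesis using \<epsilon> by (simp add: abs_le_iff field_simps)
        qed
        have unit: "\<bar>blinfun_apply (\<psi> - \<phi>) x\<bar> \<le> 3 * \<epsilon>" if x: "norm x \<le> 1" for x
        proof -
          obtain y where y: "y \<in> F" "\<And>\<phi>. \<phi> \<in> A \<Longrightarrow> \<bar>blinfun_apply \<phi> (x - y)\<bar> < \<epsilon>"
            using F(3)[OF x] by blast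
          show ?thesis
            using y(2)[OF \<phi>(1)] y(2)[OF \<psi>(2)] near[OF y(1)]
            by (simp add: blinfun.diff_left blinfun.diff_right abs_le_iff abs_less_iff)
        qed
        have "norm (\<psi> - \<phi>) \<le> 3 * \<epsilon>"
        proof (rule norm_blinfun_bound)
          fix x :: 'a
          show "norm (blinfun_apply (\<psi> - \<phi>) x) \<le> 3 * \<epsilon> * norm x"
          proof (cases "x = 0")
            case False
            have "\<bar>blinfun_apply (\<psi> - \<phi>) (inverse (norm x) *\<^sub>R x)\<bar> \<le> 3 * \<epsilon>"
              using False by (intro unit) simp
            then show ?thesis using False by (simp add: blinfun.scaleR_right abs_mult field_simps)
          qed simp
        qed (use \<epsilon> in simp)
        then have "dist \<psi> \<zeta> \<le> 3 * \<epsilon> + \<epsilon>"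
          using dist_triangle[of \<psi> \<zeta> \<phi>] \<phi>(2) by (simp add: dist_norm)
        then have "dist \<psi> \<zeta> < e" using e by (simp add: \<epsilon>_def)
        then show "\<zeta> \<in> (\<Union>\<psi>\<in>k. ball \<psi> e)" using \<psi>(1) by auto
      qed
      moreover have "finite k" using fin by (simp add: k_def)
      ultimately show ?thesis by blast
    qed
    then have "compact (closure A)"
      unfolding compact_eq_totally_bounded by (simp add: complete_eq_closed)
    with A show False by contradiction
  qed
  then obtain \<epsilon> where \<epsilon>: "\<epsilon> > 0" "\<And>F. finite F \<Longrightarrow> F \<subseteq> cball (0::'a) 1 \<Longrightarrow>
      \<exists>x. norm x \<le> 1 \<and> (\<forall>y\<in>F. \<exists>\<phi>\<in>A. \<epsilon> \<le> \<bar>blinfun_apply \<phi> (x - y)\<bar>)"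
    by blast
  have "\<exists>x :: nat \<Rightarrow> 'a. \<forall>n. norm (x n) \<le> 1 \<and>
      (\<forall>m<n. \<exists>\<phi>\<in>A. \<epsilon> \<le> \<bar>blinfun_apply \<phi> (x n - x m)\<bar>)"
  proof (rule dependent_wellorder_choice)
    fix n and f :: "nat \<Rightarrow> 'a"
    assume "\<And>m. m < n \<Longrightarrow> norm (f m) \<le> 1 \<and>
        (\<forall>l<m. \<exists>\<phi>\<in>A. \<epsilon> \<le> \<bar>blinfun_apply \<phi> (f m - f l)\<bar>)"
    then have "f ` {..<n} \<subseteq> cball 0 1" by auto
    from \<epsilon>(2)[OF _ this] show "\<exists>r. norm r \<le> 1 \<and> (\<forall>m<n. \<exists>\<phi>\<in>A. \<epsilon> \<le> \<bar>blinfun_apply \<phi> (r - f m)\<bar>)"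
      by auto
  qed auto
  then obtain x :: "nat \<Rightarrow> 'a" where x: "\<And>n. norm (x n) \<le> 1"
      "\<And>n m. m < n \<Longrightarrow> \<exists>\<phi>\<in>A. \<epsilon> \<le> \<bar>blinfun_apply \<phi> (x n - x m)\<bar>"
    by blast
  show thesis
  proof (rule that[OF \<epsilon>(1) x(1)])
    fix n m :: nat assume "n \<noteq> m"
    then consider "m < n" | "n < m" by linarith
    then show "\<exists>\<phi>\<in>A. \<epsilon> \<le> \<bar>blinfun_apply \<phi> (x n - x m)\<bar>"
    proof cases
      case 2
      from x(2)[OF this] show ?thesis by (simp add: blinfun.diff_right abs_minus_commute)
    qed (rule x(2))
  qed
qed

section \<open>From limited sets to copies of the space of summable sequences\<close>

text \<open>The summing inequality for families with a single member bounds the norms.\<close>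

lemma limited_bounded:
  fixes A :: "('a::banach \<Rightarrow>\<^sub>L real) set"
  assumes p: "1 \<le> p" and A: "limited p A"
  obtains R where "\<And>\<phi>. \<phi> \<in> A \<Longrightarrow> norm \<phi> \<le> R"
proof -
  obtain C where C: "C > 0" "summing_with p C A" using limited_imp_summing[OF p A] by blast
  have unit: "\<bar>blinfun_apply \<phi> x\<bar> \<le> C + 1" if \<phi>: "\<phi> \<in> A" and x: "norm x \<le> 1" for \<phi> x
  proof -
    have "\<bar>blinfun_apply \<psi> x\<bar> powr p \<le> 1" if "norm \<psi> \<le> 1" for \<psi> :: "'a \<Rightarrow>\<^sub>L real"
    proof -
      have "norm (blinfun_apply \<psi> x) \<le> norm \<psi> * norm x" by (rule norm_blinfun)
      also have "\<dots> \<le> 1 * 1" using that x by (intro mult_mono) auto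
      finally show ?thesis using p powr_mono2[of p "\<bar>blinfun_apply \<psi> x\<bar>" 1] by simp
    qed
    then have le: "\<bar>blinfun_apply \<phi> x\<bar> powr p \<le> C"
      using summing_withD[OF C(2), of "{()}" "\<lambda>_. x" "\<lambda>_. \<phi>"] \<phi>
      by (simp add: weakly_unit_summable_def)
    show ?thesis
    proof (cases "\<bar>blinfun_apply \<phi> x\<bar> \<le> 1")
      case False
      then have "\<bar>blinfun_apply \<phi> x\<bar> powr 1 \<le> \<bar>blinfun_apply \<phi> x\<bar> powr p"
        using p by (intro powr_mono) auto
      with le False show ?thesis by simp
    qed (use C in simp)
  qed
  have "norm \<phi> \<le> C + 1" if \<phi>: "\<phi> \<in> A" for \<phi>
  proof (rule norm_blinfun_bound)
    fix x :: 'a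
    show "norm (blinfun_apply \<phi> x) \<le> (C + 1) * norm x"
    proof (cases "x = 0")
      case False
      have "\<bar>blinfun_apply \<phi> (inverse (norm x) *\<^sub>R x)\<bar> \<le> C + 1"
        using False by (intro unit[OF \<phi>]) simp
      then show ?thesis using False by (simp add: blinfun.scaleR_right abs_mult field_simps)
    qed simp
  qed (use C in simp)
  then show thesis by (rule that)
qed

text \<open>A vector as a bounded function on the dual unit ball. Extending it by zero to all functionals
  lets means be taken over the whole type.\<close>

definition ball_eval :: "'a::real_normed_vector \<Rightarrow> ('a \<Rightarrow>\<^sub>L real) \<Rightarrow> real" where
  "ball_eval x \<phi> = (if norm \<phi> \<le> 1 then blinfun_apply \<phi> x else 0)"

lemma ball_eval_bound: "\<bar>ball_eval x \<phi>\<bar> \<le> norm x"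
proof (cases "norm \<phi> \<le> 1")
  case True
  have "norm (blinfun_apply \<phi> x) \<le> norm \<phi> * norm x" by (rule norm_blinfun)
  also have "\<dots> \<le> 1 * norm x" using True by (intro mult_right_mono) auto
  finally show ?thesis using True by (simp add: ball_eval_def)
qed (simp add: ball_eval_def)

lemma ball_eval_diff: "ball_eval (x - y) \<phi> = ball_eval x \<phi> - ball_eval y \<phi>"
  by (simp add: ball_eval_def blinfun.diff_right)

lemma bounded_fun_ball_eval_powr:
  "0 \<le> p \<Longrightarrow> bounded_fun (\<lambda>\<phi>. \<bar>ball_eval x \<phi>\<bar> powr p)"
  by (rule bounded_funI[of _ "norm x powr p"]) (auto intro!: powr_mono2 ball_eval_bound)

text \<open>A form of the Pietsch domination theorem. The cone spanned by the functions
  \<open>\<bar>y\<^sub>i\<bar> powr p - \<epsilon> powr p / C\<close> contains no function bounded above by a negative constant: after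
  rescaling the \<open>y\<^sub>i\<close> by the \<open>p\<close>-th roots of the coefficients, such a function would contradict the
  summing inequality.\<close>

lemma summing_imp_mean:
  fixes A :: "('a::real_normed_vector \<Rightarrow>\<^sub>L real) set" and y :: "'i \<Rightarrow> 'a"
  assumes p: "1 \<le> p" and C: "C > 0" and \<epsilon>: "\<epsilon> > 0"
    and summing: "summing_with p C A"
    and y: "\<And>i. i \<in> S \<Longrightarrow> \<exists>\<phi>\<in>A. \<epsilon> \<le> \<bar>blinfun_apply \<phi> (y i)\<bar>"
  obtains T where "subprobability_mean T"
    "\<And>i. i \<in> S \<Longrightarrow> \<epsilon> powr p / C \<le> T (\<lambda>\<phi>. \<bar>ball_eval (y i) \<phi>\<bar> powr p)"
proof -
  define c where "c = \<epsilon> powr p / C"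
  define h where "h i \<phi> = \<bar>ball_eval (y i) \<phi>\<bar> powr p - c" for i \<phi>
  have hb: "bounded_fun (h i)" for i
    unfolding h_def using p by (intro bounded_fun_diff bounded_fun_ball_eval_powr bounded_fun_const) auto
  define G where "G = {g. \<exists>I w. finite I \<and> I \<subseteq> S \<and> (\<forall>i. 0 \<le> w i) \<and> g = (\<lambda>\<phi>. \<Sum>i\<in>I. w i * h i \<phi>)}"
  have GI: "(\<lambda>\<phi>. \<Sum>i\<in>I. w i * h i \<phi>) \<in> G" if "finite I" "I \<subseteq> S" "\<And>i. 0 \<le> w i" for I w
    using that by (auto simp: G_def)
  obtain a where a: "\<And>i. i \<in> S \<Longrightarrow> a i \<in> A" "\<And>i. i \<in> S \<Longrightarrow> \<epsilon> \<le> \<bar>blinfun_apply (a i) (y i)\<bar>"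
    using y by metis
  have almost: "\<exists>\<phi>. - e \<le> g \<phi>" if g: "g \<in> G" and e: "e > 0" for g e
  proof (rule ccontr)
    assume "\<not> ?thesis"
    then have neg: "g \<phi> < - e" for \<phi> by (meson not_le)
    obtain I w where I: "finite I" "I \<subseteq> S" and w: "\<And>i. 0 \<le> w i"
      and geq: "g = (\<lambda>\<phi>. \<Sum>i\<in>I. w i * h i \<phi>)"
      using g by (auto simp: G_def)
    define W where "W = (\<Sum>i\<in>I. w i)"
    define s where "s = c * W - e"
    have expand: "g \<phi> = (\<Sum>i\<in>I. w i * \<bar>ball_eval (y i) \<phi>\<bar> powr p) - c * W" for \<phi>
      unfolding geq h_def W_def by (simp add: right_diff_distrib sum_subtractf sum_distrib_left mult.commute)
    have "0 \<le> (\<Sum>i\<in>I. w i * \<bar>ball_eval (y i) 0\<bar> powr p)"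
      using w by (intro sum_nonneg mult_nonneg_nonneg) auto
    with neg[of 0] expand[of 0] have s: "s > 0" by (simp add: s_def)
    define z where "z i = ((w i / s) powr (1 / p)) *\<^sub>R y i" for i
    have zp: "\<bar>blinfun_apply \<phi> (z i)\<bar> powr p = (w i / s) * \<bar>blinfun_apply \<phi> (y i)\<bar> powr p" for \<phi> i
    proof -
      have "\<bar>blinfun_apply \<phi> (z i)\<bar> = (w i / s) powr (1 / p) * \<bar>blinfun_apply \<phi> (y i)\<bar>"
        by (simp add: z_def blinfun.scaleR_right abs_mult)
      then show ?thesis using p w[of i] s by (simp add: powr_mult powr_powr)
    qed
    have "(\<Sum>i\<in>I. \<bar>blinfun_apply (a i) (z i)\<bar> powr p) \<le> C"
    proof (rule summing_withD[OF summing I(1)], unfold weakly_unit_summable_def, intro allI impI)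
      fix \<phi> :: "'a \<Rightarrow>\<^sub>L real" assume \<phi>: "norm \<phi> \<le> 1"
      have "(\<Sum>i\<in>I. \<bar>blinfun_apply \<phi> (z i)\<bar> powr p)
          = (\<Sum>i\<in>I. w i * \<bar>ball_eval (y i) \<phi>\<bar> powr p) / s"
        using \<phi> by (simp add: zp ball_eval_def sum_divide_distrib)
      also have "\<dots> \<le> s / s"
        using neg[of \<phi>] expand[of \<phi>] s by (intro divide_right_mono) (auto simp: s_def)
      finally show "(\<Sum>i\<in>I. \<bar>blinfun_apply \<phi> (z i)\<bar> powr p) \<le> 1" using s by simp
    qed (use a I in auto)
    moreover have "(\<Sum>i\<in>I. (w i / s) * \<epsilon> powr p) \<le> (\<Sum>i\<in>I. \<bar>blinfun_apply (a i) (z i)\<bar> powr p)"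
      unfolding zp using w s a(2) I \<epsilon> p by (intro sum_mono mult_left_mono powr_mono2) auto
    moreover have "(\<Sum>i\<in>I. (w i / s) * \<epsilon> powr p) = W * \<epsilon> powr p / s"
      by (simp add: W_def sum_divide_distrib sum_distrib_right)
    ultimately have "W * \<epsilon> powr p / s \<le> C" by linarith
    then have "W * \<epsilon> powr p \<le> C * s" using s by (simp add: divide_le_eq)
    then have "c * W \<le> s" using C by (simp add: c_def field_simps)
    then show False using e by (simp add: s_def)
  qed
  obtain T where T: "subprobability_mean T" "T (\<lambda>_. 1) = 1" "\<And>g. g \<in> G \<Longrightarrow> 0 \<le> T g"
  proof (rule mean_nonneg_on_cone[of G])
    show "bounded_fun g" if "g \<in> G" for g
      using that hb by (auto simp: G_def intro!: bounded_fun_sum bounded_fun_mult)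
    show "(\<lambda>_. 0) \<in> G" using GI[of "{}" "\<lambda>_. 0"] by simp
    show "(\<lambda>\<phi>. g \<phi> + g' \<phi>) \<in> G" if gg: "g \<in> G" "g' \<in> G" for g g'
    proof -
      obtain I w where I: "finite I" "I \<subseteq> S" "\<And>i. 0 \<le> w i" "g = (\<lambda>\<phi>. \<Sum>i\<in>I. w i * h i \<phi>)"
        using gg(1) by (auto simp: G_def)
      obtain J v where J: "finite J" "J \<subseteq> S" "\<And>i. 0 \<le> v i" "g' = (\<lambda>\<phi>. \<Sum>i\<in>J. v i * h i \<phi>)"
        using gg(2) by (auto simp: G_def)
      define u where "u i = (if i \<in> I then w i else 0) + (if i \<in> J then v i else 0)" for i
      have "g \<phi> + g' \<phi> = (\<Sum>i\<in>I \<union> J. u i * h i \<phi>)" for \<phi>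
      proof -
        have "g \<phi> = (\<Sum>i\<in>I \<union> J. (if i \<in> I then w i else 0) * h i \<phi>)"
          unfolding I(4) using I(1) J(1) by (intro sum.mono_neutral_cong_left) auto
        moreover have "g' \<phi> = (\<Sum>i\<in>I \<union> J. (if i \<in> J then v i else 0) * h i \<phi>)"
          unfolding J(4) using I(1) J(1) by (intro sum.mono_neutral_cong_left) auto
        ultimately show ?thesis by (simp add: u_def distrib_right sum.distrib)
      qed
      moreover have "(\<lambda>\<phi>. \<Sum>i\<in>I \<union> J. u i * h i \<phi>) \<in> G"
        using I J by (intro GI) (auto simp: u_def)
      ultimately show ?thesis by simp
    qed
    show "(\<lambda>\<phi>. t * g \<phi>) \<in> G" if g: "g \<in> G" and t: "t > 0" for g t
    proof -
      obtain I w where I: "finite I" "I \<subseteq> S" "\<And>i. 0 \<le> w i" "g = (\<lambda>\<phi>. \<Sum>i\<in>I. w i * h i \<phi>)"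
        using g by (auto simp: G_def)
      have "(\<lambda>\<phi>. t * g \<phi>) = (\<lambda>\<phi>. \<Sum>i\<in>I. (t * w i) * h i \<phi>)"
        by (simp add: I(4) sum_distrib_left mult.assoc)
      moreover have "\<dots> \<in> G" using I t by (intro GI) auto
      ultimately show ?thesis by simp
    qed
    show "\<exists>\<phi>. - e \<le> g \<phi>" if "g \<in> G" "e > 0" for g e using that by (rule almost)
  qed blast
  interpret subprobability_mean T by (rule T(1))
  show thesis
  proof (rule that[OF T(1)])
    fix i assume i: "i \<in> S"
    have "h i \<in> G" using GI[of "{i}" "\<lambda>_. 1"] i by simp
    then have "0 \<le> T (h i)" by (rule T(3))
    also have "T (h i) = T (\<lambda>\<phi>. \<bar>ball_eval (y i) \<phi>\<bar> powr p) - c"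
      unfolding h_def using p const[of c] T(2) by (simp add: diff bounded_fun_ball_eval_powr)
    finally show "\<epsilon> powr p / C \<le> T (\<lambda>\<phi>. \<bar>ball_eval (y i) \<phi>\<bar> powr p)" by (simp add: c_def)
  qed
qed

lemma powr_le_affine_square:
  assumes p: "(p::real) > 0" and c: "c > 0"
  obtains D where "D > 0" "\<And>t :: real. \<bar>t\<bar> \<le> 2 \<Longrightarrow> \<bar>t\<bar> powr p \<le> c + D * t\<^sup>2"
proof
  define \<eta> where "\<eta> = c powr (1 / p)"
  have \<eta>: "\<eta> > 0" "\<eta> powr p = c" using p c by (simp_all add: \<eta>_def powr_powr)
  show "2 powr p / \<eta>\<^sup>2 > 0" using \<eta> by simp
  fix t :: real assume t: "\<bar>t\<bar> \<le> 2"
  show "\<bar>t\<bar> powr p \<le> c + 2 powr p / \<eta>\<^sup>2 * t\<^sup>2"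
  proof (cases "\<bar>t\<bar> \<le> \<eta>")
    case True
    then have "\<bar>t\<bar> powr p \<le> \<eta> powr p" using p by (intro powr_mono2) auto
    moreover have "0 \<le> 2 powr p / \<eta>\<^sup>2 * t\<^sup>2" by simp
    ultimately show ?thesis using \<eta>(2) by linarith
  next
    case False
    then have "\<eta>\<^sup>2 \<le> \<bar>t\<bar>\<^sup>2" using \<eta>(1) by (intro power_mono) auto
    then have "1 \<le> t\<^sup>2 / \<eta>\<^sup>2" using \<eta>(1) by (simp add: le_divide_eq)
    then have "2 powr p * 1 \<le> 2 powr p * (t\<^sup>2 / \<eta>\<^sup>2)" by (intro mult_left_mono) auto
    moreover have "\<bar>t\<bar> powr p \<le> 2 powr p" using t p by (intro powr_mono2) auto
    ultimately show ?thesis using c by simp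
  qed
qed

text \<open>The lower bound for the mean of \<open>\<bar>x\<^sub>n - x\<^sub>m\<bar> powr p\<close> passes to the mean of the square, since on
  \<open>[-2, 2]\<close> the \<open>p\<close>-th power is at most a small constant plus a multiple of the square.\<close>

lemma limited_not_compact_imp_independent:
  fixes A :: "('a::banach \<Rightarrow>\<^sub>L real) set"
  assumes p: "1 \<le> p" and A: "limited p A" "\<not> compact (closure A)"
  obtains x :: "nat \<Rightarrow> 'a" and r h where "h > 0" "\<And>n. norm (x n) \<le> 1"
    "\<And>k \<epsilon>. \<exists>\<phi>. \<forall>i<k. if \<epsilon> i then r + h < ball_eval (x i) \<phi> else ball_eval (x i) \<phi> < r"
proof -
  obtain C where C: "C > 0" "summing_with p C A" using limited_imp_summing[OF p A(1)] by blast
  obtain R where "\<And>\<phi>. \<phi> \<in> A \<Longrightarrow> norm \<phi> \<le> R" using limited_bounded[OF p A(1)] by blast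
  then obtain \<epsilon> and x :: "nat \<Rightarrow> 'a" where \<epsilon>: "\<epsilon> > 0" and x: "\<And>n. norm (x n) \<le> 1"
    and sep: "\<And>n m. n \<noteq> m \<Longrightarrow> \<exists>\<phi>\<in>A. \<epsilon> \<le> \<bar>blinfun_apply \<phi> (x n - x m)\<bar>"
    using not_relatively_compact_imp_separated[OF _ A(2)] by metis
  define c where "c = \<epsilon> powr p / C"
  have c: "c > 0" using \<epsilon> C(1) by (simp add: c_def)
  obtain T where T: "subprobability_mean T"
    "\<And>i. i \<in> {(n, m). n \<noteq> m} \<Longrightarrow> c \<le> T (\<lambda>\<phi>. \<bar>ball_eval (case i of (n, m) \<Rightarrow> x n - x m) \<phi>\<bar> powr p)"
    unfolding c_def
    by (rule summing_imp_mean[where A = A and S = "{(n, m). n \<noteq> m}" and y = "\<lambda>(n, m). x n - x m", OF p C(1) \<epsilon> C(2)])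
      (use sep in auto)
  interpret subprobability_mean T by (rule T(1))
  obtain D where D: "D > 0" "\<And>t :: real. \<bar>t\<bar> \<le> 2 \<Longrightarrow> \<bar>t\<bar> powr p \<le> c / 2 + D * t\<^sup>2"
    using powr_le_affine_square[of p "c / 2"] p c by auto
  have ev: "\<bar>ball_eval (x n) \<phi>\<bar> \<le> 1" for n \<phi> using ball_eval_bound[of "x n" \<phi>] x[of n] by linarith
  then have evb: "bounded_fun (ball_eval (x n))" for n by (rule bounded_funI)
  have square: "c / (2 * D) \<le> T (\<lambda>\<phi>. (ball_eval (x n) \<phi> - ball_eval (x m) \<phi>)\<^sup>2)" if "n \<noteq> m" for n m
  proof -
    let ?d = "\<lambda>\<phi>. ball_eval (x n) \<phi> - ball_eval (x m) \<phi>"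
    have db: "bounded_fun ?d" using evb by (intro bounded_fun_diff)
    have "c \<le> T (\<lambda>\<phi>. \<bar>ball_eval (x n - x m) \<phi>\<bar> powr p)" using T(2)[of "(n, m)"] that by simp
    also have "\<dots> \<le> T (\<lambda>\<phi>. c / 2 + D * (?d \<phi>)\<^sup>2)"
    proof (rule mono)
      show "bounded_fun (\<lambda>\<phi>. \<bar>ball_eval (x n - x m) \<phi>\<bar> powr p)"
        using p by (intro bounded_fun_ball_eval_powr) simp
      show "bounded_fun (\<lambda>\<phi>. c / 2 + D * (?d \<phi>)\<^sup>2)"
        using db by (intro bounded_fun_add bounded_fun_const bounded_fun_mult bounded_fun_power)
      show "\<bar>ball_eval (x n - x m) \<phi>\<bar> powr p \<le> c / 2 + D * (?d \<phi>)\<^sup>2" for \<phi>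
      proof -
        have "\<bar>?d \<phi>\<bar> \<le> 2" using ev[of n \<phi>] ev[of m \<phi>] by linarith
        then show ?thesis unfolding ball_eval_diff by (rule D(2))
      qed
    qed
    also have "\<dots> = c / 2 * T (\<lambda>_. 1) + D * T (\<lambda>\<phi>. (?d \<phi>)\<^sup>2)"
      using db const[of "c / 2"] by (simp add: add scale bounded_fun_mult bounded_fun_power)
    also have "\<dots> \<le> c / 2 * 1 + D * T (\<lambda>\<phi>. (?d \<phi>)\<^sup>2)"
      using one_le c by (intro add_right_mono mult_left_mono) auto
    finally show ?thesis using D(1) by (simp add: field_simps)
  qed
  obtain \<sigma> :: "nat \<Rightarrow> nat" and r h where \<sigma>: "strict_mono \<sigma>" "h > 0" and
    indep: "\<And>k \<epsilon>. \<exists>\<phi>. \<forall>i<k. if \<epsilon> i then r + h < ball_eval (x (\<sigma> i)) \<phi> else ball_eval (x (\<sigma> i)) \<phi> < r"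
  proof (rule independent_subsequence[of T "\<lambda>n. ball_eval (x n)" "c / (2 * D)", OF T(1) ev _ square])
    show "0 < c / (2 * D)" using c D(1) by simp
  qed blast+
  show thesis
  proof (rule that[of h "\<lambda>i. x (\<sigma> i)" r])
    show "\<exists>\<phi>. \<forall>i<k. if \<epsilon> i then r + h < ball_eval (x (\<sigma> i)) \<phi> else ball_eval (x (\<sigma> i)) \<phi> < r"
      for k \<epsilon>
      by (rule indep)
  qed (use \<sigma> x in auto)
qed

text \<open>Rosenthal's argument: choose \<open>\<phi>\<close> following the signs of the coefficients and \<open>\<psi>\<close> following the
  opposite signs. The evaluations at \<open>\<phi>\<close> and \<open>\<psi>\<close> differ by at most twice the norm on any vector, and
  by at least \<open>h * \<bar>c i\<bar>\<close> on the term \<open>c i *\<^sub>R x i\<close>.\<close>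

lemma independent_imp_ell1_lower_bound:
  fixes x :: "nat \<Rightarrow> 'a::real_normed_vector"
  assumes h: "h > 0"
    and indep: "\<And>k \<epsilon>. \<exists>\<phi>. \<forall>i<k. if \<epsilon> i then r + h < ball_eval (x i) \<phi> else ball_eval (x i) \<phi> < r"
  shows "h / 2 * (\<Sum>i<k. \<bar>c i\<bar>) \<le> norm (\<Sum>i<k. c i *\<^sub>R x i)"
proof (cases "k = 0")
  case False
  obtain \<phi> where \<phi>: "\<And>i. i < k \<Longrightarrow> if 0 \<le> c i then r + h < ball_eval (x i) \<phi> else ball_eval (x i) \<phi> < r"
    using indep[of k "\<lambda>i. 0 \<le> c i"] by blast
  obtain \<psi> where \<psi>: "\<And>i. i < k \<Longrightarrow> if c i < 0 then r + h < ball_eval (x i) \<psi> else ball_eval (x i) \<psi> < r"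
    using indep[of k "\<lambda>i. c i < 0"] by blast
  define v where "v = (\<Sum>i<k. c i *\<^sub>R x i)"
  have lin: "ball_eval v \<xi> = (\<Sum>i<k. c i * ball_eval (x i) \<xi>)" for \<xi>
    by (simp add: ball_eval_def v_def blinfun.sum_right blinfun.scaleR_right)
  have "h * (\<Sum>i<k. \<bar>c i\<bar>) = (\<Sum>i<k. h * \<bar>c i\<bar>)" by (rule sum_distrib_left)
  also have "\<dots> \<le> (\<Sum>i<k. c i * (ball_eval (x i) \<phi> - ball_eval (x i) \<psi>))"
  proof (rule sum_mono)
    fix i assume "i \<in> {..<k}"
    then have i: "i < k" by simp
    show "h * \<bar>c i\<bar> \<le> c i * (ball_eval (x i) \<phi> - ball_eval (x i) \<psi>)"
    proof (cases "0 \<le> c i")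
      case True
      then have "h \<le> ball_eval (x i) \<phi> - ball_eval (x i) \<psi>" using \<phi>[OF i] \<psi>[OF i] by simp
      from mult_left_mono[OF this True] show ?thesis using True by (simp add: mult.commute)
    next
      case False
      then have "h \<le> ball_eval (x i) \<psi> - ball_eval (x i) \<phi>" using \<phi>[OF i] \<psi>[OF i] by simp
      then have "- c i * h \<le> - c i * (ball_eval (x i) \<psi> - ball_eval (x i) \<phi>)"
        using False by (intro mult_left_mono) auto
      then show ?thesis using False by (simp add: algebra_simps)
    qed
  qed
  also have "\<dots> = ball_eval v \<phi> - ball_eval v \<psi>"
    by (simp add: lin right_diff_distrib sum_subtractf)
  also have "\<dots> \<le> 2 * norm v" using ball_eval_bound[of v \<phi>] ball_eval_bound[of v \<psi>] by linarith
  finally show ?thesis by (simp add: v_def)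
qed simp

lemma ell1_lower_bound_imp_copy:
  fixes x :: "nat \<Rightarrow> 'a::banach"
  assumes x: "\<And>n. norm (x n) \<le> 1" and \<delta>: "\<delta> > 0"
    and lower: "\<And>c k. \<delta> * (\<Sum>i<k. \<bar>c i\<bar>) \<le> norm (\<Sum>i<k. c i *\<^sub>R x i)"
  shows "contains_copy_of_ell1 TYPE('a)"
proof -
  define T where "T c = (\<Sum>i. seq c i *\<^sub>R x i)" for c
  have nle: "norm (seq c i *\<^sub>R x i) \<le> \<bar>seq c i\<bar>" for c i
    using x[of i] by (simp add: mult_left_le)
  have sum_norm: "summable (\<lambda>i. norm (seq c i *\<^sub>R x i))" for c
    by (rule summable_comparison_test'[OF summable_abs_seq[of c], of 0]) (use nle in simp)
  have sm: "summable (\<lambda>i. seq c i *\<^sub>R x i)" for c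
    using sum_norm by (rule summable_norm_cancel)
  have bl: "bounded_linear T"
  proof (rule bounded_linear_intro)
    show "T (b + c) = T b + T c" for b c
      unfolding T_def by (simp add: suminf_add[OF sm sm] plus_ell1.rep_eq scaleR_add_left)
    show "T (t *\<^sub>R c) = t *\<^sub>R T c" for t c
      unfolding T_def by (simp add: suminf_scaleR_right[OF sm] scaleR_ell1.rep_eq)
    show "norm (T c) \<le> norm c * 1" for c
    proof -
      have "norm (T c) \<le> (\<Sum>i. norm (seq c i *\<^sub>R x i))"
        unfolding T_def by (rule summable_norm[OF sum_norm])
      also have "\<dots> \<le> norm c"
        unfolding norm_ell1_def by (rule suminf_le[OF nle sum_norm summable_abs_seq])
      finally show ?thesis by simp
    qed
  qed
  have below: "\<delta> * norm c \<le> norm (T c)" for c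
  proof (rule LIMSEQ_le)
    show "(\<lambda>k. \<delta> * (\<Sum>i<k. \<bar>seq c i\<bar>)) \<longlonglongrightarrow> \<delta> * norm c"
      unfolding norm_ell1_def by (intro tendsto_intros summable_LIMSEQ summable_abs_seq)
    show "(\<lambda>k. norm (\<Sum>i<k. seq c i *\<^sub>R x i)) \<longlonglongrightarrow> norm (T c)"
      unfolding T_def by (intro tendsto_norm summable_LIMSEQ sm)
    show "\<exists>N. \<forall>k\<ge>N. \<delta> * (\<Sum>i<k. \<bar>seq c i\<bar>) \<le> norm (\<Sum>i<k. seq c i *\<^sub>R x i)"
      using lower by blast
  qed
  interpret T: bounded_linear T by (rule bl)
  have inj: "inj T"
  proof (rule injI)
    fix b c assume "T b = T c"
    then have "\<delta> * norm (b - c) \<le> 0" using below[of "b - c"] by (simp add: T.diff)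
    then show "b = c" using \<delta> by (simp add: mult_le_0_iff)
  qed
  define S where "S = inv T"
  have ST: "S (T c) = c" for c using inj by (simp add: S_def)
  have cont: "continuous_on (range T) S"
  proof (rule lipschitz_on_continuous_on[OF lipschitz_onI])
    fix u v assume "u \<in> range T" "v \<in> range T"
    then obtain b c where bc: "u = T b" "v = T c" by blast
    show "dist (S u) (S v) \<le> (1 / \<delta>) * dist u v"
      using below[of "b - c"] \<delta> unfolding bc ST by (simp add: dist_norm T.diff field_simps)
  qed (use \<delta> in simp)
  have "complete (range T)"
    using \<delta> bl below by (intro complete_isometric_image[of \<delta> UNIV T]) (auto simp: complete_UNIV)
  then have "closed (range T)" by (rule complete_imp_closed)
  moreover have "subspace (range T)" using linear_subspace_image[OF T.linear subspace_UNIV] .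
  moreover have "homeomorphism UNIV (range T) T S"
    using cont T.continuous_on[OF continuous_on_id] by (auto simp: homeomorphism_def ST image_iff)
  ultimately show ?thesis
    unfolding contains_copy_of_ell1_def using T.linear by blast
qed

theorem not_contains_ell1_imp_weak_GP:
  assumes p: "1 \<le> p" and no: "\<not> contains_copy_of_ell1 TYPE('a::banach)"
  shows "weak_GP_property p TYPE('a \<Rightarrow>\<^sub>L real)"
  unfolding weak_GP_property_def
proof (intro allI impI, rule ccontr)
  fix A :: "('a \<Rightarrow>\<^sub>L real) set"
  assume "limited p A" "\<not> compact (closure A)"
  then obtain x :: "nat \<Rightarrow> 'a" and r h where x: "h > 0" "\<And>n. norm (x n) \<le> 1"
    "\<And>k \<epsilon>. \<exists>\<phi>. \<forall>i<k. if \<epsilon> i then r + h < ball_eval (x i) \<phi> else ball_eval (x i) \<phi> < r"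
    using limited_not_compact_imp_independent[OF p] by metis
  have "contains_copy_of_ell1 TYPE('a)"
    by (rule ell1_lower_bound_imp_copy[OF x(2) _ independent_imp_ell1_lower_bound[OF x(1,3)]])
      (use x(1) in simp)
  with no show False by contradiction
qed

section \<open>Uniform boundedness and convexity\<close>

text \<open>A uniform boundedness principle: by Baire's theorem, the partial sums are bounded uniformly on
  some ball, hence near the origin, and the bound follows by homogeneity. It is stated with a bound on
  all partial sums so that finitely many functionals can be handled at a time.\<close>

lemma weak_star_summable_bound:
  fixes f :: "nat \<Rightarrow> 'z::banach \<Rightarrow>\<^sub>L real"
  assumes p: "0 < p" and f: "weak_star_summable p f"
  shows "\<exists>C\<ge>0. \<forall>z K. (\<Sum>k<K. \<bar>blinfun_apply (f k) z\<bar> powr p) \<le> C * norm z powr p"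
proof -
  define V where "V z K = (\<Sum>k<K. \<bar>blinfun_apply (f k) z\<bar> powr p)" for z K
  define F where "F M = {z. \<forall>K. V z K \<le> real M}" for M :: nat
  have closed: "closed (F M)" for M
  proof -
    have "closed {z. V z K \<le> real M}" for K
      unfolding V_def
      by (intro closed_Collect_le continuous_on_sum continuous_on_powr' continuous_on_rabs
          continuous_on_const linear_continuous_on blinfun.bounded_linear_right) (use p in auto)
    then show ?thesis unfolding F_def by (simp add: closed_Collect_all)
  qed
  have cover: "(\<Union>M. F M) = UNIV"
  proof -
    have "\<exists>M. z \<in> F M" for z
    proof -
      have s: "summable (\<lambda>k. \<bar>blinfun_apply (f k) z\<bar> powr p)"
        using f by (auto simp: weak_star_summable_def ell_def)
      obtain M :: nat where "(\<Sum>k. \<bar>blinfun_apply (f k) z\<bar> powr p) \<le> M" using real_arch_simple by blast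
      moreover have "V z K \<le> (\<Sum>k. \<bar>blinfun_apply (f k) z\<bar> powr p)" for K
        unfolding V_def by (rule sum_le_suminf[OF s]) auto
      ultimately show ?thesis by (auto simp: F_def intro: order_trans)
    qed
    then show ?thesis by auto
  qed
  have "\<exists>M. interior (F M) \<noteq> {}"
  proof (rule ccontr)
    assume "\<not> ?thesis"
    then have "Met_TC.mtopology interior_of \<Union>(range F) = {}"
      using closed
      by (intro Met_TC.metric_Baire_category_alt) (auto simp: complete_UNIV)
    then show False using cover by simp
  qed
  then obtain M z0 r where r: "r > 0" "ball z0 r \<subseteq> F M"
    by (metis ex_in_conv mem_interior)
  have add_powr: "\<bar>a - b\<bar> powr p \<le> 2 powr p * (\<bar>a\<bar> powr p + \<bar>b\<bar> powr p)" for a b :: real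
  proof -
    have "\<bar>a - b\<bar> powr p \<le> (2 * max \<bar>a\<bar> \<bar>b\<bar>) powr p" using p by (intro powr_mono2) auto
    also have "\<dots> = 2 powr p * max \<bar>a\<bar> \<bar>b\<bar> powr p" by (simp add: powr_mult)
    also have "\<dots> \<le> 2 powr p * (\<bar>a\<bar> powr p + \<bar>b\<bar> powr p)"
      by (intro mult_left_mono) (auto simp: max_def)
    finally show ?thesis .
  qed
  have small: "V z K \<le> 2 powr p * (2 * M)" if z: "norm z < r" for z K
  proof -
    have "z0 + z \<in> F M" "z0 \<in> F M" using r z by (auto simp: dist_norm)
    then have V: "V (z0 + z) K \<le> M" "V z0 K \<le> M" by (auto simp: F_def)
    have "V z K = (\<Sum>k<K. \<bar>blinfun_apply (f k) (z0 + z) - blinfun_apply (f k) z0\<bar> powr p)"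
      by (simp add: V_def blinfun.add_right)
    also have "\<dots> \<le> (\<Sum>k<K. 2 powr p * (\<bar>blinfun_apply (f k) (z0 + z)\<bar> powr p + \<bar>blinfun_apply (f k) z0\<bar> powr p))"
      by (intro sum_mono add_powr)
    also have "\<dots> = 2 powr p * (V (z0 + z) K + V z0 K)"
      by (simp add: V_def sum_distrib_left sum.distrib distrib_left)
    also have "\<dots> \<le> 2 powr p * (2 * M)" using V by (intro mult_left_mono) auto
    finally show ?thesis .
  qed
  define C where "C = 2 powr p * (2 * M) / (r / 2) powr p"
  have "V z K \<le> C * norm z powr p" for z K
  proof (cases "z = 0")
    case True
    then show ?thesis using p by (simp add: V_def)
  next
    case False
    define t where "t = (r / 2) / norm z"
    have t: "t > 0" using r False by (simp add: t_def)
    have "V (t *\<^sub>R z) K = t powr p * V z K"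
      using t by (simp add: V_def blinfun.scaleR_right abs_mult powr_mult sum_distrib_left)
    moreover have "norm (t *\<^sub>R z) < r" using r False by (simp add: t_def)
    ultimately have "t powr p * V z K \<le> 2 powr p * (2 * M)" using small by metis
    moreover have "t powr p = (r / 2) powr p / norm z powr p"
      using r by (simp add: t_def powr_divide powr_mult)
    ultimately show ?thesis using r False by (simp add: C_def field_simps)
  qed
  moreover have "C \<ge> 0" by (simp add: C_def)
  ultimately show ?thesis unfolding V_def by blast
qed

lemma convex_on_powr_nonneg:
  assumes p: "1 \<le> p" shows "convex_on {0..} (\<lambda>x::real. x powr p)"
proof (rule convex_onI)
  fix t x y :: real
  assume t: "0 < t" "t < 1" and xy: "x \<in> {0..}" "y \<in> {0..}"
  have shrink: "(u * v) powr p \<le> u * v powr p" if "0 < u" "u < 1" "0 \<le> v" for u v :: real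
  proof -
    have "u powr p \<le> u powr 1" using that p by (intro powr_mono') auto
    then have "u powr p * v powr p \<le> u * v powr p" using that by (intro mult_right_mono) auto
    then show ?thesis by (simp add: powr_mult)
  qed
  show "((1 - t) *\<^sub>R x + t *\<^sub>R y) powr p \<le> (1 - t) * x powr p + t * y powr p"
  proof (cases "x = 0 \<or> y = 0")
    case True
    then show ?thesis using t xy shrink[of t y] shrink[of "1 - t" x] p by auto
  next
    case False
    then show ?thesis using convex_onD[OF powr_convex[OF p], of t x y] t xy by auto
  qed
qed simp

lemma powr_average_le:
  assumes p: "1 \<le> p" and S: "finite S" "S \<noteq> {}" and t: "\<And>i. i \<in> S \<Longrightarrow> 0 \<le> t i"
  shows "((\<Sum>i\<in>S. t i) / card S) powr p \<le> (\<Sum>i\<in>S. t i powr p) / card S"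
  using convex_on_sum[OF S convex_on_powr_nonneg[OF p], of "\<lambda>_. 1 / card S" t] S t
  by (simp add: sum_divide_distrib)

lemma homogeneous_continuous_imp_bounded:
  fixes g :: "'u::real_normed_vector \<Rightarrow> 'v::real_normed_vector"
  assumes Y: "subspace Y" and cont: "continuous_on Y g"
    and scale: "\<And>c y. y \<in> Y \<Longrightarrow> g (c *\<^sub>R y) = c *\<^sub>R g y"
  obtains B where "B > 0" "\<And>y. y \<in> Y \<Longrightarrow> norm (g y) \<le> B * norm y"
proof -
  have g0: "g 0 = 0" using scale[OF subspace_0[OF Y], of 0] by simp
  obtain d where d: "d > 0" "\<And>y. y \<in> Y \<Longrightarrow> norm y < d \<Longrightarrow> norm (g y) < 1"
    using cont subspace_0[OF Y] g0 unfolding continuous_on_iff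
    by (metis dist_0_norm dist_commute zero_less_one)
  show thesis
  proof (rule that[of "2 / d"])
    fix y assume y: "y \<in> Y"
    show "norm (g y) \<le> 2 / d * norm y"
    proof (cases "y = 0")
      case False
      define c where "c = (d / 2) / norm y"
      have "norm (g (c *\<^sub>R y)) < 1"
        using y Y d(1) False by (intro d(2)) (auto simp: c_def subspace_scale)
      then have "c * norm (g y) < 1" using d(1) by (simp add: scale[OF y] c_def)
      then show ?thesis using d(1) False by (simp add: c_def field_simps)
    qed (simp add: g0)
  qed (use d in simp)
qed

section \<open>Rademacher functions and the dyadic mean\<close>

text \<open>The \<open>n\<close>-th sign is read off the \<open>n\<close>-th binary digit of \<open>j\<close>, so that the natural numbers take the
  place of the Cantor group of all sign sequences.\<close>

definition rademacher :: "nat \<Rightarrow> nat \<Rightarrow> real" where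
  "rademacher n j = (- 1) ^ (j div 2 ^ n)"

lemma abs_rademacher [simp]: "\<bar>rademacher n j\<bar> = 1"
  by (simp add: rademacher_def power_abs)

lemma rademacher_mod:
  assumes "n < N" shows "rademacher n (j mod 2 ^ N) = rademacher n j"
proof -
  obtain d where d: "N = n + Suc d" using assms less_imp_Suc_add by auto
  have "j = j mod 2 ^ N + (j div 2 ^ N * 2 ^ Suc d) * 2 ^ n"
    using mod_mult_div_eq[of j "2 ^ N"] by (simp add: d power_add mult_ac)
  then have "j div 2 ^ n = j mod 2 ^ N div 2 ^ n + j div 2 ^ N * 2 ^ Suc d"
    by (metis div_mult_self1 power_not_zero zero_neq_numeral add.commute)
  moreover have "even (j div 2 ^ N * 2 ^ Suc d)" by simp
  ultimately show ?thesis by (simp only: rademacher_def power_add neg_one_even_power mult_1_right)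
qed

lemma sum_lessThan_add:
  fixes g :: "nat \<Rightarrow> real"
  shows "(\<Sum>j<m + k. g j) = (\<Sum>j<m. g j) + (\<Sum>j<k. g (m + j))"
  by (induction k) (auto simp: add.assoc)

lemma sum_periodic:
  fixes g :: "nat \<Rightarrow> real"
  assumes g: "\<And>j. g (j mod 2 ^ N) = g j"
  shows "(\<Sum>j<2 ^ (N + d). g j) = 2 ^ d * (\<Sum>j<2 ^ N. g j)"
proof (induction d)
  case (Suc d)
  have "g (2 ^ (N + d) + j) = g j" for j
    using g[of "2 ^ (N + d) + j"] g[of j] by (simp add: power_add)
  moreover have "(\<Sum>j<2 ^ (N + d) + 2 ^ (N + d). g j)
      = (\<Sum>j<2 ^ (N + d). g j) + (\<Sum>j<2 ^ (N + d). g (2 ^ (N + d) + j))"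
    by (rule sum_lessThan_add)
  moreover have "(2::nat) ^ (N + Suc d) = 2 ^ (N + d) + 2 ^ (N + d)" by simp
  ultimately have "(\<Sum>j<2 ^ (N + Suc d). g j) = 2 * (\<Sum>j<2 ^ (N + d). g j)" by (simp only:)
  then show ?case using Suc by simp
qed simp

lemma sum_rademacher_mult:
  assumes "n < m" shows "(\<Sum>j<2 ^ Suc m. rademacher n j * rademacher m j) = 0"
proof -
  have "rademacher n (2 ^ m + j) = rademacher n j" for j
    using rademacher_mod[OF assms, of "2 ^ m + j"] rademacher_mod[OF assms, of j] by simp
  moreover have "rademacher m (2 ^ m + j) = - 1 \<and> rademacher m j = 1" if "j < 2 ^ m" for j
    using that by (simp add: rademacher_def)
  moreover have "(\<Sum>j<2 ^ m + 2 ^ m. rademacher n j * rademacher m j)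
      = (\<Sum>j<2 ^ m. rademacher n j * rademacher m j)
        + (\<Sum>j<2 ^ m. rademacher n (2 ^ m + j) * rademacher m (2 ^ m + j))"
    by (rule sum_lessThan_add)
  moreover have "(2::nat) ^ Suc m = 2 ^ m + 2 ^ m" by simp
  ultimately show ?thesis by (simp only:) (simp add: sum_negf)
qed

text \<open>On functions which depend on finitely many binary digits only, this is integration against Haar
  measure on the Cantor group; the ultrafilter extends it to all bounded functions.\<close>

definition dyadic_mean :: "nat filter \<Rightarrow> (nat \<Rightarrow> real) \<Rightarrow> real" where
  "dyadic_mean U f = Lim U (\<lambda>N. (\<Sum>j<2 ^ N. f j) / 2 ^ N)"

context free_ultrafilter
begin

lemma dyadic_mean_tendsto:
  assumes "bounded_fun f"
  shows "((\<lambda>N. (\<Sum>j<2 ^ N. f j) / 2 ^ N) \<longlongrightarrow> dyadic_mean U f) U"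
proof -
  obtain M where M: "M \<ge> 0" "\<And>x. \<bar>f x\<bar> \<le> M" using bounded_funE[OF assms] by blast
  have "\<bar>(\<Sum>j<2 ^ N. f j) / 2 ^ N\<bar> \<le> M" for N
  proof -
    have "\<bar>\<Sum>j<2 ^ N. f j\<bar> \<le> (\<Sum>j<2 ^ N. \<bar>f j\<bar>)" by (rule sum_abs)
    also have "\<dots> \<le> 2 ^ N * M" using sum_bounded_above[of "{..<2 ^ N}" "\<lambda>j. \<bar>f j\<bar>" M] M(2) by simp
    finally show ?thesis by (simp add: divide_le_eq mult.commute)
  qed
  then show ?thesis unfolding dyadic_mean_def by (rule tendsto_Lim_bounded)
qed

lemma dyadic_mean_subprobability: "subprobability_mean (dyadic_mean U)"
proof
  show "dyadic_mean U (\<lambda>j. f j + g j) = dyadic_mean U f + dyadic_mean U g"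
    if "bounded_fun f" "bounded_fun g" for f g
  proof -
    have "((\<lambda>N. (\<Sum>j<2 ^ N. f j) / 2 ^ N + (\<Sum>j<2 ^ N. g j) / 2 ^ N)
        \<longlongrightarrow> dyadic_mean U f + dyadic_mean U g) U"
      using that by (intro tendsto_add dyadic_mean_tendsto)
    then show ?thesis unfolding dyadic_mean_def[of _ "\<lambda>j. f j + g j"]
      by (intro Lim_eqI) (simp add: sum.distrib add_divide_distrib)
  qed
  show "dyadic_mean U (\<lambda>j. c * f j) = c * dyadic_mean U f" if "bounded_fun f" for f c
  proof -
    have "((\<lambda>N. c * ((\<Sum>j<2 ^ N. f j) / 2 ^ N)) \<longlongrightarrow> c * dyadic_mean U f) U"
      using that by (intro tendsto_mult_left dyadic_mean_tendsto)
    then show ?thesis unfolding dyadic_mean_def[of _ "\<lambda>j. c * f j"]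
      by (intro Lim_eqI) (simp add: sum_distrib_left)
  qed
  show "0 \<le> dyadic_mean U f" if "bounded_fun f" "\<And>j. 0 \<le> f j" for f
  proof (rule tendsto_lowerbound[OF dyadic_mean_tendsto[OF that(1)]])
    show "\<forall>\<^sub>F N in U. 0 \<le> (\<Sum>j<2 ^ N. f j) / 2 ^ N"
      using that(2) by (intro always_eventually allI divide_nonneg_nonneg sum_nonneg) auto
  qed (use proper in auto)
  have "dyadic_mean U (\<lambda>_. 1) = 1"
    unfolding dyadic_mean_def by (intro Lim_eqI) simp
  then show "dyadic_mean U (\<lambda>_. 1) \<le> 1" by simp
qed

lemma dyadic_mean_periodic:
  assumes g: "\<And>j. g (j mod 2 ^ N) = g j"
  shows "dyadic_mean U g = (\<Sum>j<2 ^ N. g j) / 2 ^ N"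
  unfolding dyadic_mean_def
proof (intro Lim_eqI tendsto_eventually)
  have "(\<Sum>j<2 ^ M. g j) / 2 ^ M = (\<Sum>j<2 ^ N. g j) / 2 ^ N" if "N \<le> M" for M
    using sum_periodic[of g N "M - N", OF g] that
    by (simp add: power_add[symmetric] field_simps flip: power_add)
  then have "\<forall>\<^sub>F M in sequentially. (\<Sum>j<2 ^ M. g j) / 2 ^ M = (\<Sum>j<2 ^ N. g j) / 2 ^ N"
    unfolding eventually_sequentially by blast
  then show "\<forall>\<^sub>F M in U. (\<Sum>j<2 ^ M. g j) / 2 ^ M = (\<Sum>j<2 ^ N. g j) / 2 ^ N"
    by (rule filter_leD[OF free])
qed

lemma dyadic_mean_rademacher:
  "dyadic_mean U (\<lambda>j. rademacher n j * rademacher m j) = of_bool (n = m)"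
proof -
  have less: "dyadic_mean U (\<lambda>j. rademacher n j * rademacher m j) = 0" if "n < m" for n m
  proof -
    have "dyadic_mean U (\<lambda>j. rademacher n j * rademacher m j)
        = (\<Sum>j<2 ^ Suc m. rademacher n j * rademacher m j) / 2 ^ Suc m"
      using that rademacher_mod[of n "Suc m"] rademacher_mod[of m "Suc m"]
      by (intro dyadic_mean_periodic) simp
    then show ?thesis by (simp only: sum_rademacher_mult[OF that])
  qed
  consider "n < m" | "m < n" | "n = m" by linarith
  then show ?thesis
  proof cases
    case 3
    have "rademacher m j * rademacher m j = 1" for j
      by (simp add: rademacher_def flip: power_mult_distrib)
    then show ?thesis using 3 by (simp add: dyadic_mean_def Lim_eqI)
  qed (use less[of n m] less[of m n] in \<open>simp_all add: mult.commute\<close>)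
qed

end

section \<open>From copies of the space of summable sequences to limited sets\<close>

text \<open>The \<open>\<psi> N i\<close> are the values at the dyadic cells of level \<open>N\<close> of a bounded vector-valued
  martingale. Finitely many of the \<open>a n\<close>, one for each functional \<open>f k\<close>, are averages over one
  common level, so that Jensen's inequality bounds the \<open>p\<close>-sum of the \<open>f k (a (n k))\<close> by an average of
  \<open>p\<close>-sums at single vectors. As the choice of \<open>n k\<close> is arbitrary, the suprema over \<open>n\<close> are
  \<open>p\<close>-summable.\<close>

lemma bounded_tree_averages_limited:
  fixes a :: "nat \<Rightarrow> 'z::banach" and \<psi> :: "nat \<Rightarrow> nat \<Rightarrow> 'z"
  assumes p: "1 \<le> p" and \<psi>: "\<And>N i. norm (\<psi> N i) \<le> D"
    and a: "\<And>n N. n < N \<Longrightarrow> a n = (1 / 2 ^ N) *\<^sub>R (\<Sum>i<2 ^ N. rademacher n i *\<^sub>R \<psi> N i)"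
  shows "limited p (range a)"
  unfolding limited_def
proof (intro allI impI)
  fix f :: "nat \<Rightarrow> 'z \<Rightarrow>\<^sub>L real" assume "weak_star_summable p f"
  then obtain C where C: "C \<ge> 0" "\<And>z K. (\<Sum>k<K. \<bar>blinfun_apply (f k) z\<bar> powr p) \<le> C * norm z powr p"
    using weak_star_summable_bound[of p f] p by auto
  define B where "B = C * D powr p"
  have choice: "(\<Sum>k<K. \<bar>blinfun_apply (f k) (a (n k))\<bar> powr p) \<le> B" for K and n :: "nat \<Rightarrow> nat"
  proof -
    define N where "N = Suc (Max (n ` {..<K} \<union> {0}))"
    have N: "n k < N" if "k < K" for k
      unfolding N_def less_Suc_eq_le using that by (intro Max_ge) auto
    have "(\<Sum>k<K. \<bar>blinfun_apply (f k) (a (n k))\<bar> powr p)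
        \<le> (\<Sum>k<K. (\<Sum>i<2 ^ N. \<bar>blinfun_apply (f k) (\<psi> N i)\<bar> powr p) / 2 ^ N)"
    proof (rule sum_mono)
      fix k assume "k \<in> {..<K}"
      then have k: "n k < N" using N by simp
      have "\<bar>blinfun_apply (f k) (a (n k))\<bar>
          = \<bar>\<Sum>i<2 ^ N. rademacher (n k) i * blinfun_apply (f k) (\<psi> N i)\<bar> / 2 ^ N"
        by (simp add: a[OF k] blinfun.scaleR_right blinfun.sum_right abs_mult)
      also have "\<dots> \<le> (\<Sum>i<2 ^ N. \<bar>blinfun_apply (f k) (\<psi> N i)\<bar>) / 2 ^ N"
        by (intro divide_right_mono order_trans[OF sum_abs]) (auto simp: abs_mult)
      finally have "\<bar>blinfun_apply (f k) (a (n k))\<bar> powr p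
          \<le> ((\<Sum>i<2 ^ N. \<bar>blinfun_apply (f k) (\<psi> N i)\<bar>) / 2 ^ N) powr p"
        using p by (intro powr_mono2) auto
      also have "\<dots> \<le> (\<Sum>i<2 ^ N. \<bar>blinfun_apply (f k) (\<psi> N i)\<bar> powr p) / 2 ^ N"
        using powr_average_le[OF p, of "{..<2 ^ N :: nat}" "\<lambda>i. \<bar>blinfun_apply (f k) (\<psi> N i)\<bar>"]
        by (simp add: lessThan_empty_iff)
      finally show "\<bar>blinfun_apply (f k) (a (n k))\<bar> powr p
          \<le> (\<Sum>i<2 ^ N. \<bar>blinfun_apply (f k) (\<psi> N i)\<bar> powr p) / 2 ^ N" .
    qed
    also have "\<dots> = (\<Sum>i<2 ^ N. \<Sum>k<K. \<bar>blinfun_apply (f k) (\<psi> N i)\<bar> powr p) / 2 ^ N"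
      by (subst sum.swap) (simp add: sum_divide_distrib)
    also have "\<dots> \<le> (\<Sum>i<(2::nat) ^ N. B) / 2 ^ N"
    proof (intro divide_right_mono sum_mono)
      fix i
      have "(\<Sum>k<K. \<bar>blinfun_apply (f k) (\<psi> N i)\<bar> powr p) \<le> C * norm (\<psi> N i) powr p" by (rule C(2))
      also have "\<dots> \<le> B" unfolding B_def using C(1) \<psi> p by (intro mult_left_mono powr_mono2) auto
      finally show "(\<Sum>k<K. \<bar>blinfun_apply (f k) (\<psi> N i)\<bar> powr p) \<le> B" .
    qed simp
    also have "\<dots> = B" by simp
    finally show ?thesis .
  qed
  define q where "q k = (SUP n. \<bar>blinfun_apply (f k) (a n)\<bar> powr p)" for k
  have bdd: "bdd_above (range (\<lambda>n. \<bar>blinfun_apply (f k) (a n)\<bar> powr p))" for k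
  proof (rule bdd_aboveI2)
    fix n
    have "\<bar>blinfun_apply (f k) (a n)\<bar> powr p \<le> (\<Sum>j<Suc k. \<bar>blinfun_apply (f j) (a n)\<bar> powr p)"
      by (rule member_le_sum) auto
    also have "\<dots> \<le> B" by (rule choice)
    finally show "\<bar>blinfun_apply (f k) (a n)\<bar> powr p \<le> B" .
  qed
  have le_q: "\<bar>blinfun_apply (f k) (a n)\<bar> powr p \<le> q k" for k n
    unfolding q_def using bdd by (intro cSUP_upper) auto
  have q0: "0 \<le> q k" for k using le_q[of k 0] powr_ge_zero order_trans by blast
  have sum_q: "(\<Sum>k<K. q k) \<le> B" for K
  proof (rule field_le_epsilon)
    fix e :: real assume e: "e > 0"
    define d where "d = e / (K + 1)"
    have d: "d > 0" using e by (simp add: d_def)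
    have "\<exists>n. q k - d < \<bar>blinfun_apply (f k) (a n)\<bar> powr p" for k
      using less_cSUP_iff[OF _ bdd[of k], of "q k - d"] d unfolding q_def by auto
    then obtain n where n: "\<And>k. q k - d < \<bar>blinfun_apply (f k) (a (n k))\<bar> powr p" by metis
    have "(\<Sum>k<K. q k) \<le> (\<Sum>k<K. \<bar>blinfun_apply (f k) (a (n k))\<bar> powr p + d)"
    proof (rule sum_mono)
      fix k show "q k \<le> \<bar>blinfun_apply (f k) (a (n k))\<bar> powr p + d" using n[of k] by linarith
    qed
    also have "\<dots> \<le> B + K * d" using choice[of n K] by (simp add: sum.distrib)
    also have "K * d \<le> e" using e by (simp add: d_def field_simps)
    finally show "(\<Sum>k<K. q k) \<le> B + e" by simp
  qed
  define b where "b k = q k powr (1 / p)" for k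
  have bp: "\<bar>b k\<bar> powr p = q k" for k using p q0[of k] by (simp add: b_def powr_powr)
  have "b \<in> ell p"
    unfolding ell_def mem_Collect_eq bp using q0 sum_q by (rule summableI_nonneg_bounded)
  moreover have "\<bar>blinfun_apply (f k) (a n)\<bar> \<le> b k" for k n
  proof -
    have "\<bar>blinfun_apply (f k) (a n)\<bar> = (\<bar>blinfun_apply (f k) (a n)\<bar> powr p) powr (1 / p)"
      using p by (simp add: powr_powr)
    also have "\<dots> \<le> b k" unfolding b_def using p le_q by (intro powr_mono2) auto
    finally show ?thesis .
  qed
  ultimately show "\<exists>b\<in>ell p. \<forall>z\<in>range a. \<forall>n. \<bar>blinfun_apply (f n) z\<bar> \<le> b n" by blast
qed

text \<open>The weak integral of the functionals \<open>\<phi>\<^sub>j\<close> against the weight \<open>w\<close>; its norm is controlled by the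
  \<open>L\<^sup>1\<close> norm of \<open>w\<close>.\<close>

lemma averaged_functional:
  fixes \<phi> :: "nat \<Rightarrow> 'a::real_normed_vector \<Rightarrow>\<^sub>L real"
  assumes T: "subprobability_mean T" and w: "bounded_fun w"
    and \<phi>: "\<And>j. norm (\<phi> j) \<le> D"
    and M: "M \<ge> 0" "T (\<lambda>j. \<bar>w j\<bar>) \<le> M"
  shows "\<exists>\<xi> :: 'a \<Rightarrow>\<^sub>L real. norm \<xi> \<le> M * D \<and>
    (\<forall>x. blinfun_apply \<xi> x = T (\<lambda>j. w j * blinfun_apply (\<phi> j) x))"
proof -
  interpret subprobability_mean T by (rule T)
  have D: "D \<ge> 0" using \<phi>[of 0] norm_ge_zero order_trans by blast
  have \<phi>x: "\<bar>blinfun_apply (\<phi> j) x\<bar> \<le> D * norm x" for j x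
  proof -
    have "norm (blinfun_apply (\<phi> j) x) \<le> norm (\<phi> j) * norm x" by (rule norm_blinfun)
    also have "\<dots> \<le> D * norm x" using \<phi> by (intro mult_right_mono) auto
    finally show ?thesis by simp
  qed
  then have \<phi>b: "bounded_fun (\<lambda>j. blinfun_apply (\<phi> j) x)" for x by (rule bounded_funI)
  have wb: "bounded_fun (\<lambda>j. \<bar>w j\<bar>)" using w by (auto simp: bounded_fun_def)
  define L where "L x = T (\<lambda>j. w j * blinfun_apply (\<phi> j) x)" for x
  have bound: "\<bar>L x\<bar> \<le> M * D * norm x" for x
  proof -
    have up: "T g \<le> (D * norm x) * T (\<lambda>j. \<bar>w j\<bar>)"
      if "bounded_fun g" "\<And>j. \<bar>g j\<bar> = \<bar>w j\<bar> * \<bar>blinfun_apply (\<phi> j) x\<bar>" for g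
    proof -
      have "g j \<le> (D * norm x) * \<bar>w j\<bar>" for j
        using mult_left_mono[OF \<phi>x[of j x], of "\<bar>w j\<bar>"] abs_ge_self[of "g j"] that(2)[of j]
        by (simp add: mult.commute)
      then have "T g \<le> T (\<lambda>j. (D * norm x) * \<bar>w j\<bar>)"
        using that(1) wb by (intro mono) auto
      then show ?thesis using wb by (simp add: scale)
    qed
    have gb: "bounded_fun (\<lambda>j. w j * blinfun_apply (\<phi> j) x)" using w \<phi>b by (intro bounded_fun_mult)
    have "L x \<le> (D * norm x) * T (\<lambda>j. \<bar>w j\<bar>)"
      unfolding L_def using gb by (intro up) (auto simp: abs_mult)
    moreover have "- L x \<le> (D * norm x) * T (\<lambda>j. \<bar>w j\<bar>)"
      unfolding L_def minus[OF gb, symmetric] using gb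
      by (intro up bounded_fun_minus) (auto simp: abs_mult)
    moreover have "(D * norm x) * T (\<lambda>j. \<bar>w j\<bar>) \<le> (D * norm x) * M"
      using M D by (intro mult_left_mono) auto
    ultimately show ?thesis by (simp add: abs_le_iff mult_ac)
  qed
  have bl: "bounded_linear L"
  proof (rule bounded_linear_intro)
    show "L (x + y) = L x + L y" for x y
    proof -
      have "L (x + y) = T (\<lambda>j. w j * blinfun_apply (\<phi> j) x + w j * blinfun_apply (\<phi> j) y)"
        by (simp add: L_def blinfun.add_right distrib_left)
      also have "\<dots> = L x + L y" unfolding L_def using w \<phi>b by (intro add bounded_fun_mult)
      finally show ?thesis .
    qed
    show "L (c *\<^sub>R x) = c *\<^sub>R L x" for c x
    proof -
      have "L (c *\<^sub>R x) = T (\<lambda>j. c * (w j * blinfun_apply (\<phi> j) x))"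
        by (simp add: L_def blinfun.scaleR_right mult_ac)
      also have "\<dots> = c * L x" unfolding L_def using w \<phi>b by (intro scale bounded_fun_mult)
      finally show ?thesis by simp
    qed
    show "norm (L x) \<le> norm x * (M * D)" for x using bound[of x] by (simp add: mult.commute)
  qed
  show ?thesis
  proof (intro exI[of _ "Blinfun L"] conjI allI)
    show "blinfun_apply (Blinfun L) x = T (\<lambda>j. w j * blinfun_apply (\<phi> j) x)" for x
      by (simp add: bounded_linear_Blinfun_apply[OF bl] L_def)
    show "norm (Blinfun L) \<le> M * D"
      using bound M D by (intro norm_blinfun_bound) (simp_all add: bounded_linear_Blinfun_apply[OF bl])
  qed
qed

text \<open>The \<open>e\<^sub>m\<close> are the images of the unit vectors of \<open>\<ell>\<^sub>1\<close>. A bounded sequence of signs is a functional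
  on \<open>\<ell>\<^sub>1\<close>, which is transported to the copy and extended by Hahn-Banach.\<close>

lemma copy_imp_sign_functionals:
  assumes "contains_copy_of_ell1 TYPE('a::banach)"
  obtains e :: "nat \<Rightarrow> 'a::banach" and \<phi> :: "nat \<Rightarrow> 'a::banach \<Rightarrow>\<^sub>L real" and E D where
    "E > 0" "D > 0" "\<And>n. norm (e n) \<le> E" "\<And>j. norm (\<phi> j) \<le> D"
    "\<And>j m. blinfun_apply (\<phi> j) (e m) = rademacher m j"
proof -
  obtain Y :: "'a set" and T :: "ell1 \<Rightarrow> 'a" and S where Y: "subspace Y" and lin: "linear T"
    and hom: "homeomorphism UNIV Y T S"
    using assms unfolding contains_copy_of_ell1_def by blast
  have ST: "S (T c) = c" and TY: "range T = Y" for c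
    using hom by (auto simp: homeomorphism_def)
  have ex: "\<exists>c. y = T c" if "y \<in> Y" for y using that TY by blast
  obtain E where E: "E > 0" "\<And>c. norm (T c) \<le> E * norm c"
    using homogeneous_continuous_imp_bounded[of UNIV T] hom linear_scale[OF lin]
    by (metis homeomorphism_cont1 subspace_UNIV UNIV_I)
  obtain D where D: "D > 0" "\<And>y. y \<in> Y \<Longrightarrow> norm (S y) \<le> D * norm y"
  proof (rule homogeneous_continuous_imp_bounded[OF Y])
    show "continuous_on Y S" using hom by (rule homeomorphism_cont2)
    show "S (c *\<^sub>R y) = c *\<^sub>R S y" if "y \<in> Y" for c y
      using ex[OF that] by (metis ST linear_scale[OF lin])
  qed blast
  define unit where "unit m = Abs_ell1 (\<lambda>n. of_bool (n = m))" for m :: nat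
  have seq_unit: "seq (unit m) = (\<lambda>n. of_bool (n = m))" for m
    unfolding unit_def by (rule Abs_ell1_inverse) (simp add: ell_1_iff summable_single[of m] of_bool_def if_distrib cong: if_cong)
  have one: "(\<lambda>n. c n * of_bool (n = m)) sums c m" for c :: "nat \<Rightarrow> real" and m
    using sums_single[of m c] by (simp add: of_bool_def if_distrib cong: if_cong)
  have norm_unit: "norm (unit m) = 1" for m
    using sums_unique[OF one[of "\<lambda>_. 1" m]] by (simp add: norm_ell1_def seq_unit)
  have "\<exists>\<phi> :: 'a \<Rightarrow>\<^sub>L real. norm \<phi> \<le> D \<and> (\<forall>m. blinfun_apply \<phi> (T (unit m)) = rademacher m j)" for j
  proof -
    define g where "g y = (\<Sum>m. rademacher m j * seq (S y) m)" for y
    have nrm: "summable (\<lambda>m. \<bar>rademacher m j * seq c m\<bar>)" for c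
      using summable_abs_seq[of c] by (simp add: abs_mult)
    have sm: "summable (\<lambda>m. rademacher m j * seq c m)" for c
      using nrm by (rule summable_rabs_cancel)
    have Sadd: "S (x + y) = S x + S y" if "x \<in> Y" "y \<in> Y" for x y
      using ex[OF that(1)] ex[OF that(2)] by (metis ST linear_add[OF lin])
    have Sscale: "S (c *\<^sub>R y) = c *\<^sub>R S y" if "y \<in> Y" for c y
      using ex[OF that] by (metis ST linear_scale[OF lin])
    obtain \<phi> :: "'a \<Rightarrow>\<^sub>L real" where \<phi>: "\<And>x. x \<in> Y \<Longrightarrow> blinfun_apply \<phi> x = g x" "norm \<phi> \<le> D"
    proof (rule bounded_functional_extension[OF Y, of D g])
      show "g (x + y) = g x + g y" if "x \<in> Y" "y \<in> Y" for x y
        unfolding g_def Sadd[OF that]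
        by (simp add: plus_ell1.rep_eq distrib_left suminf_add[OF sm sm])
      show "g (c *\<^sub>R y) = c * g y" if "y \<in> Y" for c y
        unfolding g_def Sscale[OF that]
        by (simp add: scaleR_ell1.rep_eq suminf_mult[OF sm, symmetric] mult_ac)
      show "\<bar>g y\<bar> \<le> D * norm y" if "y \<in> Y" for y
      proof -
        have "\<bar>g y\<bar> \<le> (\<Sum>m. \<bar>rademacher m j * seq (S y) m\<bar>)"
          unfolding g_def by (rule summable_rabs[OF nrm])
        also have "\<dots> = norm (S y)" by (simp add: norm_ell1_def abs_mult)
        also have "\<dots> \<le> D * norm y" by (rule D(2)[OF that])
        finally show ?thesis .
      qed
    qed (use D in auto)
    have "blinfun_apply \<phi> (T (unit m)) = rademacher m j" for m
    proof -
      have "blinfun_apply \<phi> (T (unit m)) = g (T (unit m))" using TY by (intro \<phi>) blast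
      also have "\<dots> = rademacher m j"
        unfolding g_def ST seq_unit using sums_unique[OF one[of "\<lambda>m. rademacher m j" m]] by simp
      finally show ?thesis .
    qed
    with \<phi>(2) show ?thesis by blast
  qed
  then obtain \<phi> :: "nat \<Rightarrow> 'a \<Rightarrow>\<^sub>L real" where \<phi>: "\<And>j. norm (\<phi> j) \<le> D"
      "\<And>j m. blinfun_apply (\<phi> j) (T (unit m)) = rademacher m j"
    by metis
  have "norm (T (unit m)) \<le> E" for m using E(2)[of "unit m"] by (simp add: norm_unit)
  then show thesis using E(1) D(1) \<phi> by (intro that[of E D "\<lambda>m. T (unit m)" \<phi>])
qed

lemma separated_not_relatively_compact:
  fixes a :: "nat \<Rightarrow> 'z::metric_space"
  assumes d: "d > 0" and sep: "\<And>n m. n \<noteq> m \<Longrightarrow> d \<le> dist (a n) (a m)"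
  shows "\<not> compact (closure (range a))"
proof
  assume "compact (closure (range a))"
  then have "seq_compact (closure (range a))" by (rule compact_imp_seq_compact)
  moreover have "\<forall>n. a n \<in> closure (range a)" using closure_subset[of "range a"] by auto
  ultimately obtain l r where r: "strict_mono r" "(a \<circ> r) \<longlonglongrightarrow> l"
    unfolding seq_compact_def by blast
  then have "Cauchy (a \<circ> r)" by (intro LIMSEQ_imp_Cauchy)
  then obtain N where N: "\<And>m n. m \<ge> N \<Longrightarrow> n \<ge> N \<Longrightarrow> dist ((a \<circ> r) m) ((a \<circ> r) n) < d"
    using d unfolding Cauchy_def by blast
  have "r N \<noteq> r (Suc N)" using r(1) by (simp add: strict_mono_eq)
  from sep[OF this] N[of N "Suc N"] show False by simp
qed

text \<open>The set which is limited but not relatively compact consists of the averages \<open>a n\<close> of the sign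
  functionals against the Rademacher functions. The tree \<open>\<psi> N i\<close> consists of the conditional
  averages over the indices \<open>j\<close> with prescribed last \<open>N\<close> binary digits \<open>i\<close>. The factor \<open>2\<^sup>N\<close>
  normalises the cell to mass one, so these averages keep the norm bound of the sign functionals.\<close>

theorem contains_ell1_imp_not_weak_GP:
  assumes p: "1 \<le> p" and copy: "contains_copy_of_ell1 TYPE('a::banach)"
  shows "\<not> weak_GP_property p TYPE('a \<Rightarrow>\<^sub>L real)"
proof -
  obtain e :: "nat \<Rightarrow> 'a" and \<phi> :: "nat \<Rightarrow> 'a \<Rightarrow>\<^sub>L real" and E D where
    E: "E > 0" and D: "D > 0" and e: "\<And>n. norm (e n) \<le> E" and \<phi>: "\<And>j. norm (\<phi> j) \<le> D"
    and \<phi>e: "\<And>j m. blinfun_apply (\<phi> j) (e m) = rademacher m j"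
    using copy_imp_sign_functionals[OF copy] by metis
  obtain U where "free_ultrafilter U" using free_ultrafilter_exists by blast
  then interpret free_ultrafilter U .
  define \<Lambda> where "\<Lambda> = dyadic_mean U"
  have mean: "subprobability_mean \<Lambda>" unfolding \<Lambda>_def by (rule dyadic_mean_subprobability)
  interpret \<Lambda>: subprobability_mean \<Lambda> by (rule mean)
  have rb: "bounded_fun (rademacher n)" for n by (rule bounded_funI[of _ 1]) simp
  have cell: "\<Lambda> (\<lambda>j. of_bool (j mod 2 ^ N = i)) \<le> 1 / 2 ^ N" for N i :: nat
  proof -
    have "\<Lambda> (\<lambda>j. of_bool (j mod 2 ^ N = i)) = (\<Sum>j<2 ^ N. of_bool (j mod 2 ^ N = i)) / 2 ^ N"
      unfolding \<Lambda>_def by (rule dyadic_mean_periodic) simp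
    also have "(\<Sum>j<2 ^ N. of_bool (j mod 2 ^ N = i)) = (\<Sum>j<2 ^ N. of_bool (j = i) :: real)"
      by (intro sum.cong) auto
    also have "\<dots> \<le> 1" by (simp add: of_bool_def sum.delta)
    finally show ?thesis by (simp add: divide_right_mono)
  qed
  have "\<exists>\<xi> :: 'a \<Rightarrow>\<^sub>L real. norm \<xi> \<le> D \<and>
      (\<forall>x. blinfun_apply \<xi> x = \<Lambda> (\<lambda>j. (2 ^ N * of_bool (j mod 2 ^ N = i)) * blinfun_apply (\<phi> j) x))"
    for N i :: nat
  proof -
    have wb: "bounded_fun (\<lambda>j. 2 ^ N * of_bool (j mod 2 ^ N = i) :: real)"
      by (rule bounded_funI[of _ "2 ^ N"]) simp
    have cb: "bounded_fun (\<lambda>j. of_bool (j mod 2 ^ N = i) :: real)"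
      by (rule bounded_funI[of _ 1]) simp
    have "\<Lambda> (\<lambda>j. \<bar>2 ^ N * of_bool (j mod 2 ^ N = i)\<bar>) = 2 ^ N * \<Lambda> (\<lambda>j. of_bool (j mod 2 ^ N = i))"
      by (simp add: \<Lambda>.scale[OF cb, symmetric] abs_mult)
    also have "\<dots> \<le> 2 ^ N * (1 / 2 ^ N)" by (intro mult_left_mono cell) simp
    finally have "\<Lambda> (\<lambda>j. \<bar>2 ^ N * of_bool (j mod 2 ^ N = i)\<bar>) \<le> 1" by simp
    from averaged_functional[where \<phi> = \<phi>, OF mean wb \<phi> zero_le_one this] show ?thesis by simp
  qed
  then obtain \<psi> :: "nat \<Rightarrow> nat \<Rightarrow> 'a \<Rightarrow>\<^sub>L real" where \<psi>: "\<And>N i. norm (\<psi> N i) \<le> D"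
    "\<And>N i x. blinfun_apply (\<psi> N i) x = \<Lambda> (\<lambda>j. (2 ^ N * of_bool (j mod 2 ^ N = i)) * blinfun_apply (\<phi> j) x)"
    by metis
  have "\<exists>\<xi> :: 'a \<Rightarrow>\<^sub>L real. \<forall>x. blinfun_apply \<xi> x = \<Lambda> (\<lambda>j. rademacher n j * blinfun_apply (\<phi> j) x)" for n
  proof -
    have "\<Lambda> (\<lambda>j. \<bar>rademacher n j\<bar>) \<le> 1" using \<Lambda>.one_le by simp
    from averaged_functional[where \<phi> = \<phi>, OF mean rb \<phi> zero_le_one this] show ?thesis by blast
  qed
  then obtain a :: "nat \<Rightarrow> 'a \<Rightarrow>\<^sub>L real" where
    a: "\<And>n x. blinfun_apply (a n) x = \<Lambda> (\<lambda>j. rademacher n j * blinfun_apply (\<phi> j) x)"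
    by metis
  have \<phi>b: "bounded_fun (\<lambda>j. blinfun_apply (\<phi> j) x)" for x
  proof (rule bounded_funI)
    fix j
    have "norm (blinfun_apply (\<phi> j) x) \<le> norm (\<phi> j) * norm x" by (rule norm_blinfun)
    also have "\<dots> \<le> D * norm x" using \<phi> by (intro mult_right_mono) auto
    finally show "\<bar>blinfun_apply (\<phi> j) x\<bar> \<le> D * norm x" by simp
  qed
  have average: "a n = (1 / 2 ^ N) *\<^sub>R (\<Sum>i<2 ^ N. rademacher n i *\<^sub>R \<psi> N i)" if "n < N" for n N
  proof (rule blinfun_eqI)
    fix x
    have wb: "bounded_fun (\<lambda>j. (2 ^ N * of_bool (j mod 2 ^ N = i)) * blinfun_apply (\<phi> j) x)" for i
      by (intro bounded_fun_mult \<phi>b bounded_fun_const bounded_funI[of "\<lambda>j. of_bool (j mod 2 ^ N = i)" 1]) simp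
    have "blinfun_apply ((1 / 2 ^ N) *\<^sub>R (\<Sum>i<2 ^ N. rademacher n i *\<^sub>R \<psi> N i)) x
        = (\<Sum>i<2 ^ N. (rademacher n i / 2 ^ N) * blinfun_apply (\<psi> N i) x)"
      by (simp add: blinfun.scaleR_left blinfun.sum_left sum_distrib_left)
    also have "\<dots> = (\<Sum>i<2 ^ N. \<Lambda> (\<lambda>j. (rademacher n i / 2 ^ N) *
        ((2 ^ N * of_bool (j mod 2 ^ N = i)) * blinfun_apply (\<phi> j) x)))"
      unfolding \<psi>(2) by (simp only: \<Lambda>.scale[OF wb])
    also have "\<dots> = \<Lambda> (\<lambda>j. \<Sum>i<2 ^ N. (rademacher n i / 2 ^ N) *
        ((2 ^ N * of_bool (j mod 2 ^ N = i)) * blinfun_apply (\<phi> j) x))"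
      by (rule \<Lambda>.sum[symmetric]) (intro bounded_fun_mult bounded_fun_const wb)
    also have "\<dots> = \<Lambda> (\<lambda>j. rademacher n j * blinfun_apply (\<phi> j) x)"
    proof (rule arg_cong[of _ _ \<Lambda>], rule ext)
      fix j :: nat
      have "(\<Sum>i<2 ^ N. (rademacher n i / 2 ^ N) * ((2 ^ N * of_bool (j mod 2 ^ N = i)) * blinfun_apply (\<phi> j) x))
          = (\<Sum>i<2 ^ N. if i = j mod 2 ^ N then rademacher n i * blinfun_apply (\<phi> j) x else 0)"
        by (intro sum.cong) auto
      also have "\<dots> = rademacher n (j mod 2 ^ N) * blinfun_apply (\<phi> j) x"
        by (simp add: sum.delta)
      finally show "(\<Sum>i<2 ^ N. (rademacher n i / 2 ^ N) * ((2 ^ N * of_bool (j mod 2 ^ N = i)) * blinfun_apply (\<phi> j) x))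
          = rademacher n j * blinfun_apply (\<phi> j) x"
        by (simp add: rademacher_mod[OF that])
    qed
    finally show "blinfun_apply (a n) x
        = blinfun_apply ((1 / 2 ^ N) *\<^sub>R (\<Sum>i<2 ^ N. rademacher n i *\<^sub>R \<psi> N i)) x"
      by (simp add: a)
  qed
  have ae: "blinfun_apply (a n) (e m) = of_bool (n = m)" for n m
    unfolding a \<phi>e \<Lambda>_def by (rule dyadic_mean_rademacher)
  have "limited p (range a)"
    by (rule bounded_tree_averages_limited[OF p \<psi>(1) average])
  moreover have "\<not> compact (closure (range a))"
  proof (rule separated_not_relatively_compact[of "1 / E"])
    fix n m :: nat assume "n \<noteq> m"
    then have "1 = norm (blinfun_apply (a n - a m) (e n))"
      by (simp add: blinfun.diff_left ae)
    also have "\<dots> \<le> norm (a n - a m) * norm (e n)" by (rule norm_blinfun)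
    also have "\<dots> \<le> norm (a n - a m) * E" using e by (intro mult_left_mono) auto
    finally show "1 / E \<le> dist (a n) (a m)" using E by (simp add: dist_norm field_simps)
  qed (use E in simp)
  ultimately show ?thesis unfolding weak_GP_property_def by blast
qed

theorem corollary2p10:
  fixes p :: real
  assumes "1 \<le> p"
  shows "\<not> contains_copy_of_ell1 TYPE('a::banach) \<longleftrightarrow>
         weak_GP_property p TYPE('a \<Rightarrow>\<^sub>L real)"
  using contains_ell1_imp_not_weak_GP[OF assms] not_contains_ell1_imp_weak_GP[OF assms] by blast

end
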